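(* Let $M$ and $M'$ be pure motives over $\mathbb{Q}$ with coefficients in a number field $\mathbb{E}$. Suppose that: (1) the rank $d(M)$ of $M$ is even and the rank $d(M')$ of $M'$ is odd; (2) all the nonzero Hodge numbers $h^{p,q}_{M}$ and $h^{p,q}_{M'}$ are equal to $1$; (3) the tensor product motive $M\otimes M'$ is critical. (Hypotheses (1) and (2) imply that $M$ and $M'$ are critical and that complex conjugation acts by a scalar $\epsilon(M')\in\{\pm1\}$ on the one-dimensional middle Hodge type of $M'$.) Then, in $(\mathbb{E}\otimes_{\mathbb{Q}}\mathbb{C})^\times/\mathbb{E}^\times$, \[ \frac{c^{+}(M\otimes M')}{c^{-}(M\otimes M')} \;=\; \left( \frac{c^{+}(M)}{c^{-}(M)}\right)^{\epsilon(M')}. \]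
   Context: Motives are understood through their realizations in the sense of Deligne. For a pure motive $M$ over $\mathbb{Q}$ with coefficients in $\mathbb{E}$: the Betti realization $H_B(M)$ is a finite-dimensional $\mathbb{E}$-vector space of dimension $d(M)$ (the rank), with an $\mathbb{E}$-linear involution $\rho$ (complex conjugation); $H_B^{\pm}(M)$ are its $\pm1$-eigenspaces, of dimensions $d^{\pm}(M)$. There is a Hodge decomposition $H_B(M)\otimes_{\mathbb{Q}}\mathbb{C}=\bigoplus_{p+q=w}H^{p,q}(M)$ (purity of weight $w$), with $H^{p,q}(M)$ free $\mathbb{E}\otimes\mathbb{C}$-modules of rank $h^{p,q}_M$ (the Hodge numbers) and $\rho(H^{p,q})=H^{q,p}$; the middle Hodge type is $H^{w/2,w/2}(M)$. The de Rham realization $H_{DR}(M)$ is a $d(M)$-dimensional $\mathbb{E}$-vector space with a decreasing Hodge filtration $F^p(M)$, and there is a comparison isomorphism $I:H_B(M)\otimes_{\mathbb{Q}}\mathbb{C}\to H_{DR}(M)\otimes_{\mathbb{Q}}\mathbb{C}$ with $I(\bigoplus_{p'\ge p}H^{p',q})=F^p(M)\otimes\mathbb{C}$. $M$ is critical if there are filtration steps $F^{\pm}(M)$ of the Hodge filtration with $\dim_{\mathbb{E}} H_{DR}(M)/F^{\mp}(M)=d^{\pm}(M)$ (equivalently, when a middle Hodge type exists, $\rho$ acts on it by a scalar). Deligne's periods $c^{\pm}(M)\in(\mathbb{E}\otimes_{\mathbb{Q}}\mathbb{C})^\times/\mathbb{E}^\times$ are the determinants of the composite isomorphisms $H_B^{\pm}(M)\otimes\mathbb{C}\to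 H_B(M)\otimes\mathbb{C}\xrightarrow{I}H_{DR}(M)\otimes\mathbb{C}\to (H_{DR}(M)/F^{\mp}(M))\otimes\mathbb{C}$, computed with respect to $\mathbb{E}$-rational bases (well defined modulo $\mathbb{E}^\times$). Tensor products of motives have realizations the tensor products of the realizations. *)

theory Defs
  imports
    "HOL-Library.Multiset"
    "HOL-Algebra.Coset"
    "Jordan_Normal_Form.Determinant"
    Complex_Main
begin

section \<open>Tensor products over the rationals\<close>

text \<open>
  The tensor product of two abelian groups: formal sums of pairs modulo the congruence generated by
  biadditivity. All groups below are vector spaces over the rationals (they carry a vector space
  structure over a field of characteristic 0); for these the tensor products over the integers and
  over the rationals are the same, see \<open>tens_rat_balanced\<close>.
\<close>

inductive tens_eq :: "('a::ab_group_add \<times> 'b::ab_group_add) multiset \<Rightarrow> ('a \<times> 'b) multiset \<Rightarrow> bool"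
  where
    refl: "tens_eq x x"
  | sym: "tens_eq x y \<Longrightarrow> tens_eq y x"
  | trans: "tens_eq x y \<Longrightarrow> tens_eq y z \<Longrightarrow> tens_eq x z"
  | add: "tens_eq x y \<Longrightarrow> tens_eq (x + z) (y + z)"
  | zero: "tens_eq {#(0, 0)#} {#}"
  | left: "tens_eq {#(a + a', b)#} ({#(a, b)#} + {#(a', b)#})"
  | right: "tens_eq {#(a, b + b')#} ({#(a, b)#} + {#(a, b')#})"

quotient_type (overloaded) ('a, 'b) tensor =
  "('a::ab_group_add \<times> 'b::ab_group_add) multiset" / tens_eq
  by (intro equivpI reflpI sympI transpI)
     (auto intro: tens_eq.refl tens_eq.sym tens_eq.trans)

lift_definition tens :: "'a::ab_group_add \<Rightarrow> 'b::ab_group_add \<Rightarrow> ('a, 'b) tensor"  (infixl "\<otimes>\<^sub>\<rat>" 75)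
  is "\<lambda>a b. {#(a, b)#}" .

lemma tens_eq_plus:
  assumes "tens_eq x y" "tens_eq x' y'"
  shows "tens_eq (x + x') (y + y')"
proof -
  have "tens_eq (x + x') (y + x')" using assms(1) by (rule tens_eq.add)
  moreover have "tens_eq (x' + y) (y' + y)" using assms(2) by (rule tens_eq.add)
  ultimately show ?thesis by (metis tens_eq.trans add.commute)
qed

lemma tens_eq_zero_left: "tens_eq {#(0, b)#} {#}"
proof -
  let ?e = "{#(0::'a, b)#}" and ?f = "{#(0::'a, - b)#}"
  have "tens_eq {#(0::'a, 0::'b)#} (?e + ?f)"
    using tens_eq.right[of "0::'a" b "- b"] by (simp add: add_mset_commute)
  with tens_eq.zero have ef: "tens_eq {#} (?e + ?f)"
    by (blast intro: tens_eq.sym tens_eq.trans)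
  have ee: "tens_eq ?e (?e + ?e)"
    using tens_eq.left[of "0::'a" "0::'a" b] by simp
  have "tens_eq (?e + ?f) ((?e + ?e) + ?f)" using ee by (rule tens_eq.add)
  also have "(?e + ?e) + ?f = ?e + (?e + ?f)" by (rule add.assoc)
  finally have "tens_eq (?e + ?f) (?e + (?e + ?f))" .
  moreover have "tens_eq (?e + (?e + ?f)) (?e + {#})"
    by (rule tens_eq_plus[OF tens_eq.refl tens_eq.sym[OF ef]])
  ultimately have "tens_eq (?e + ?f) (?e + {#})" by (rule tens_eq.trans)
  then have "tens_eq {#} (?e + {#})" by (rule tens_eq.trans[OF ef])
  then show ?thesis by (simp add: tens_eq.sym)
qed

lemma tens_eq_uminus:
  assumes "tens_eq x y"
  shows "tens_eq (image_mset (\<lambda>(a, b). (- a, b)) x) (image_mset (\<lambda>(a, b). (- a, b)) y)"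
  using assms
proof (induction rule: tens_eq.induct)
  case (left a a' b)
  show ?case using tens_eq.left[of "- a" "- a'" b] by simp
next
  case (right a b b')
  show ?case using tens_eq.right[of "- a" b b'] by simp
qed (auto intro: tens_eq.intros)

lemma tens_eq_left_minus: "tens_eq (image_mset (\<lambda>(a, b). (- a, b)) x + x) {#}"
proof (induction x)
  case empty
  show ?case by (simp add: tens_eq.refl)
next
  case (add p x)
  obtain a b where p: "p = (a, b)" by (cases p)
  have "tens_eq {#(- a + a, b)#} {#}" by (simp add: tens_eq_zero_left)
  then have "tens_eq ({#(- a, b)#} + {#(a, b)#}) {#}"
    by (rule tens_eq.trans[OF tens_eq.sym[OF tens_eq.left]])
  from tens_eq_plus[OF this add] show ?case by (simp add: p add_mset_commute)
qed

instantiation tensor :: (ab_group_add, ab_group_add) ab_group_add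
begin

lift_definition zero_tensor :: "('a, 'b) tensor" is "{#}" .

lift_definition plus_tensor :: "('a, 'b) tensor \<Rightarrow> ('a, 'b) tensor \<Rightarrow> ('a, 'b) tensor"
  is "(+)" by (rule tens_eq_plus)

lift_definition uminus_tensor :: "('a, 'b) tensor \<Rightarrow> ('a, 'b) tensor"
  is "image_mset (\<lambda>(a, b). (- a, b))" by (rule tens_eq_uminus)

definition minus_tensor :: "('a, 'b) tensor \<Rightarrow> ('a, 'b) tensor \<Rightarrow> ('a, 'b) tensor"
  where "minus_tensor x y = x + - y"

instance
proof
  fix x y z :: "('a, 'b) tensor"
  show "x + y + z = x + (y + z)" by transfer (simp add: tens_eq.refl add.assoc)
  show "x + y = y + x" by transfer (simp add: tens_eq.refl add.commute)
  show "0 + x = x" by transfer (simp add: tens_eq.refl)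
  show "- x + x = 0" by transfer (rule tens_eq_left_minus)
  show "x - y = x + - y" by (rule minus_tensor_def)
qed

end

lemma tens_add_left: "(a + a') \<otimes>\<^sub>\<rat> b = a \<otimes>\<^sub>\<rat> b + a' \<otimes>\<^sub>\<rat> b"
  by transfer (rule tens_eq.left)

lemma tens_add_right: "a \<otimes>\<^sub>\<rat> (b + b') = a \<otimes>\<^sub>\<rat> b + a \<otimes>\<^sub>\<rat> b'"
  by transfer (rule tens_eq.right)

lemma tensor_induct [case_names zero add, induct type: tensor]:
  assumes zero: "P 0" and add: "\<And>a b x. P x \<Longrightarrow> P (a \<otimes>\<^sub>\<rat> b + x)"
  shows "P x"
proof -
  have "P (abs_tensor m)" for m
  proof (induction m)
    case empty
    then show ?case using zero by (simp add: zero_tensor_def)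
  next
    case (add p m)
    obtain a b where p: "p = (a, b)" by (cases p)
    have "abs_tensor (add_mset p m) = a \<otimes>\<^sub>\<rat> b + abs_tensor m"
      by (simp add: p tens.abs_eq plus_tensor.abs_eq)
    then show ?case using assms(2)[OF add] by simp
  qed
  then show ?thesis by (metis Quotient_tensor Quotient_abs_rep)
qed

definition biadditive :: "('a::ab_group_add \<Rightarrow> 'b::ab_group_add \<Rightarrow> 'c::ab_group_add) \<Rightarrow> bool"
  where "biadditive f \<longleftrightarrow>
    (\<forall>a a' b. f (a + a') b = f a b + f a' b) \<and> (\<forall>a b b'. f a (b + b') = f a b + f a b')"

text \<open>
  The additive map on the tensor product induced by \<open>f\<close>. It is independent of the chosen
  representative if \<open>f\<close> is biadditive; it is only used for such \<open>f\<close>.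
\<close>

definition tlift :: "('a::ab_group_add \<Rightarrow> 'b::ab_group_add \<Rightarrow> 'c::ab_group_add) \<Rightarrow> ('a, 'b) tensor \<Rightarrow> 'c"
  where "tlift f x = (\<Sum>(a, b) \<in># rep_tensor x. f a b)"

lemma biadditive_zero:
  assumes "biadditive f"
  shows "f 0 b = 0" "f a 0 = 0"
  using assms unfolding biadditive_def by (metis add.right_neutral add_cancel_right_right)+

lemma tlift_abs:
  assumes f: "biadditive f"
  shows "tlift f (abs_tensor m) = (\<Sum>(a, b) \<in># m. f a b)"
proof -
  have "(\<Sum>(a, b) \<in># x. f a b) = (\<Sum>(a, b) \<in># y. f a b)" if "tens_eq x y" for x y
    using that
  proof (induction rule: tens_eq.induct)
    case zero
    show ?case using biadditive_zero[OF f] by simp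
  next
    case (left a a' b)
    show ?case using f by (simp add: biadditive_def)
  next
    case (right a b b')
    show ?case using f by (simp add: biadditive_def)
  qed auto
  moreover have "tens_eq (rep_tensor (abs_tensor m)) m"
    using rep_abs_rsp_left[OF Quotient3_tensor] tens_eq.refl by metis
  ultimately show ?thesis unfolding tlift_def by blast
qed

lemma tlift_tens: "biadditive f \<Longrightarrow> tlift f (a \<otimes>\<^sub>\<rat> b) = f a b"
  by (simp add: tens.abs_eq tlift_abs)

lemma tlift_zero: "biadditive f \<Longrightarrow> tlift f 0 = 0"
  by (simp add: zero_tensor_def tlift_abs)

lemma tlift_add:
  assumes f: "biadditive f"
  shows "tlift f (x + y) = tlift f x + tlift f y"
proof -
  obtain m n where "x = abs_tensor m" "y = abs_tensor n"
    by (metis Quotient_tensor Quotient_abs_rep)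
  then show ?thesis by (simp add: plus_tensor.abs_eq tlift_abs[OF f])
qed

lemma tens_zero: "0 \<otimes>\<^sub>\<rat> b = 0" "a \<otimes>\<^sub>\<rat> 0 = 0"
  using biadditive_zero[of "(\<otimes>\<^sub>\<rat>)"] by (auto simp: biadditive_def tens_add_left tens_add_right)

lemma tens_of_nat_balanced:
  fixes s :: "'e::field_char_0 \<Rightarrow> 'v::ab_group_add \<Rightarrow> 'v"
    and t :: "'f::field_char_0 \<Rightarrow> 'w::ab_group_add \<Rightarrow> 'w"
  assumes "vector_space s" "vector_space t"
  shows "s (of_nat n) v \<otimes>\<^sub>\<rat> w = v \<otimes>\<^sub>\<rat> t (of_nat n) w"
proof -
  interpret S: vector_space s by fact
  interpret T: vector_space t by fact
  show ?thesis
    by (induction n)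
       (simp_all add: tens_zero S.scale_left_distrib T.scale_left_distrib tens_add_left tens_add_right)
qed

lemma tens_rat_balanced:
  fixes s :: "'e::field_char_0 \<Rightarrow> 'v::ab_group_add \<Rightarrow> 'v"
    and t :: "'f::field_char_0 \<Rightarrow> 'w::ab_group_add \<Rightarrow> 'w"
  assumes "vector_space s" "vector_space t"
  shows "s (of_rat q) v \<otimes>\<^sub>\<rat> w = v \<otimes>\<^sub>\<rat> t (of_rat q) w"
proof -
  interpret S: vector_space s by fact
  interpret T: vector_space t by fact
  note bal = tens_of_nat_balanced[OF assms]
  have pos: "s (of_rat (of_nat m / of_nat n)) v \<otimes>\<^sub>\<rat> w = v \<otimes>\<^sub>\<rat> t (of_rat (of_nat m / of_nat n)) w"
    if n: "n > 0" for m n :: nat and v w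
  proof -
    let ?v = "s (1 / of_nat n) v" and ?w = "t (1 / of_nat n) w"
    have 1: "s (of_rat (of_nat m / of_nat n)) v = s (of_nat m) ?v"
      "t (of_rat (of_nat m / of_nat n)) w = t (of_nat m) ?w"
      by (simp_all add: of_rat_divide)
    have 2: "s (of_nat n) ?v = v" "t (of_nat n) ?w = w"
      using n by simp_all
    have "s (of_nat m) ?v \<otimes>\<^sub>\<rat> w = s (of_nat m) ?v \<otimes>\<^sub>\<rat> t (of_nat n) ?w" by (simp only: 2)
    also have "\<dots> = s (of_nat n) (s (of_nat m) ?v) \<otimes>\<^sub>\<rat> ?w" by (rule bal[symmetric])
    also have "\<dots> = s (of_nat m) v \<otimes>\<^sub>\<rat> ?w" by (subst S.scale_left_commute) (simp only: 2)
    also have "\<dots> = v \<otimes>\<^sub>\<rat> t (of_nat m) ?w" by (rule bal)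
    finally show ?thesis by (simp add: 1)
  qed
  obtain a b where q: "q = of_int a / of_int b" and b: "b > 0"
    by (metis Fract_of_int_quotient Rat_cases)
  show ?thesis
  proof (cases "a \<ge> 0")
    case True
    then have "q = of_nat (nat a) / of_nat (nat b)" using q b by simp
    then show ?thesis using pos[of "nat b" "nat a" v w] b by simp
  next
    case False
    then have q': "q = - (of_nat (nat (- a)) / of_nat (nat b))" using q b by simp
    have "s (of_rat q) v = s (of_rat (of_nat (nat (- a)) / of_nat (nat b))) (- v)"
      by (simp only: q' of_rat_minus S.scale_minus_left S.scale_minus_right)
    moreover have "t (of_rat q) w = t (of_rat (of_nat (nat (- a)) / of_nat (nat b))) (- w)"
      by (simp only: q' of_rat_minus T.scale_minus_left T.scale_minus_right)
    moreover have "(- x) \<otimes>\<^sub>\<rat> y = x \<otimes>\<^sub>\<rat> (- y)" for x :: 'v and y :: 'w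
    proof -
      have "(- x) \<otimes>\<^sub>\<rat> y + x \<otimes>\<^sub>\<rat> y = x \<otimes>\<^sub>\<rat> (- y) + x \<otimes>\<^sub>\<rat> y"
        by (simp flip: tens_add_left tens_add_right add: tens_zero)
      then show ?thesis by simp
    qed
    moreover have "s (of_rat (of_nat (nat (- a)) / of_nat (nat b))) (- v) \<otimes>\<^sub>\<rat> w =
        (- v) \<otimes>\<^sub>\<rat> t (of_rat (of_nat (nat (- a)) / of_nat (nat b))) w"
      by (rule pos) (use b in simp)
    ultimately show ?thesis by (simp only: T.scale_minus_right)
  qed
qed

text \<open>The map determined by \<open>(a \<otimes> b, a' \<otimes> b') \<mapsto> f a a' \<otimes> g b b'\<close>.\<close>

definition tmap2 ::
  "('a::ab_group_add \<Rightarrow> 'a'::ab_group_add \<Rightarrow> 'c::ab_group_add) \<Rightarrow>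
   ('b::ab_group_add \<Rightarrow> 'b'::ab_group_add \<Rightarrow> 'd::ab_group_add) \<Rightarrow>
   ('a, 'b) tensor \<Rightarrow> ('a', 'b') tensor \<Rightarrow> ('c, 'd) tensor"
  where "tmap2 f g x y = tlift (\<lambda>a b. tlift (\<lambda>a' b'. f a a' \<otimes>\<^sub>\<rat> g b b') y) x"

lemma biadditive_tmap2_inner:
  assumes "biadditive f" "biadditive g"
  shows "biadditive (\<lambda>a' b'. f a a' \<otimes>\<^sub>\<rat> g b b')"
  using assms by (simp add: biadditive_def tens_add_left tens_add_right)

lemma biadditive_tmap2_outer:
  assumes f: "biadditive f" and g: "biadditive g"
  shows "biadditive (\<lambda>a b. tlift (\<lambda>a' b'. f a a' \<otimes>\<^sub>\<rat> g b b') y)"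
proof (induction y)
  case zero
  show ?case by (simp add: tlift_zero[OF biadditive_tmap2_inner[OF f g]] biadditive_def)
next
  case (add a' b' y)
  have "biadditive (\<lambda>a b. f a a' \<otimes>\<^sub>\<rat> g b b')"
    using f g by (simp add: biadditive_def tens_add_left tens_add_right)
  with add show ?case
    by (simp add: tlift_add[OF biadditive_tmap2_inner[OF f g]]
        tlift_tens[OF biadditive_tmap2_inner[OF f g]] biadditive_def algebra_simps)
qed

lemma tmap2_left:
  assumes "biadditive f" "biadditive g"
  shows "tmap2 f g 0 y = 0"
    "tmap2 f g (x + x') y = tmap2 f g x y + tmap2 f g x' y"
    "tmap2 f g (a \<otimes>\<^sub>\<rat> b) y = tlift (\<lambda>a' b'. f a a' \<otimes>\<^sub>\<rat> g b b') y"
  unfolding tmap2_def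
  using biadditive_tmap2_outer[OF assms] by (simp_all add: tlift_zero tlift_add tlift_tens)

lemma tmap2_tens:
  assumes "biadditive f" "biadditive g"
  shows "tmap2 f g (a \<otimes>\<^sub>\<rat> b) (a' \<otimes>\<^sub>\<rat> b') = f a a' \<otimes>\<^sub>\<rat> g b b'"
  by (simp add: tmap2_left(3)[OF assms] tlift_tens[OF biadditive_tmap2_inner[OF assms]])

lemma biadditive_tmap2:
  assumes "biadditive f" "biadditive g"
  shows "biadditive (tmap2 f g)"
proof -
  have "tmap2 f g x (y + y') = tmap2 f g x y + tmap2 f g x y'" for x y y'
    by (induction x)
       (simp_all add: tmap2_left[OF assms] tlift_add[OF biadditive_tmap2_inner[OF assms]])
  then show ?thesis
    by (simp add: biadditive_def tmap2_left(2)[OF assms])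
qed

lemma tmap2_add:
  assumes "biadditive f" "biadditive g"
  shows "tmap2 f g (x + x') y = tmap2 f g x y + tmap2 f g x' y"
    "tmap2 f g x (y + y') = tmap2 f g x y + tmap2 f g x y'"
  using biadditive_tmap2[OF assms] by (auto simp: biadditive_def)

lemma tmap2_zero:
  assumes "biadditive f" "biadditive g"
  shows "tmap2 f g 0 y = 0" "tmap2 f g x 0 = 0"
  using biadditive_zero[OF biadditive_tmap2[OF assms]] by auto

lemma tmap2_assoc:
  assumes biadd: "biadditive f" "biadditive g" "biadditive f'" "biadditive g'"
      "biadditive h" "biadditive k" "biadditive h'" "biadditive k'"
    and f: "\<And>a b c. f a (f' b c) = h (h' a b) c"
    and g: "\<And>a b c. g a (g' b c) = k (k' a b) c"
  shows "tmap2 f g x (tmap2 f' g' y z) = tmap2 h k (tmap2 h' k' x y) z"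
proof (induction x)
  case (add a b x)
  have "tmap2 f g (a \<otimes>\<^sub>\<rat> b) (tmap2 f' g' y z) = tmap2 h k (tmap2 h' k' (a \<otimes>\<^sub>\<rat> b) y) z"
  proof (induction y)
    case (add a' b' y)
    have "tmap2 f g (a \<otimes>\<^sub>\<rat> b) (tmap2 f' g' (a' \<otimes>\<^sub>\<rat> b') z) =
        tmap2 h k (tmap2 h' k' (a \<otimes>\<^sub>\<rat> b) (a' \<otimes>\<^sub>\<rat> b')) z"
      by (induction z) (simp_all add: tmap2_zero tmap2_add tmap2_tens biadd f g)
    with add show ?case by (simp add: tmap2_add biadd)
  qed (simp add: tmap2_zero biadd)
  with add show ?case by (simp add: tmap2_add biadd)
qed (simp add: tmap2_zero biadd)

lemma biadditive_times: "biadditive ((*) :: 'a::ring \<Rightarrow> 'a \<Rightarrow> 'a)"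
  by (simp add: biadditive_def distrib_left distrib_right)

instantiation tensor :: (field_char_0, field_char_0) comm_ring_1
begin

definition one_tensor :: "('a, 'b) tensor"
  where "one_tensor = 1 \<otimes>\<^sub>\<rat> 1"

definition times_tensor :: "('a, 'b) tensor \<Rightarrow> ('a, 'b) tensor \<Rightarrow> ('a, 'b) tensor"
  where "times_tensor = tmap2 (*) (*)"

instance
proof
  fix x y z :: "('a, 'b) tensor"
  note t = biadditive_times[where 'a = 'a] biadditive_times[where 'a = 'b]
  show "x * y * z = x * (y * z)"
    unfolding times_tensor_def by (rule tmap2_assoc[symmetric]) (simp_all add: t mult.assoc)
  have *: "(a \<otimes>\<^sub>\<rat> b) * y = y * (a \<otimes>\<^sub>\<rat> b)" for a :: 'a and b :: 'b
    unfolding times_tensor_def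
    by (induction y) (simp_all add: tmap2_zero tmap2_add tmap2_tens t mult.commute)
  show "x * y = y * x"
    by (induction x) (use * in \<open>simp_all add: times_tensor_def tmap2_zero tmap2_add t\<close>)
  show "1 * x = x"
    unfolding times_tensor_def one_tensor_def
    by (induction x) (simp_all add: tmap2_zero tmap2_add tmap2_tens t)
  show "(x + y) * z = x * z + y * z"
    unfolding times_tensor_def by (simp add: tmap2_add t)
  show "(0::('a, 'b) tensor) \<noteq> 1"
  proof
    assume eq: "(0::('a, 'b) tensor) = 1"
    define sa where "sa = (\<lambda>(q::rat) (x::'a). of_rat q * x)"
    define sb where "sb = (\<lambda>(q::rat) (x::'b). of_rat q * x)"
    define sq where "sq = (\<lambda>(q::rat) (x::rat). q * x)"
    interpret A: vector_space_pair sa sq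
      by standard (simp_all add: sa_def sq_def algebra_simps of_rat_add of_rat_mult)
    interpret B: vector_space_pair sb sq
      by standard (simp_all add: sb_def sq_def algebra_simps of_rat_add of_rat_mult)
    have "A.vs1.independent {1}" by simp
    then obtain \<phi> where \<phi>: "Vector_Spaces.linear sa sq \<phi>" "\<phi> 1 = 1"
      using A.linear_independent_extend[of "{1}" "\<lambda>_. 1"] by auto
    have "B.vs1.independent {1}" by simp
    then obtain \<psi> where \<psi>: "Vector_Spaces.linear sb sq \<psi>" "\<psi> 1 = 1"
      using B.linear_independent_extend[of "{1}" "\<lambda>_. 1"] by auto
    interpret P: Vector_Spaces.linear sa sq \<phi> by fact
    interpret Q: Vector_Spaces.linear sb sq \<psi> by fact
    have f: "biadditive (\<lambda>a b. \<phi> a * \<psi> b)"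
      by (simp add: biadditive_def P.add Q.add algebra_simps)
    show False
      using tlift_tens[OF f, of 1 1] tlift_zero[OF f] eq \<phi>(2) \<psi>(2) by (simp add: one_tensor_def)
  qed
qed

end


section \<open>Complexification\<close>

text \<open>
  \<open>'a cx\<close> is the tensor product of \<open>'a\<close> and the complex numbers over the rationals. If \<open>'a\<close> is a
  field, it is a commutative ring; if \<open>s\<close> is the scalar multiplication of an \<open>'e\<close>-vector space
  \<open>'v\<close>, then \<open>cext s\<close> is the scalar multiplication of the \<open>'e cx\<close>-module \<open>'v cx\<close>.
\<close>

type_synonym 'a cx = "('a, complex) tensor"

definition cext :: "('a::ab_group_add \<Rightarrow> 'b::ab_group_add \<Rightarrow> 'c::ab_group_add) \<Rightarrow> 'a cx \<Rightarrow> 'b cx \<Rightarrow> 'c cx"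
  where "cext f = tmap2 f (*)"

definition cmap :: "('a::ab_group_add \<Rightarrow> 'b::ab_group_add) \<Rightarrow> 'a cx \<Rightarrow> 'b cx"
  where "cmap f = tlift (\<lambda>v z. f v \<otimes>\<^sub>\<rat> z)"

lemma module_cext:
  fixes s :: "'e::field_char_0 \<Rightarrow> 'v::ab_group_add \<Rightarrow> 'v"
  assumes "vector_space s"
  shows "Modules.module (cext s)"
proof -
  interpret vector_space s by fact
  have s: "biadditive s" by (simp add: biadditive_def scale_left_distrib scale_right_distrib)
  note b = s biadditive_times[where 'a = complex] biadditive_times[where 'a = 'e]
  show ?thesis
  proof
    fix a b :: "'e cx" and x y :: "'v cx"
    show "cext s a (x + y) = cext s a x + cext s a y" "cext s (a + b) x = cext s a x + cext s b x"
      unfolding cext_def by (simp_all add: tmap2_add b)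
    show "cext s a (cext s b x) = cext s (a * b) x"
      unfolding cext_def times_tensor_def
      by (rule tmap2_assoc) (simp_all add: b mult.assoc)
    show "cext s 1 x = x"
      unfolding cext_def one_tensor_def
      by (induction x) (simp_all add: tmap2_zero tmap2_add tmap2_tens b)
  qed
qed


section \<open>Linear algebra\<close>

text \<open>The additive subgroup generated by the elements \<open>ev \<otimes> w - v \<otimes> ew\<close>, \<open>e\<close> a scalar.\<close>

inductive_set balanced_rel ::
  "('e \<Rightarrow> 'v \<Rightarrow> 'v) \<Rightarrow> ('e \<Rightarrow> 'w \<Rightarrow> 'w) \<Rightarrow> ('v::ab_group_add, 'w::ab_group_add) tensor set"
  for s t
  where
    zero: "0 \<in> balanced_rel s t"
  | generator: "s e v \<otimes>\<^sub>\<rat> w - v \<otimes>\<^sub>\<rat> t e w \<in> balanced_rel s t"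
  | diff: "x \<in> balanced_rel s t \<Longrightarrow> y \<in> balanced_rel s t \<Longrightarrow> x - y \<in> balanced_rel s t"

text \<open>
  \<open>\<tau>\<close> exhibits \<open>(UNIV, u)\<close> as the tensor product over the field \<open>'e\<close> of \<open>(UNIV, s)\<close> and \<open>(UNIV, t)\<close>,
  that is, as the quotient of their tensor product of abelian groups by \<open>balanced_rel s t\<close>.
\<close>

definition is_tensor_product ::
  "('e::field_char_0 \<Rightarrow> 'v::ab_group_add \<Rightarrow> 'v) \<Rightarrow> ('e \<Rightarrow> 'w::ab_group_add \<Rightarrow> 'w) \<Rightarrow>
   ('e \<Rightarrow> 'u::ab_group_add \<Rightarrow> 'u) \<Rightarrow> ('v \<Rightarrow> 'w \<Rightarrow> 'u) \<Rightarrow> bool"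
  where "is_tensor_product s t u \<tau> \<longleftrightarrow>
    biadditive \<tau> \<and>
    (\<forall>e v w. \<tau> (s e v) w = u e (\<tau> v w) \<and> \<tau> v (t e w) = u e (\<tau> v w)) \<and>
    surj (tlift \<tau>) \<and> {x. tlift \<tau> x = 0} = balanced_rel s t"

definition free_of_rank :: "('r::comm_ring_1 \<Rightarrow> 'v::ab_group_add \<Rightarrow> 'v) \<Rightarrow> 'v set \<Rightarrow> nat \<Rightarrow> bool"
  where "free_of_rank s V n \<longleftrightarrow>
    (\<exists>B. finite B \<and> card B = n \<and> \<not> Modules.module.dependent s B \<and> Modules.module.span s B = V)"

definition is_direct_sum :: "('i \<Rightarrow> 'v::ab_group_add set) \<Rightarrow> bool"
  where "is_direct_sum V \<longleftrightarrow>
    (\<forall>x. \<exists>!f. (\<forall>i. f i \<in> V i) \<and> finite {i. f i \<noteq> 0} \<and> x = (\<Sum>i | f i \<noteq> 0. f i))"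

definition ordered_basis :: "('k::field \<Rightarrow> 'v::ab_group_add \<Rightarrow> 'v) \<Rightarrow> 'v set \<Rightarrow> 'v list \<Rightarrow> bool"
  where "ordered_basis s V bs \<longleftrightarrow>
    distinct bs \<and> \<not> Modules.module.dependent s (set bs) \<and> Modules.module.span s (set bs) = V"

text \<open>The classes of \<open>vs\<close> form an ordered basis of the quotient of the whole space by \<open>F\<close>.\<close>

definition quotient_basis :: "('k::field \<Rightarrow> 'v::ab_group_add \<Rightarrow> 'v) \<Rightarrow> 'v set \<Rightarrow> 'v list \<Rightarrow> bool"
  where "quotient_basis s F vs \<longleftrightarrow>
    (\<forall>x. \<exists>!c. c \<in> carrier_vec (length vs) \<and> x - (\<Sum>i<length vs. s (c $ i) (vs ! i)) \<in> F)"

definition codim :: "('k::field \<Rightarrow> 'v::ab_group_add \<Rightarrow> 'v) \<Rightarrow> 'v set \<Rightarrow> nat"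
  where "codim s F = vector_space.dim s UNIV - vector_space.dim s F"


section \<open>Realizations of motives\<close>

definition number_field :: "'e::field_char_0 itself \<Rightarrow> bool"
  where "number_field _ \<longleftrightarrow>
    (\<exists>B::'e set. finite B \<and> Modules.module.span (\<lambda>(q::rat) x. of_rat q * x) B = UNIV)"

text \<open>
  A motive over the rationals with coefficients in \<open>'e\<close>, given by its Betti realization \<open>'b\<close>, its
  de Rham realization \<open>'d\<close> and the comparison isomorphism. \<open>hodge M p q\<close> is the summand of Hodge
  type \<open>(p, q)\<close>, taken to be \<open>{0}\<close> unless \<open>p + q = weight M\<close>.
\<close>

record (overloaded) ('e, 'b, 'd) motive =
  weight :: int
  scaleB :: "'e::field_char_0 \<Rightarrow> 'b::ab_group_add \<Rightarrow> 'b"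
  rho :: "'b \<Rightarrow> 'b"
  hodge :: "int \<Rightarrow> int \<Rightarrow> 'b cx set"
  hodge_number :: "int \<Rightarrow> int \<Rightarrow> nat"
  scaleD :: "'e \<Rightarrow> 'd::ab_group_add \<Rightarrow> 'd"
  hodge_filtration :: "int \<Rightarrow> 'd set"
  comparison :: "'b cx \<Rightarrow> 'd cx"

definition filtration_cx :: "('e::field_char_0, 'b::ab_group_add, 'd::ab_group_add) motive \<Rightarrow> int \<Rightarrow> 'd cx set"
  where "filtration_cx M p =
    Modules.module.span (cext (scaleD M)) ((\<lambda>v. v \<otimes>\<^sub>\<rat> 1) ` hodge_filtration M p)"

definition pure_motive :: "('e::field_char_0, 'b::ab_group_add, 'd::ab_group_add) motive \<Rightarrow> bool"
  where "pure_motive M \<longleftrightarrow>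
    \<comment> \<open>Betti realization\<close>
    vector_space (scaleB M) \<and>
    (\<exists>B. finite B \<and> Modules.module.span (scaleB M) B = UNIV) \<and>
    Vector_Spaces.linear (scaleB M) (scaleB M) (rho M) \<and>
    (\<forall>v. rho M (rho M v) = v) \<and>
    \<comment> \<open>Hodge decomposition\<close>
    (\<forall>p q. p + q \<noteq> weight M \<longrightarrow> hodge M p q = {0}) \<and>
    (\<forall>p q. free_of_rank (cext (scaleB M)) (hodge M p q) (hodge_number M p q)) \<and>
    is_direct_sum (\<lambda>p. hodge M p (weight M - p)) \<and>
    (\<forall>p q. cmap (rho M) ` hodge M p q = hodge M q p) \<and>
    \<comment> \<open>de Rham realization\<close>
    vector_space (scaleD M) \<and>
    (\<exists>B. finite B \<and> Modules.module.span (scaleD M) B = UNIV) \<and>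
    vector_space.dim (scaleD M) UNIV = vector_space.dim (scaleB M) UNIV \<and>
    (\<forall>p. Modules.module.subspace (scaleD M) (hodge_filtration M p)) \<and>
    antimono (hodge_filtration M) \<and>
    \<comment> \<open>comparison isomorphism\<close>
    module_hom (cext (scaleB M)) (cext (scaleD M)) (comparison M) \<and>
    bij (comparison M) \<and>
    (\<forall>p. comparison M ` Modules.module.span (cext (scaleB M)) (\<Union>p'\<in>{p..}. \<Union>q. hodge M p' q) =
      filtration_cx M p)"

text \<open>
  \<open>N\<close> is a tensor product of \<open>M\<close> and \<open>M'\<close>: its realizations, with all their structure, are the
  tensor products over \<open>'e\<close> of the realizations of \<open>M\<close> and \<open>M'\<close>. This determines \<open>N\<close> up to
  isomorphism.
\<close>

definition is_tensor_motive ::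
  "('e::field_char_0, 'b::ab_group_add, 'd::ab_group_add) motive \<Rightarrow>
   ('e, 'b'::ab_group_add, 'd'::ab_group_add) motive \<Rightarrow>
   ('e, 'b''::ab_group_add, 'd''::ab_group_add) motive \<Rightarrow> bool"
  where "is_tensor_motive M M' N \<longleftrightarrow>
    pure_motive N \<and> weight N = weight M + weight M' \<and>
    (\<exists>\<tau>\<^sub>B \<tau>\<^sub>D.
      is_tensor_product (scaleB M) (scaleB M') (scaleB N) \<tau>\<^sub>B \<and>
      is_tensor_product (scaleD M) (scaleD M') (scaleD N) \<tau>\<^sub>D \<and>
      (\<forall>v w. rho N (\<tau>\<^sub>B v w) = \<tau>\<^sub>B (rho M v) (rho M' w)) \<and>
      (\<forall>p q. hodge N p q = Modules.module.span (cext (scaleB N))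
        {cext \<tau>\<^sub>B x y | x y a b. x \<in> hodge M a b \<and> y \<in> hodge M' (p - a) (q - b)}) \<and>
      (\<forall>p. hodge_filtration N p = Modules.module.span (scaleD N)
        {\<tau>\<^sub>D v w | v w a. v \<in> hodge_filtration M a \<and> w \<in> hodge_filtration M' (p - a)}) \<and>
      (\<forall>x y. comparison N (cext \<tau>\<^sub>B x y) = cext \<tau>\<^sub>D (comparison M x) (comparison M' y)))"

definition motive_rank :: "('e::field_char_0, 'b::ab_group_add, 'd::ab_group_add) motive \<Rightarrow> nat"
  where "motive_rank M = vector_space.dim (scaleB M) UNIV"

text \<open>The sign in \<open>H\<^sub>B\<^sup>\<plusminus>\<close>, \<open>d\<^sup>\<plusminus>\<close> and \<open>c\<^sup>\<plusminus>\<close> is an integer \<open>\<sigma>\<close>, either \<open>1\<close> or \<open>-1\<close>.\<close>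

definition betti_eigenspace :: "('e::field_char_0, 'b::ab_group_add, 'd::ab_group_add) motive \<Rightarrow> int \<Rightarrow> 'b set"
  where "betti_eigenspace M \<sigma> = {v. rho M v = scaleB M (of_int \<sigma>) v}"

definition eigen_rank :: "('e::field_char_0, 'b::ab_group_add, 'd::ab_group_add) motive \<Rightarrow> int \<Rightarrow> nat"
  where "eigen_rank M \<sigma> = vector_space.dim (scaleB M) (betti_eigenspace M \<sigma>)"

text \<open>\<open>hodge_filtration M p\<close> is the step \<open>F\<^sup>\<mp>\<close> for the sign \<open>\<sigma> = \<plusminus>\<close>, that is, its codimension is \<open>d\<^sup>\<plusminus>\<close>.\<close>

definition critical_step :: "('e::field_char_0, 'b::ab_group_add, 'd::ab_group_add) motive \<Rightarrow> int \<Rightarrow> int \<Rightarrow> bool"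
  where "critical_step M \<sigma> p \<longleftrightarrow> codim (scaleD M) (hodge_filtration M p) = eigen_rank M \<sigma>"

definition critical :: "('e::field_char_0, 'b::ab_group_add, 'd::ab_group_add) motive \<Rightarrow> bool"
  where "critical M \<longleftrightarrow> (\<forall>\<sigma>\<in>{1, - 1}. \<exists>p. critical_step M \<sigma> p)"


section \<open>Periods\<close>

definition cx_units :: "'e::field_char_0 cx monoid"
  where "cx_units = \<lparr>carrier = {x. x dvd 1}, monoid.mult = (*), one = 1\<rparr>"

definition rational_units :: "'e::field_char_0 cx set"
  where "rational_units = {e \<otimes>\<^sub>\<rat> 1 | e. e \<noteq> 0}"

definition period_group :: "'e::field_char_0 cx set monoid"
  where "period_group = cx_units Mod rational_units"

text \<open>
  \<open>A\<close> is the matrix, in the bases \<open>bs\<close> and \<open>vs\<close>, of the map from \<open>H\<^sub>B\<^sup>\<plusminus> \<otimes> \<complex>\<close> to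
  \<open>(H\<^sub>D\<^sub>R / F\<^sup>\<mp>) \<otimes> \<complex>\<close> induced by the comparison isomorphism; the target is identified with
  the quotient of \<open>H\<^sub>D\<^sub>R \<otimes> \<complex>\<close> by \<open>F\<^sup>\<mp> \<otimes> \<complex>\<close>.
\<close>

definition is_period_matrix ::
  "('e::field_char_0, 'b::ab_group_add, 'd::ab_group_add) motive \<Rightarrow> int \<Rightarrow> 'e cx mat \<Rightarrow> bool"
  where "is_period_matrix M \<sigma> A \<longleftrightarrow>
    (\<exists>p bs vs.
      critical_step M \<sigma> p \<and>
      ordered_basis (scaleB M) (betti_eigenspace M \<sigma>) bs \<and>
      quotient_basis (scaleD M) (hodge_filtration M p) vs \<and>
      A \<in> carrier_mat (length vs) (length bs) \<and>
      (\<forall>j<length bs.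
        comparison M ((bs ! j) \<otimes>\<^sub>\<rat> 1)
          - (\<Sum>i<length vs. cext (scaleD M) (A $$ (i, j)) ((vs ! i) \<otimes>\<^sub>\<rat> 1)) \<in> filtration_cx M p))"

text \<open>
  The class modulo the units of \<open>'e\<close> of the determinants of the period matrices. (The determinants
  alone are not the whole class in rank 0, where the only one is \<open>1\<close>.)
\<close>

definition period :: "('e::field_char_0, 'b::ab_group_add, 'd::ab_group_add) motive \<Rightarrow> int \<Rightarrow> 'e cx set"
  where "period M \<sigma> = {r * det A | r A. r \<in> rational_units \<and> is_period_matrix M \<sigma> A}"

text \<open>There is a nonzero middle Hodge type, and complex conjugation acts on it by \<open>\<epsilon> \<in> {1, - 1}\<close>.\<close>

definition is_middle_sign :: "('e::field_char_0, 'b::ab_group_add, 'd::ab_group_add) motive \<Rightarrow> int \<Rightarrow> bool"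
  where "is_middle_sign M \<epsilon> \<longleftrightarrow>
    \<epsilon> \<in> {1, - 1} \<and>
    (\<exists>p. 2 * p = weight M \<and> hodge M p p \<noteq> {0} \<and>
      (\<forall>x\<in>hodge M p p. cmap (rho M) x = cext (scaleB M) (of_int \<epsilon>) x))"

definition middle_sign :: "('e::field_char_0, 'b::ab_group_add, 'd::ab_group_add) motive \<Rightarrow> int"
  where "middle_sign M = (THE \<epsilon>. is_middle_sign M \<epsilon>)"

end

theory Submission
  imports Defs
begin

text \<open>
  Choose generators \<open>e\<^sub>p\<close> and \<open>e'\<^sub>q\<close> of the Hodge summands of the two motives. Conjugation maps \<open>e\<^sub>p\<close> to a
  multiple of \<open>e\<^sub>w\<^sub>-\<^sub>p\<close>, so the trace of conjugation shows that \<open>d\<^sup>+ = d\<^sup>-\<close> for \<open>M\<close>, and that conjugation acts on the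
  middle type of \<open>M'\<close> by the integer \<open>\<epsilon> = d\<^sup>+ - d\<^sup>-\<close>, whose square is 1. With bases \<open>v\<^sup>\<plusminus>\<close> of the eigenspaces
  of \<open>M\<close> and a basis \<open>b\<close> of eigenvectors of \<open>M'\<close> with signs \<open>s\<close>, the eigenspace of sign \<open>\<sigma>\<close> of the tensor
  product has the basis of the vectors \<open>v\<close> (of sign \<open>\<sigma> s\<close>) \<open>\<otimes> b\<close>. Replacing \<open>b\<close> by the Hodge basis of \<open>M'\<close>
  multiplies both periods by the same factor. In the Hodge basis the period matrices for the two signs
  differ by signs on the pairs of conjugate types of \<open>M'\<close>, and on the middle type they are the period
  matrices of \<open>M\<close> of signs \<open>\<epsilon>\<close> and \<open>-\<epsilon>\<close>.
\<close>

text \<open>Sizes of bases are compared through traces, invertibility means that a determinant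
  divides 1, and inverses come from adjugates.

  The even rank of \<open>M\<close> gives its two eigenspaces the same rank \<open>n\<close>, so
  both eigenspaces of the tensor product have rank \<open>n\<close> times the rank of
  \<open>M'\<close>. One filtration step therefore serves both signs, and the two period matrices
  have the same rows and the same de Rham factor, which cancels.

  Criticality of the tensor product makes this step separate every product of Hodge vectors below it
  from its conjugate. Two things depend on this: the period matrices are invertible, and a row over
  the middle type of \<open>M'\<close> involves a Hodge type of \<open>M\<close> below half its
  weight, so that the middle block consists of rows of the period matrix of \<open>M\<close>. The
  remaining signs are rational and vanish in the period group.\<close>

section \<open>The ring of complexified coefficients has characteristic zero\<close>

lemma of_nat_tensor: "of_nat n = (of_nat n \<otimes>\<^sub>\<rat> 1 :: ('a::field_char_0, 'b::field_char_0) tensor)"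
  by (induction n) (simp_all add: tens_zero one_tensor_def tens_add_left)

lemma times_tens: "(a \<otimes>\<^sub>\<rat> b) * (c \<otimes>\<^sub>\<rat> d) = (a * c) \<otimes>\<^sub>\<rat> (b * d)"
  for a c :: "'a::field_char_0" and b d :: "'b::field_char_0"
  unfolding times_tensor_def by (rule tmap2_tens[OF biadditive_times biadditive_times])

text \<open>Traces and cardinalities are computed inside the ring and then read back as integers.
  This needs \<open>of_nat\<close> to be injective, which holds because every positive integer is
  invertible in the ring and 1 is not 0.\<close>

instance tensor :: (field_char_0, field_char_0) ring_char_0
proof
  have *: "m = 0" if "of_nat m = (0::('a, 'b) tensor)" for m
  proof (rule ccontr)
    assume "m \<noteq> 0"
    then have "(1::('a, 'b) tensor) = of_nat m * ((1 / of_nat m) \<otimes>\<^sub>\<rat> 1)"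
      by (simp add: of_nat_tensor times_tens one_tensor_def)
    then show False using that by simp
  qed
  show "inj (of_nat :: nat \<Rightarrow> ('a, 'b) tensor)"
  proof (rule injI)
    fix m n assume e: "of_nat m = (of_nat n :: ('a, 'b) tensor)"
    show "m = n"
    proof (cases "m \<le> n")
      case True
      then have "of_nat (n - m) = (0::('a, 'b) tensor)" using e by (simp add: of_nat_diff)
      then show ?thesis using * True by fastforce
    next
      case False
      then have "of_nat (m - n) = (0::('a, 'b) tensor)" using e by (simp add: of_nat_diff)
      then show ?thesis using * False by fastforce
    qed
  qed
qed

section \<open>Bases of quotients of modules\<close>

text \<open>The quotient by \<open>F\<close> is never formed: statements about it are congruences
  modulo \<open>F\<close>. With \<open>F = {0}\<close> this is the theory of bases of the module
  itself, used on the Betti side; with \<open>F\<close> a filtration step it describes the target of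
  the period map.\<close>

locale quotient_module = Modules.module s
  for s :: "'r::{comm_ring_1, ring_char_0} \<Rightarrow> 'v::ab_group_add \<Rightarrow> 'v" (infixr "*s" 75) +
  fixes F :: "'v set"
  assumes F: "subspace F"
begin

text \<open>
  \<open>qb k v\<close>: the classes of \<open>v 0, \<dots>, v (k - 1)\<close> form a basis of the quotient by \<open>F\<close>. The coordinates
  \<open>qc k v x i\<close> are meaningful for \<open>i < k\<close> only.
\<close>

definition qb :: "nat \<Rightarrow> (nat \<Rightarrow> 'v) \<Rightarrow> bool"
  where "qb k v \<longleftrightarrow> (\<forall>x. \<exists>c. x - (\<Sum>i<k. c i *s v i) \<in> F) \<and>
    (\<forall>c. (\<Sum>i<k. c i *s v i) \<in> F \<longrightarrow> (\<forall>i<k. c i = 0))"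

definition qc :: "nat \<Rightarrow> (nat \<Rightarrow> 'v) \<Rightarrow> 'v \<Rightarrow> nat \<Rightarrow> 'r"
  where "qc k v x = (SOME c. x - (\<Sum>i<k. c i *s v i) \<in> F)"

lemma qc_spec:
  assumes "qb k v"
  shows "x - (\<Sum>i<k. qc k v x i *s v i) \<in> F"
proof -
  have "\<exists>c. x - (\<Sum>i<k. c i *s v i) \<in> F" using assms by (simp add: qb_def)
  then show ?thesis unfolding qc_def by (rule someI_ex)
qed

lemma qb_indep:
  assumes "qb k v" "(\<Sum>i<k. c i *s v i) \<in> F" "i < k"
  shows "c i = 0"
proof -
  have "(\<Sum>i<k. c i *s v i) \<in> F \<longrightarrow> (\<forall>i<k. c i = 0)"
    using assms(1) unfolding qb_def by (elim conjE) (erule spec)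
  then show ?thesis using assms(2,3) by simp
qed

lemma qb_unique:
  assumes "qb k v" "x - (\<Sum>i<k. c i *s v i) \<in> F" "x - (\<Sum>i<k. c' i *s v i) \<in> F" "i < k"
  shows "c i = c' i"
proof -
  have "(x - (\<Sum>i<k. c' i *s v i)) - (x - (\<Sum>i<k. c i *s v i)) \<in> F"
    using subspace_diff[OF F assms(3,2)] .
  then have "(\<Sum>i<k. (c i - c' i) *s v i) \<in> F"
    by (simp add: scale_left_diff_distrib sum_subtractf)
  then have "c i - c' i = 0" using qb_indep[OF assms(1) _ assms(4), of "\<lambda>i. c i - c' i"] by simp
  then show ?thesis by simp
qed

lemma qc_eq: "qb k v \<Longrightarrow> x - (\<Sum>i<k. c i *s v i) \<in> F \<Longrightarrow> i < k \<Longrightarrow> qc k v x i = c i"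
  using qb_unique qc_spec by blast

lemma qc_sum:
  assumes "qb k v" "finite A" "i < k"
  shows "qc k v (\<Sum>a\<in>A. c a *s x a) i = (\<Sum>a\<in>A. c a * qc k v (x a) i)"
proof (rule qc_eq[OF assms(1) _ assms(3)])
  have "(\<Sum>a\<in>A. c a *s (x a - (\<Sum>i<k. qc k v (x a) i *s v i))) \<in> F"
    by (intro subspace_sum[OF F] subspace_scale[OF F] qc_spec assms)
  also have "(\<Sum>a\<in>A. c a *s (x a - (\<Sum>i<k. qc k v (x a) i *s v i))) =
    (\<Sum>a\<in>A. c a *s x a) - (\<Sum>i<k. (\<Sum>a\<in>A. c a * qc k v (x a) i) *s v i)"
    by (simp add: scale_right_diff_distrib sum_subtractf scale_sum_left scale_sum_right
        sum.swap[of _ A])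
  finally show "(\<Sum>a\<in>A. c a *s x a) - (\<Sum>i<k. (\<Sum>a\<in>A. c a * qc k v (x a) i) *s v i) \<in> F" .
qed

lemma qc_cong:
  assumes "qb k v" "x - y \<in> F" "i < k"
  shows "qc k v x i = qc k v y i"
proof (rule qc_eq[OF assms(1) _ assms(3)])
  show "x - (\<Sum>i<k. qc k v y i *s v i) \<in> F"
    using subspace_add[OF F assms(2) qc_spec[OF assms(1), of y]] by (simp add: algebra_simps)
qed

lemma qc_scale: "qb k v \<Longrightarrow> i < k \<Longrightarrow> qc k v (c *s x) i = c * qc k v x i"
  using qc_sum[of k v "{()}" i "\<lambda>_. c" "\<lambda>_. x"] by simp

lemma qc_add: "qb k v \<Longrightarrow> i < k \<Longrightarrow> qc k v (x + y) i = qc k v x i + qc k v y i"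
  using qc_sum[of k v UNIV i "\<lambda>_. 1" "\<lambda>b. if b then x else y"] by (simp add: UNIV_bool add.commute)

lemma sum_delta_scale: "j < k \<Longrightarrow> (\<Sum>i<k. (of_bool (i = j) * c) *s v i) = c *s v j" for k :: nat
  by (subst sum.remove[of _ j]) auto

lemma qc_base:
  assumes "qb k v" "i < k" "j < k"
  shows "qc k v (v j) i = of_bool (i = j)"
  using qc_eq[OF assms(1) _ assms(2), of "v j" "\<lambda>i. of_bool (i = j)"]
    sum_delta_scale[OF assms(3), where c = 1 and v = v] subspace_0[OF F] by simp

lemma qc_0: 
  assumes "qb k v" "x \<in> F" "i < k"
  shows "qc k v x i = 0"
  using qc_eq[OF assms(1) _ assms(3), of x "\<lambda>_. 0"] assms(2) by simp

lemma qc_trans: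
  assumes v: "qb k v" and u: "qb m u" and i: "i < k"
  shows "qc k v x i = (\<Sum>j<m. qc m u x j * qc k v (u j) i)"
proof -
  have "qc k v x i = qc k v (\<Sum>j<m. qc m u x j *s u j) i"
    by (rule qc_cong[OF v qc_spec[OF u] i])
  then show ?thesis by (simp add: qc_sum[OF v _ i])
qed

text \<open>A transition matrix and its inverse: the traces of their two products are the numbers of
  elements of the two bases.\<close>

lemma qb_card:
  assumes v: "qb k v" and u: "qb m u"
  shows "k = m"
proof -
  have "of_nat k = (\<Sum>i<k. qc k v (v i) i)" by (simp add: qc_base[OF v])
  also have "\<dots> = (\<Sum>i<k. \<Sum>j<m. qc m u (v i) j * qc k v (u j) i)"
    by (intro sum.cong) (auto simp: qc_trans[OF v u])
  also have "\<dots> = (\<Sum>j<m. \<Sum>i<k. qc k v (u j) i * qc m u (v i) j)"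
    by (subst sum.swap) (simp add: mult.commute)
  also have "\<dots> = (\<Sum>j<m. qc m u (u j) j)"
    by (intro sum.cong) (auto simp: qc_trans[OF u v])
  also have "\<dots> = of_nat m" by (simp add: qc_base[OF u])
  finally show ?thesis by simp
qed

text \<open>Column \<open>j\<close> holds the coordinates of \<open>u j\<close> in the basis
  \<open>v\<close>. Only \<open>v\<close> has to be a basis; \<open>u\<close> may be a family not
  yet known to be one, as in \<open>qb_spanI\<close>.\<close>

definition tm :: "nat \<Rightarrow> (nat \<Rightarrow> 'v) \<Rightarrow> (nat \<Rightarrow> 'v) \<Rightarrow> 'r mat"
  where "tm k v u = mat k k (\<lambda>(i, j). qc k v (u j) i)"

lemma tm_carrier [simp]: "tm k v u \<in> carrier_mat k k"
  by (simp add: tm_def)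

lemma tm_trans:
  assumes v: "qb k v" and u: "qb k u"
  shows "tm k v w = tm k v u * tm k u w"
proof (rule eq_matI)
  fix i j assume "i < dim_row (tm k v u * tm k u w)" "j < dim_col (tm k v u * tm k u w)"
  then have ij: "i < k" "j < k" by (auto simp: tm_def)
  have "tm k v w $$ (i, j) = (\<Sum>l<k. qc k u (w j) l * qc k v (u l) i)"
    using ij by (simp add: tm_def flip: qc_trans[OF v u])
  also have "\<dots> = (tm k v u * tm k u w) $$ (i, j)"
    using ij by (simp add: tm_def scalar_prod_def atLeast0LessThan mult.commute)
  finally show "tm k v w $$ (i, j) = (tm k v u * tm k u w) $$ (i, j)" .
qed (auto simp: tm_def)

lemma tm_id: "qb k v \<Longrightarrow> tm k v v = 1\<^sub>m k"
  by (rule eq_matI) (auto simp: tm_def qc_base)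

lemma tm_det_trans:
  assumes "qb k v" "qb k u"
  shows "det (tm k v w) = det (tm k v u) * det (tm k u w)"
  using arg_cong[OF tm_trans[OF assms, of w], of det] by (simp only: det_mult[OF tm_carrier tm_carrier])

lemma tm_unit:
  assumes "qb k v" "qb k u"
  shows "det (tm k v u) dvd 1"
  using tm_det_trans[OF assms, of v] by (simp add: tm_id assms dvdI)

text \<open>The matrix of \<open>u\<close> in the basis \<open>v\<close> has a right inverse, so its
  determinant is a unit; the adjugate then shows that every relation among the \<open>u j\<close> is
  trivial. This replaces the count of dimensions by which a generating family of the right size is a
  basis over a field.\<close>

lemma qb_spanI:
  assumes v: "qb k v" and span: "\<And>i. i < k \<Longrightarrow> \<exists>c. v i - (\<Sum>j<k. c j *s u j) \<in> F"
  shows "qb k u"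
proof -
  obtain C where C: "v i - (\<Sum>j<k. C i j *s u j) \<in> F" if "i < k" for i
    using span by metis
  define U where "U = mat k k (\<lambda>(j, i). C i j)"
  have 1: "tm k v u * U = 1\<^sub>m k"
  proof (rule eq_matI)
    fix i j assume "i < dim_row (1\<^sub>m k :: 'r mat)" "j < dim_col (1\<^sub>m k :: 'r mat)"
    then have ij: "i < k" "j < k" by auto
    have "of_bool (i = j) = qc k v (v j) i" using qc_base[OF v ij] by simp
    also have "\<dots> = (\<Sum>l<k. C j l * qc k v (u l) i)"
      using qc_cong[OF v C[OF ij(2)] ij(1)] by (simp add: qc_sum[OF v _ ij(1)])
    also have "\<dots> = (\<Sum>l<k. qc k v (u l) i * C j l)" by (simp add: mult.commute)
    also have "\<dots> = (tm k v u * U) $$ (i, j)"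
      using ij by (simp add: tm_def U_def scalar_prod_def atLeast0LessThan)
    finally show "(tm k v u * U) $$ (i, j) = 1\<^sub>m k $$ (i, j)"
      using ij by auto
  qed (auto simp: tm_def U_def)
  have "det (tm k v u) * det U = 1"
    using arg_cong[OF 1, of det] by (subst det_mult[of _ k, symmetric]) (auto simp: U_def)
  then obtain D where D: "D * det (tm k v u) = 1" by (metis mult.commute)
  show ?thesis
    unfolding qb_def
  proof (intro conjI allI impI)
    fix x
    have "(\<Sum>i<k. qc k v x i *s (v i - (\<Sum>j<k. C i j *s u j))) \<in> F"
      by (intro subspace_sum[OF F] subspace_scale[OF F]) (use C in auto)
    from subspace_add[OF F this qc_spec[OF v, of x]]
    have "x - (\<Sum>i<k. qc k v x i *s (\<Sum>j<k. C i j *s u j)) \<in> F"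
      by (simp add: scale_right_diff_distrib sum_subtractf)
    also have "(\<Sum>i<k. qc k v x i *s (\<Sum>j<k. C i j *s u j)) =
        (\<Sum>j<k. (\<Sum>i<k. qc k v x i * C i j) *s u j)"
      by (simp add: scale_sum_left scale_sum_right) (rule sum.swap)
    finally show "\<exists>c. x - (\<Sum>i<k. c i *s u i) \<in> F"
      by (rule exI[of _ "\<lambda>j. \<Sum>i<k. qc k v x i * C i j"])
  next
    fix c i assume c: "(\<Sum>i<k. c i *s u i) \<in> F" and i: "i < k"
    have "tm k v u *\<^sub>v vec k c = 0\<^sub>v k"
    proof (rule eq_vecI)
      fix l assume "l < dim_vec (0\<^sub>v k :: 'r vec)"
      then have l: "l < k" by simp
      have "(\<Sum>j<k. c j * qc k v (u j) l) = qc k v (\<Sum>i<k. c i *s u i) l"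
        by (rule qc_sum[OF v _ l, symmetric]) simp
      then show "(tm k v u *\<^sub>v vec k c) $ l = 0\<^sub>v k $ l"
        using l by (simp add: qc_0[OF v c] tm_def scalar_prod_def mult.commute atLeast0LessThan)
    qed (simp add: tm_def)
    then have "adj_mat (tm k v u) *\<^sub>v (tm k v u *\<^sub>v vec k c) = 0\<^sub>v k"
      using adj_mat(1)[OF tm_carrier, of k v u] by (auto simp: scalar_prod_def)
    moreover have "adj_mat (tm k v u) *\<^sub>v (tm k v u *\<^sub>v vec k c) = (det (tm k v u) \<cdot>\<^sub>m 1\<^sub>m k) *\<^sub>v vec k c"
      by (subst assoc_mult_mat_vec[symmetric, of _ k k _ k]) (auto simp: adj_mat(1,3)[OF tm_carrier])
    moreover have "((det (tm k v u) \<cdot>\<^sub>m 1\<^sub>m k) *\<^sub>v vec k c) $ i = det (tm k v u) * c i"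
      using i by (simp add: scalar_prod_def if_distrib[of "\<lambda>x. _ * x"] if_distrib[of "\<lambda>x. x * _"] cong: if_cong)
    ultimately have "det (tm k v u) * c i = 0" using i by simp
    then have "D * det (tm k v u) * c i = 0" by (simp add: mult.assoc)
    then show "c i = 0" using D by simp
  qed
qed

end

section \<open>Extension of scalars\<close>

lemma biadditive_scale: "vector_space s \<Longrightarrow> biadditive s"
proof -
  assume "vector_space s"
  then interpret vector_space s .
  show ?thesis by (simp add: biadditive_def scale_left_distrib scale_right_distrib)
qed

lemma tens_diff_left: "(x - y) \<otimes>\<^sub>\<rat> z = x \<otimes>\<^sub>\<rat> z - y \<otimes>\<^sub>\<rat> z"
  by (metis add_diff_cancel diff_add_cancel tens_add_left)

lemma tens_sum_left: "sum g A \<otimes>\<^sub>\<rat> z = (\<Sum>a\<in>A. g a \<otimes>\<^sub>\<rat> z)"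
  by (induction A rule: infinite_finite_induct) (simp_all add: tens_zero tens_add_left)

lemma cext_tens: "biadditive \<tau> \<Longrightarrow> cext \<tau> (v \<otimes>\<^sub>\<rat> z) (w \<otimes>\<^sub>\<rat> z') = \<tau> v w \<otimes>\<^sub>\<rat> (z * z')"
  unfolding cext_def by (rule tmap2_tens[OF _ biadditive_times])

lemma cext_add:
  assumes "biadditive \<tau>"
  shows "cext \<tau> (x + x') y = cext \<tau> x y + cext \<tau> x' y" "cext \<tau> x (y + y') = cext \<tau> x y + cext \<tau> x y'"
  unfolding cext_def by (simp_all add: tmap2_add[OF assms biadditive_times])

lemma cext_zero:
  assumes "biadditive \<tau>"
  shows "cext \<tau> 0 y = 0" "cext \<tau> x 0 = 0"
  unfolding cext_def by (simp_all add: tmap2_zero[OF assms biadditive_times])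

lemma cext_sum:
  assumes "biadditive \<tau>"
  shows "cext \<tau> (sum f A) y = (\<Sum>a\<in>A. cext \<tau> (f a) y)" "cext \<tau> x (sum g A) = (\<Sum>a\<in>A. cext \<tau> x (g a))"
  by (induction A rule: infinite_finite_induct) (simp_all add: cext_zero[OF assms] cext_add[OF assms])

lemma cext_times: "cext (*) = (*)"
  by (simp add: cext_def times_tensor_def fun_eq_iff)

lemma cext_bilinear:
  assumes s: "vector_space s" and t: "vector_space t" and u: "vector_space u" and \<tau>: "biadditive \<tau>"
    and hom: "\<And>e v w. \<tau> (s e v) w = u e (\<tau> v w)" "\<And>e v w. \<tau> v (t e w) = u e (\<tau> v w)"
  shows "cext \<tau> (cext s r x) y = cext u r (cext \<tau> x y)" "cext \<tau> x (cext t r y) = cext u r (cext \<tau> x y)"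
proof -
  note b = biadditive_scale[OF s] biadditive_scale[OF t] biadditive_scale[OF u] \<tau>
  note simps = cext_zero[OF b(1)] cext_zero[OF b(2)] cext_zero[OF b(3)] cext_zero[OF b(4)]
    cext_add[OF b(1)] cext_add[OF b(2)] cext_add[OF b(3)] cext_add[OF b(4)]
    cext_tens[OF b(1)] cext_tens[OF b(2)] cext_tens[OF b(3)] cext_tens[OF b(4)] hom
  have 1: "cext \<tau> (cext s (e \<otimes>\<^sub>\<rat> z) (v \<otimes>\<^sub>\<rat> z')) y = cext u (e \<otimes>\<^sub>\<rat> z) (cext \<tau> (v \<otimes>\<^sub>\<rat> z') y)" for e z v z'
    by (induction y) (simp_all add: simps mult.assoc)
  \<comment> \<open>From here on only the additive rules \<open>simps(1-16)\<close> are used: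
    evaluating \<open>cext\<close> on pure tensors would rewrite the left side before the preceding
    fact \<open>1\<close> can match.\<close>
  have 2: "cext \<tau> (cext s (e \<otimes>\<^sub>\<rat> z) x) y = cext u (e \<otimes>\<^sub>\<rat> z) (cext \<tau> x y)" for e z
    by (induction x) (simp_all add: simps(1-16) 1)
  show "cext \<tau> (cext s r x) y = cext u r (cext \<tau> x y)"
    by (induction r) (simp_all add: simps(1-16) 2)
  have 1: "cext \<tau> (v \<otimes>\<^sub>\<rat> z') (cext t (e \<otimes>\<^sub>\<rat> z) y) = cext u (e \<otimes>\<^sub>\<rat> z) (cext \<tau> (v \<otimes>\<^sub>\<rat> z') y)" for e z v z'
    by (induction y) (simp_all add: simps mult.assoc mult.left_commute)
  have 2: "cext \<tau> x (cext t (e \<otimes>\<^sub>\<rat> z) y) = cext u (e \<otimes>\<^sub>\<rat> z) (cext \<tau> x y)" for e z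
    by (induction x) (simp_all add: simps(1-16) 1)
  show "cext \<tau> x (cext t r y) = cext u r (cext \<tau> x y)"
    by (induction r) (simp_all add: simps(1-16) 2)
qed

lemma biadditive_cmap:
  assumes "Vector_Spaces.linear s s' \<phi>"
  shows "biadditive (\<lambda>v z. \<phi> v \<otimes>\<^sub>\<rat> z)"
proof -
  interpret Vector_Spaces.linear s s' \<phi> by fact
  show ?thesis by (simp add: biadditive_def add tens_add_left tens_add_right)
qed

lemma cmap_tens: "Vector_Spaces.linear s s' \<phi> \<Longrightarrow> cmap \<phi> (v \<otimes>\<^sub>\<rat> z) = \<phi> v \<otimes>\<^sub>\<rat> z"
  unfolding cmap_def by (rule tlift_tens[OF biadditive_cmap])

lemma module_hom_cmap:
  assumes "Vector_Spaces.linear s s' \<phi>"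
  shows "module_hom (cext s) (cext s') (cmap \<phi>)"
proof -
  interpret Vector_Spaces.linear s s' \<phi> by fact
  note s = vs1.vector_space_axioms and s' = vs2.vector_space_axioms
  note b = biadditive_scale[OF s] biadditive_scale[OF s']
  have add: "cmap \<phi> (x + y) = cmap \<phi> x + cmap \<phi> y" for x y
    unfolding cmap_def by (rule tlift_add[OF biadditive_cmap[OF assms]])
  have zero: "cmap \<phi> 0 = 0"
    unfolding cmap_def by (rule tlift_zero[OF biadditive_cmap[OF assms]])
  note simps = add zero cmap_tens[OF assms] cext_zero[OF b(1)] cext_add[OF b(1)] cext_tens[OF b(1)]
    cext_zero[OF b(2)] cext_add[OF b(2)] cext_tens[OF b(2)] scale
  have 1: "cmap \<phi> (cext s (e \<otimes>\<^sub>\<rat> z) x) = cext s' (e \<otimes>\<^sub>\<rat> z) (cmap \<phi> x)" for e z x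
    by (induction x) (simp_all add: simps)
  have 2: "cmap \<phi> (cext s r x) = cext s' r (cmap \<phi> x)" for r x
    by (induction r) (simp_all add: simps(1-12) 1)
  show ?thesis
    by (rule module_hom.intro[OF module_cext[OF s] module_cext[OF s']])
      (unfold_locales, simp_all add: add 2)
qed

text \<open>The uniqueness of coordinates survives the extension of scalars because the coordinates
  themselves, being linear forms, extend.\<close>

lemma qb_cext:
  assumes s: "vector_space s" and "quotient_module s F" and v: "quotient_module.qb s F k v"
  shows "quotient_module (cext s) (Modules.module.span (cext s) ((\<lambda>v. v \<otimes>\<^sub>\<rat> 1) ` F))"
    and "quotient_module.qb (cext s) (Modules.module.span (cext s) ((\<lambda>v. v \<otimes>\<^sub>\<rat> 1) ` F)) k (\<lambda>i. v i \<otimes>\<^sub>\<rat> 1)"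
proof -
  interpret E: vector_space s by fact
  interpret E: quotient_module s F by fact
  interpret R: Modules.module "cext s" by (rule module_cext[OF s])
  define FC where "FC = R.span ((\<lambda>v. v \<otimes>\<^sub>\<rat> 1) ` F)"
  interpret R: quotient_module "cext s" FC by unfold_locales (simp add: FC_def)
  note b = biadditive_scale[OF s]
  note b1 = cext_zero[OF b] cext_add[OF b] cext_tens[OF b]
  have "\<exists>c. x - (\<Sum>i<k. cext s (c i) (v i \<otimes>\<^sub>\<rat> 1)) \<in> FC" for x
  proof (induction x)
    case zero
    show ?case by (rule exI[of _ "\<lambda>_. 0"]) (simp add: R.subspace_0[OF R.F])
  next
    case (add a z x)
    then obtain c where c: "x - (\<Sum>i<k. cext s (c i) (v i \<otimes>\<^sub>\<rat> 1)) \<in> FC" by blast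
    define d where "d = E.qc k v a"
    have "a - (\<Sum>i<k. s (d i) (v i)) \<in> F" unfolding d_def by (rule E.qc_spec[OF v])
    then have "(a - (\<Sum>i<k. s (d i) (v i))) \<otimes>\<^sub>\<rat> 1 \<in> FC"
      unfolding FC_def by (intro R.span_base imageI)
    then have "cext s (1 \<otimes>\<^sub>\<rat> z) ((a - (\<Sum>i<k. s (d i) (v i))) \<otimes>\<^sub>\<rat> 1) \<in> FC"
      by (rule R.subspace_scale[OF R.F])
    from R.subspace_add[OF R.F this c]
    have "a \<otimes>\<^sub>\<rat> z + x - (\<Sum>i<k. cext s (d i \<otimes>\<^sub>\<rat> z + c i) (v i \<otimes>\<^sub>\<rat> 1)) \<in> FC"
      by (simp add: b1 cext_sum(2)[OF b] tens_diff_left tens_sum_left sum.distrib algebra_simps)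
    then show ?case by (rule exI[of _ "\<lambda>i. d i \<otimes>\<^sub>\<rat> z + c i"])
  qed
  moreover have "\<forall>i<k. c i = 0" if c: "(\<Sum>i<k. cext s (c i) (v i \<otimes>\<^sub>\<rat> 1)) \<in> FC" for c
  proof (intro allI impI)
    fix i assume i: "i < k"
    define \<phi> where "\<phi> = (\<lambda>x. E.qc k v x i)"
    have \<phi>: "Vector_Spaces.linear s (*) \<phi>"
      by unfold_locales (simp_all add: \<phi>_def E.qc_add[OF v i] E.qc_scale[OF v i] algebra_simps)
    have \<phi>0: "\<phi> x = 0" if "x \<in> F" for x using E.qc_0[OF v that i] by (simp add: \<phi>_def)
    interpret P: module_hom "cext s" "(*)" "cmap \<phi>"
      using module_hom_cmap[OF \<phi>] by (simp only: cext_times)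
    have "R.span ((\<lambda>v. v \<otimes>\<^sub>\<rat> 1) ` F) \<subseteq> {x. cmap \<phi> x = 0}"
      by (rule R.span_minimal[OF _ P.subspace_kernel])
        (use \<phi>0 in \<open>auto simp: cmap_tens[OF \<phi>] tens_zero\<close>)
    then have "cmap \<phi> (\<Sum>i<k. cext s (c i) (v i \<otimes>\<^sub>\<rat> 1)) = 0" using c FC_def by auto
    also have "cmap \<phi> (\<Sum>i<k. cext s (c i) (v i \<otimes>\<^sub>\<rat> 1)) = (\<Sum>j<k. c j * (\<phi> (v j) \<otimes>\<^sub>\<rat> 1))"
      by (simp add: P.sum P.scale cmap_tens[OF \<phi>])
    also have "\<dots> = (\<Sum>j<k. c j * of_bool (i = j))"
      by (intro sum.cong) (auto simp: \<phi>_def E.qc_base[OF v i] tens_zero one_tensor_def)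
    finally show "c i = 0" using i by simp
  qed
  ultimately have *: "R.qb k (\<lambda>i. v i \<otimes>\<^sub>\<rat> 1)" by (simp add: R.qb_def)
  show "quotient_module (cext s) (R.span ((\<lambda>v. v \<otimes>\<^sub>\<rat> 1) ` F))"
    using R.quotient_module_axioms unfolding FC_def .
  show "quotient_module.qb (cext s) (R.span ((\<lambda>v. v \<otimes>\<^sub>\<rat> 1) ` F)) k (\<lambda>i. v i \<otimes>\<^sub>\<rat> 1)"
    using * unfolding FC_def .
qed

section \<open>Bases over the coefficient field\<close>

lemma vector_space_quotient_module:
  fixes s :: "'e::field_char_0 \<Rightarrow> 'v::ab_group_add \<Rightarrow> 'v"
  assumes "vector_space s" "Modules.module.subspace s F"
  shows "quotient_module s F"
proof -
  interpret vector_space s by fact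
  show ?thesis by unfold_locales (rule assms(2))
qed

text \<open>The definition asks for a unique vector, whereas \<open>qb\<close> speaks of coefficient
  functions whose values beyond the length are arbitrary. Uniqueness of the vector amounts to the
  absence of nontrivial relations modulo \<open>F\<close>.\<close>

lemma quotient_basis_iff_qb:
  assumes "quotient_module s F"
  shows "quotient_basis s F vs \<longleftrightarrow> quotient_module.qb s F (length vs) (\<lambda>i. vs ! i)"
proof -
  interpret quotient_module s F by fact
  show ?thesis
  proof
    assume *: "quotient_basis s F vs"
    have "c i = 0" if c: "(\<Sum>i<length vs. s (c i) (vs ! i)) \<in> F" and i: "i < length vs" for c i
    proof -
      have "\<exists>!d. d \<in> carrier_vec (length vs) \<and> 0 - (\<Sum>i<length vs. s (d $ i) (vs ! i)) \<in> F"
        using * unfolding quotient_basis_def by blast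
      moreover have "0 - (\<Sum>i<length vs. s (vec (length vs) c $ i) (vs ! i)) \<in> F"
        using subspace_neg[OF F c] by simp
      moreover have "0 - (\<Sum>i<length vs. s (0\<^sub>v (length vs) $ i) (vs ! i)) \<in> F"
        using subspace_0[OF F] by simp
      ultimately have "vec (length vs) c = 0\<^sub>v (length vs)" by (metis vec_carrier zero_carrier_vec)
      then show "c i = 0" using i by (metis index_vec index_zero_vec(1))
    qed
    moreover have "\<exists>c. x - (\<Sum>i<length vs. s (c i) (vs ! i)) \<in> F" for x
      using * unfolding quotient_basis_def by blast
    ultimately show "qb (length vs) (\<lambda>i. vs ! i)" by (simp add: qb_def)
  next
    assume *: "qb (length vs) (\<lambda>i. vs ! i)"
    show "quotient_basis s F vs"
      unfolding quotient_basis_def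
    proof (intro allI ex1I)
      fix x
      show "vec (length vs) (qc (length vs) (\<lambda>i. vs ! i) x) \<in> carrier_vec (length vs) \<and>
        x - (\<Sum>i<length vs. s (vec (length vs) (qc (length vs) (\<lambda>i. vs ! i) x) $ i) (vs ! i)) \<in> F"
        using qc_spec[OF *, of x] by simp
      fix c assume "c \<in> carrier_vec (length vs) \<and> x - (\<Sum>i<length vs. s (c $ i) (vs ! i)) \<in> F"
      then show "c = vec (length vs) (qc (length vs) (\<lambda>i. vs ! i) x)"
        using qc_eq[OF *, of x "\<lambda>i. c $ i"] by (intro eq_vecI) auto
    qed
  qed
qed

locale finite_vector_space = vector_space s
  for s :: "'e::field_char_0 \<Rightarrow> 'v::ab_group_add \<Rightarrow> 'v" (infixr "*s" 75) +
  assumes fin: "\<exists>B. finite B \<and> span B = UNIV"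
begin

lemma independent_finite: "independent B \<Longrightarrow> finite B"
  using fin independent_span_bound by auto

text \<open>Coefficients indexed by positions allow bases to be concatenated and to be numbered by
  pairs. Distinctness is implied by the last condition: two equal entries would give a relation with
  coefficients 1 and -1.\<close>

lemma ordered_basis_iff:
  assumes W: "subspace W"
  shows "ordered_basis s W bs \<longleftrightarrow> set bs \<subseteq> W \<and>
    (\<forall>x\<in>W. \<exists>c. x = (\<Sum>i<length bs. c i *s bs ! i)) \<and>
    (\<forall>c. (\<Sum>i<length bs. c i *s bs ! i) = 0 \<longrightarrow> (\<forall>i<length bs. c i = 0))"
    (is "?L \<longleftrightarrow> ?R")
proof
  assume ?L
  then have d: "distinct bs" and i: "independent (set bs)" and sp: "span (set bs) = W"
    by (auto simp: ordered_basis_def)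
  have sum: "(\<Sum>v\<in>set bs. u v *s v) = (\<Sum>i<length bs. u (bs ! i) *s bs ! i)" for u
    using sum.reindex_bij_betw[OF bij_betw_nth[OF d HOL.refl HOL.refl], of "\<lambda>v. u v *s v"] by simp
  have "c j = 0" if c: "(\<Sum>i<length bs. c i *s bs ! i) = 0" and j: "j < length bs" for c j
  proof -
    \<comment> \<open>\<open>c\<close> read as a function of the vectors, which is possible because
      the list is distinct.\<close>
    define u where "u = (\<lambda>v. c (THE i. i < length bs \<and> bs ! i = v))"
    have u: "u (bs ! i) = c i" if "i < length bs" for i
      unfolding u_def using that d by (intro arg_cong[of _ _ c] the_equality) (auto simp: nth_eq_iff_index_eq)
    have "(\<Sum>v\<in>set bs. u v *s v) = 0" using c by (simp add: sum u)
    then have "u (bs ! j) = 0" using independentD[OF i, of "set bs" u "bs ! j"] j by simp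
    then show ?thesis by (simp add: u j)
  qed
  moreover have "\<exists>c. x = (\<Sum>i<length bs. c i *s bs ! i)" if "x \<in> W" for x
  proof -
    from that sp obtain u where "x = (\<Sum>v\<in>set bs. u v *s v)" by (auto simp: span_finite)
    then show ?thesis unfolding sum by (intro exI[of _ "\<lambda>i. u (bs ! i)"])
  qed
  moreover have "set bs \<subseteq> W" using span_superset[of "set bs"] sp by simp
  ultimately show ?R by blast
next
  assume R: ?R
  then have W1: "set bs \<subseteq> W" by (rule conjunct1)
  have sp: "\<exists>c. x = (\<Sum>i<length bs. c i *s bs ! i)" if "x \<in> W" for x
    using R that by (elim conjE) (erule bspec)
  have ind: "c i = 0" if "(\<Sum>i<length bs. c i *s bs ! i) = 0" "i < length bs" for c i
  proof -
    have "(\<Sum>i<length bs. c i *s bs ! i) = 0 \<longrightarrow> (\<forall>i<length bs. c i = 0)"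
      using R by (elim conjE) (erule spec)
    then show ?thesis using that by simp
  qed
  have d: "distinct bs"
    unfolding distinct_conv_nth
  proof (intro allI impI notI)
    fix i j assume ij: "i < length bs" "j < length bs" "i \<noteq> j" "bs ! i = bs ! j"
    have "(\<Sum>l<length bs. (of_bool (l = i) - of_bool (l = j)) *s bs ! l) =
      (\<Sum>l<length bs. of_bool (l = i) *s bs ! l) - (\<Sum>l<length bs. of_bool (l = j) *s bs ! l)"
      by (simp add: scale_left_diff_distrib sum_subtractf)
    also have "\<dots> = 0"
      using ij by (simp add: of_bool_def if_distrib[of "\<lambda>x. x *s _"] cong: if_cong)
    finally show False using ind[of "\<lambda>l. of_bool (l = i) - of_bool (l = j)" i] ij by simp
  qed
  have sum: "(\<Sum>v\<in>set bs. u v *s v) = (\<Sum>i<length bs. u (bs ! i) *s bs ! i)" for u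
    using sum.reindex_bij_betw[OF bij_betw_nth[OF d HOL.refl HOL.refl], of "\<lambda>v. u v *s v"] by simp
  have "independent (set bs)"
    unfolding dependent_finite[OF finite_set] sum
    using ind[of "\<lambda>i. u (bs ! i)" for u] by (auto simp: in_set_conv_nth)
  moreover have "span (set bs) = W"
  proof
    show "span (set bs) \<subseteq> W" by (rule span_minimal[OF W1 W])
    show "W \<subseteq> span (set bs)"
    proof
      fix x assume "x \<in> W"
      then obtain c where "x = (\<Sum>i<length bs. c i *s bs ! i)" using sp by blast
      moreover have "(\<Sum>i<length bs. c i *s bs ! i) \<in> span (set bs)"
        by (intro span_sum span_scale span_base nth_mem) simp
      ultimately show "x \<in> span (set bs)" by simp
    qed
  qed
  ultimately show ?L using d by (simp add: ordered_basis_def)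
qed

lemma ex_ordered_basis:
  assumes "subspace W"
  obtains bs where "ordered_basis s W bs"
proof -
  obtain B where B: "B \<subseteq> W" "independent B" "W \<subseteq> span B" "card B = dim W"
    using basis_exists by blast
  obtain bs where "set bs = B" "distinct bs"
    using finite_distinct_list[OF independent_finite[OF B(2)]] by blast
  then show thesis using B assms that[of bs] span_minimal[OF B(1) assms]
    by (auto simp: ordered_basis_def)
qed

lemma length_ordered_basis: "ordered_basis s W bs \<Longrightarrow> length bs = dim W"
  unfolding ordered_basis_def using dim_eq_card distinct_card by (metis span_span)

text \<open>A basis of \<open>F\<close> is extended to one of the whole space; the added vectors
  form a basis of the quotient, and their number is the codimension.\<close>

lemma ex_quotient_basis:
  assumes "subspace F"
  obtains vs where "quotient_basis s F vs" "length vs = codim s F"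
proof -
  interpret quotient_module s F by (unfold_locales) (rule assms)
  obtain B where B: "B \<subseteq> F" "independent B" "F \<subseteq> span B" "card B = dim F"
    using basis_exists by blast
  then have sB: "span B = F" using span_minimal[OF B(1) assms] by blast
  obtain B' where B': "B \<subseteq> B'" "independent B'" "UNIV \<subseteq> span B'"
    using maximal_independent_subset_extend[of B UNIV] B(2) by auto
  have fB': "finite B'" by (rule independent_finite[OF B'(2)])
  have fB: "finite B" using fB' B'(1) finite_subset by blast
  obtain vs where vs: "set vs = B' - B" "distinct vs" using finite_distinct_list[of "B' - B"] fB' by blast
  have "length vs = card B' - card B"
    using vs fB B'(1) by (metis card_Diff_subset distinct_card)
  moreover have "card B' = dim UNIV" using dim_eq_card[OF _ B'(2), of UNIV] B'(3) by (simp add: top.extremum_unique)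
  ultimately have l: "length vs = codim s F" using B(4) by (simp add: codim_def)
  have sum: "(\<Sum>v\<in>B' - B. u v *s v) = (\<Sum>i<length vs. u (vs ! i) *s vs ! i)" for u
    using sum.reindex_bij_betw[OF bij_betw_nth[OF vs(2) HOL.refl HOL.refl], of "\<lambda>v. u v *s v"] vs(1) by simp
  have "\<exists>c. x - (\<Sum>i<length vs. c i *s vs ! i) \<in> F" for x
  proof -
    have "x \<in> span ((B' - B) \<union> B)" using B' by (metis Un_Diff_cancel2 Un_absorb2 UNIV_I subsetD)
    then obtain y z where yz: "x = y + z" "y \<in> span (B' - B)" "z \<in> F"
      unfolding span_Un sB by blast
    then obtain u where "y = (\<Sum>v\<in>B' - B. u v *s v)" using span_finite[of "B' - B"] fB' by auto
    then have "x - (\<Sum>i<length vs. u (vs ! i) *s vs ! i) \<in> F" using yz by (simp add: sum)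
    then show ?thesis by (intro exI[of _ "\<lambda>i. u (vs ! i)"])
  qed
  moreover have "c j = 0" if c: "(\<Sum>i<length vs. c i *s vs ! i) \<in> F" and j: "j < length vs" for c j
  proof -
    obtain w where w: "(\<Sum>i<length vs. c i *s vs ! i) = (\<Sum>v\<in>B. w v *s v)"
      using c by (auto simp: sB[symmetric] span_finite[OF fB])
    define u where "u = (\<lambda>v. c (THE i. i < length vs \<and> vs ! i = v))"
    have u: "u (vs ! i) = c i" if "i < length vs" for i
      unfolding u_def using that vs(2) by (intro arg_cong[of _ _ c] the_equality) (auto simp: nth_eq_iff_index_eq)
    define u' where "u' = (\<lambda>v. if v \<in> B then - w v else u v)"
    have "(\<Sum>v\<in>B'. u' v *s v) = (\<Sum>v\<in>B' - B. u' v *s v) + (\<Sum>v\<in>B. u' v *s v)"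
      by (rule sum.subset_diff[OF B'(1) fB'])
    also have "(\<Sum>v\<in>B' - B. u' v *s v) = (\<Sum>v\<in>B' - B. u v *s v)"
      by (intro sum.cong) (auto simp: u'_def)
    also have "\<dots> = (\<Sum>i<length vs. c i *s vs ! i)" by (simp add: sum u)
    also have "(\<Sum>v\<in>B. u' v *s v) = - (\<Sum>v\<in>B. w v *s v)"
      by (simp add: u'_def sum_negf)
    finally have "(\<Sum>v\<in>B'. u' v *s v) = 0" by (simp add: w)
    moreover have "vs ! j \<in> B' - B" using vs(1) j by (metis nth_mem)
    ultimately have "u' (vs ! j) = 0" using independentD[OF B'(2) fB', of u' "vs ! j"] by simp
    then show ?thesis using \<open>vs ! j \<in> B' - B\<close> by (simp add: u'_def u j)
  qed
  ultimately have "qb (length vs) (\<lambda>i. vs ! i)" by (simp add: qb_def)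
  then have "quotient_basis s F vs"
    by (simp add: quotient_basis_iff_qb[OF quotient_module_axioms])
  then show thesis using l that by blast
qed

lemma length_quotient_basis:
  assumes "subspace F" "quotient_basis s F vs"
  shows "length vs = codim s F"
proof -
  interpret quotient_module s F by (unfold_locales) (rule assms)
  obtain us where "quotient_basis s F us" "length us = codim s F"
    using ex_quotient_basis[OF assms(1)] .
  then show ?thesis using qb_card assms(2) by (metis quotient_basis_iff_qb[OF quotient_module_axioms])
qed

lemma ordered_basis_UNIV_qb: "ordered_basis s UNIV bs \<longleftrightarrow> quotient_module.qb s {0} (length bs) (\<lambda>i. bs ! i)"
proof -
  interpret quotient_module s "{0}" by unfold_locales simp
  show ?thesis unfolding ordered_basis_iff[OF subspace_UNIV] qb_def by simp
qed

text \<open>A critical step is specified by its codimension alone. Among nested subspaces this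
  determines the step, so that periods do not depend on the chosen index.\<close>

lemma subspace_codim_eq:
  assumes "subspace F" "subspace G" "F \<subseteq> G" "codim s F = codim s G"
  shows "F = G"
proof -
  obtain B where B: "finite B" "independent B" "span B = UNIV"
    using basis_exists[of UNIV] independent_finite by (metis top.extremum_uniqueI)
  interpret finite_dimensional_vector_space s B by unfold_locales (use B in auto)
  \<comment> \<open>\<open>codim\<close> is a truncated subtraction; these bounds are what turns
    equal codimensions into equal dimensions.\<close>
  have "dim F \<le> dim UNIV" "dim G \<le> dim UNIV" by (simp_all only: dim_subset[OF subset_UNIV])
  then have "dim F = dim G" using assms(4) by (simp add: codim_def)
  then show ?thesis using assms subspace_dim_equal by auto
qed

end

lemma sum_lessThan_add: "(\<Sum>i<m + n. g i) = (\<Sum>i<m. g i) + (\<Sum>i<n. g (m + i))" for m n :: nat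
  and g :: "nat \<Rightarrow> 'a::comm_monoid_add"
  by (induction n) (simp_all add: add.assoc)

lemma of_int_tensor: "of_int n = (of_int n \<otimes>\<^sub>\<rat> 1 :: ('a::field_char_0, 'b::field_char_0) tensor)"
proof (cases n)
  case (nonneg m)
  then show ?thesis by (simp add: of_nat_tensor[symmetric])
next
  case (neg m)
  have "x \<otimes>\<^sub>\<rat> (1::'b) + (- x) \<otimes>\<^sub>\<rat> 1 = 0" for x :: 'a
    by (simp flip: tens_add_left add: tens_zero)
  then have "(- x) \<otimes>\<^sub>\<rat> (1::'b) = - (x \<otimes>\<^sub>\<rat> 1)" for x :: 'a
    by (metis add_eq_0_iff)
  then show ?thesis using neg by (simp add: of_nat_tensor[symmetric] del: of_nat_Suc)
qed

text \<open>Being a ring homomorphism, the embedding of the coefficient field commutes with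
  determinants. So a change between rational bases contributes an element of the field, not just a
  unit of \<open>'e cx\<close>.\<close>

interpretation emb: comm_ring_hom "\<lambda>e::'e::field_char_0. e \<otimes>\<^sub>\<rat> (1::complex)"
  by unfold_locales (simp_all add: tens_zero tens_add_left times_tens one_tensor_def)

lemma tens_one_unit: "(e \<otimes>\<^sub>\<rat> (1::complex)) dvd 1 \<Longrightarrow> e \<noteq> 0" for e :: "'e::field_char_0"
  by (metis dvd_0_left emb.hom_zero zero_neq_one)

lemma qb_cext_zero:
  assumes s: "vector_space s" and v: "quotient_module.qb s {0} k v"
  shows "quotient_module.qb (cext s) {0} k (\<lambda>i. v i \<otimes>\<^sub>\<rat> 1)"
proof -
  interpret vector_space s by fact
  interpret Q: quotient_module s "{0}" by unfold_locales simp
  interpret R: Modules.module "cext s" by (rule module_cext[OF s])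
  have "R.span {0} = {0}" by simp
  moreover have "(\<lambda>v. v \<otimes>\<^sub>\<rat> (1::complex)) ` {0 :: 'b} = {0}" by (simp add: tens_zero)
  ultimately show ?thesis using qb_cext(2)[OF s Q.quotient_module_axioms v] by (simp only:)
qed

text \<open>Expand the vectors of one basis in the other and exchange the sums. The lemma is applied
  to conjugation, with a basis of Hodge vectors on one side and a rational basis of eigenvectors on
  the other.\<close>

lemma (in quotient_module) trace_invariant:
  assumes zero: "F = {0}" and T: "module_hom s s T" and v: "qb k v" and u: "qb m u"
  shows "(\<Sum>i<k. qc k v (T (v i)) i) = (\<Sum>j<m. qc m u (T (u j)) j)"
proof -
  interpret T: module_hom s s T by fact
  have "(\<Sum>i<k. qc k v (T (v i)) i) = (\<Sum>i<k. \<Sum>j<m. qc m u (T (v i)) j * qc k v (u j) i)"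
    by (intro sum.cong) (auto simp: qc_trans[OF v u])
  also have "\<dots> = (\<Sum>j<m. \<Sum>i<k. qc k v (u j) i * qc m u (T (v i)) j)"
    by (subst sum.swap) (simp add: mult.commute)
  also have "\<dots> = (\<Sum>j<m. qc m u (T (u j)) j)"
  proof (intro sum.cong)
    fix j assume j: "j \<in> {..<m}"
    have "u j = (\<Sum>i<k. qc k v (u j) i *s v i)" using qc_spec[OF v, of "u j"] zero by simp
    then have "T (u j) = (\<Sum>i<k. qc k v (u j) i *s T (v i))"
      by (metis (no_types, lifting) T.scale T.sum sum.cong)
    then show "(\<Sum>i<k. qc k v (u j) i * qc m u (T (v i)) j) = qc m u (T (u j)) j"
      using j by (simp add: qc_sum[OF u])
  qed simp
  finally show ?thesis .
qed

section \<open>Motives with a basis adapted to the Hodge filtration\<close>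

locale pure =
  fixes M :: "('e::field_char_0, 'b::ab_group_add, 'd::ab_group_add) motive"
  assumes pure: "pure_motive M"
begin

abbreviation "\<sigma>B \<equiv> cext (scaleB M)"
abbreviation "\<sigma>D \<equiv> cext (scaleD M)"
abbreviation "I \<equiv> comparison M"
abbreviation "V \<equiv> betti_eigenspace M"

sublocale B: finite_vector_space "scaleB M"
  using pure by (auto simp: pure_motive_def finite_vector_space_def finite_vector_space_axioms_def)

sublocale D: finite_vector_space "scaleD M"
  using pure by (auto simp: pure_motive_def finite_vector_space_def finite_vector_space_axioms_def)

sublocale I: module_hom \<sigma>B \<sigma>D I
  using pure by (auto simp: pure_motive_def)

sublocale BC: quotient_module \<sigma>B "{0}"
  by unfold_locales simp

sublocale \<rho>: Vector_Spaces.linear "scaleB M" "scaleB M" "rho M"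
  using pure by (auto simp: pure_motive_def)

lemma \<rho>_linear: "Vector_Spaces.linear (scaleB M) (scaleB M) (rho M)"
  by (rule \<rho>.linear_axioms)

sublocale \<rho>C: module_hom \<sigma>B \<sigma>B "cmap (rho M)"
  by (rule module_hom_cmap[OF \<rho>_linear])

lemma I_bij: "bij I"
  using pure by (auto simp: pure_motive_def)

lemma I_eq: "I x = I y \<longleftrightarrow> x = y"
  using I_bij by (auto simp: bij_def inj_eq)

lemma \<rho>\<rho>: "rho M (rho M v) = v"
  using pure by (auto simp: pure_motive_def)

lemma \<rho>\<rho>C: "cmap (rho M) (cmap (rho M) x) = x"
  by (induction x) (simp_all add: \<rho>C.add cmap_tens[OF \<rho>_linear] \<rho>\<rho>)

lemma subspace_hodge_filtration: "D.subspace (hodge_filtration M p)"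
  using pure by (auto simp: pure_motive_def)

lemma subspace_eigen: "B.subspace (V \<sigma>)"
  by (rule B.subspaceI)
    (auto simp: betti_eigenspace_def \<rho>.zero \<rho>.add \<rho>.scale B.scale_right_distrib mult.commute)

lemma quotient_hodge_filtration: "quotient_module (scaleD M) (hodge_filtration M p)"
  by (rule vector_space_quotient_module[OF D.vector_space_axioms subspace_hodge_filtration])

lemma quotient_filtration_cx: "quotient_module \<sigma>D (filtration_cx M p)"
proof -
  obtain vs where "quotient_basis (scaleD M) (hodge_filtration M p) vs"
    using D.ex_quotient_basis[OF subspace_hodge_filtration] .
  then show ?thesis
    using qb_cext(1)[OF D.vector_space_axioms quotient_hodge_filtration]
    unfolding quotient_basis_iff_qb[OF quotient_hodge_filtration] filtration_cx_def by blast
qed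

lemma quotient_basis_cx:
  assumes "quotient_basis (scaleD M) (hodge_filtration M p) vs"
  shows "quotient_module.qb \<sigma>D (filtration_cx M p) (length vs) (\<lambda>i. (vs ! i) \<otimes>\<^sub>\<rat> 1)"
  using qb_cext(2)[OF D.vector_space_axioms quotient_hodge_filtration] assms
  unfolding quotient_basis_iff_qb[OF quotient_hodge_filtration] filtration_cx_def by blast

text \<open>Extension of scalars preserves the size of a quotient basis, and this size is unique by
  \<open>qb_card\<close>. So a codimension over the field can be read off from any basis of the
  complexified quotient, for instance one of Hodge vectors.\<close>

lemma codim_eqI:
  assumes "quotient_module.qb \<sigma>D (filtration_cx M p) k v"
  shows "codim (scaleD M) (hodge_filtration M p) = k"
proof -
  interpret Q: quotient_module \<sigma>D "filtration_cx M p" by (rule quotient_filtration_cx)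
  obtain vs where vs: "quotient_basis (scaleD M) (hodge_filtration M p) vs"
    "length vs = codim (scaleD M) (hodge_filtration M p)"
    using D.ex_quotient_basis[OF subspace_hodge_filtration] .
  show ?thesis using Q.qb_card[OF quotient_basis_cx[OF vs(1)] assms] vs(2) by simp
qed

lemma length_eigenbasis: "ordered_basis (scaleB M) (V \<sigma>) bs \<Longrightarrow> length bs = eigen_rank M \<sigma>"
  by (simp add: B.length_ordered_basis eigen_rank_def)

lemma eigenbases_append:
  assumes p: "ordered_basis (scaleB M) (V 1) bp" and m: "ordered_basis (scaleB M) (V (- 1)) bm"
  shows "ordered_basis (scaleB M) UNIV (bp @ bm)"
proof -
  note p = p[unfolded B.ordered_basis_iff[OF subspace_eigen]]
  note m = m[unfolded B.ordered_basis_iff[OF subspace_eigen]]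
  have sum: "(\<Sum>i<length (bp @ bm). scaleB M (c i) ((bp @ bm) ! i)) =
    (\<Sum>i<length bp. scaleB M (c i) (bp ! i)) + (\<Sum>i<length bm. scaleB M (c (length bp + i)) (bm ! i))" for c
    by (simp add: sum_lessThan_add nth_append)
  have "\<exists>c. x = (\<Sum>i<length (bp @ bm). scaleB M (c i) ((bp @ bm) ! i))" for x
  proof -
    define y z where "y = scaleB M (1/2) (x + rho M x)" and "z = scaleB M (1/2) (x - rho M x)"
    have "y \<in> V 1" "z \<in> V (- 1)"
      by (simp_all add: y_def z_def betti_eigenspace_def \<rho>.scale \<rho>.add \<rho>.diff \<rho>\<rho> algebra_simps)
    then obtain c d where c: "y = (\<Sum>i<length bp. scaleB M (c i) (bp ! i))"
      "z = (\<Sum>i<length bm. scaleB M (d i) (bm ! i))" using p m by blast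
    have "x = y + z"
      by (simp add: y_def z_def algebra_simps flip: B.scale_left_distrib)
    then show ?thesis
      by (intro exI[of _ "\<lambda>i. if i < length bp then c i else d (i - length bp)"]) (simp only: sum, simp add: c)
  qed
  moreover have "c i = 0" if c: "(\<Sum>i<length (bp @ bm). scaleB M (c i) ((bp @ bm) ! i)) = 0"
    and i: "i < length (bp @ bm)" for c i
  proof -
    define y z where "y = (\<Sum>i<length bp. scaleB M (c i) (bp ! i))"
      and "z = (\<Sum>i<length bm. scaleB M (c (length bp + i)) (bm ! i))"
    have yz: "y + z = 0" using c unfolding sum y_def z_def .
    have "y \<in> V 1" unfolding y_def using p
      by (intro B.subspace_sum[OF subspace_eigen] B.subspace_scale[OF subspace_eigen]) auto
    then have ry: "rho M y = y" by (simp add: betti_eigenspace_def)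
    have "z \<in> V (- 1)" unfolding z_def using m
      by (intro B.subspace_sum[OF subspace_eigen] B.subspace_scale[OF subspace_eigen]) auto
    then have rz: "rho M z = - z" by (simp add: betti_eigenspace_def)
    have "rho M (y + z) = y - z" by (simp add: \<rho>.add ry rz)
    then have "y = z" using yz by (simp add: \<rho>.zero)
    then have "scaleB M 2 y = 0" using yz by (metis B.scale_left_distrib B.scale_one one_add_one)
    then have y0: "y = 0" by simp
    then have z0: "z = 0" using \<open>y = z\<close> by simp
    have 1: "\<forall>i<length bp. c i = 0" using p y0 unfolding y_def by blast
    have "(\<Sum>i<length bm. scaleB M (c (length bp + i)) (bm ! i)) = 0 \<longrightarrow> (\<forall>i<length bm. c (length bp + i) = 0)"
      using m by (elim conjE) (erule spec)
    then have 2: "\<forall>i<length bm. c (length bp + i) = 0" using z0 unfolding z_def by simp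
    show "c i = 0"
    proof (cases "i < length bp")
      case False
      then show ?thesis using 2 i by (metis add_diff_inverse_nat length_append nat_add_left_cancel_less)
    qed (use 1 in simp)
  qed
  ultimately show ?thesis unfolding B.ordered_basis_iff[OF B.subspace_UNIV] by simp
qed

lemma eigenbases_append_mem:
  assumes bp: "ordered_basis (scaleB M) (V 1) bp" and bm: "ordered_basis (scaleB M) (V (- 1)) bm"
    and j: "j < length (bp @ bm)"
  shows "(bp @ bm) ! j \<in> V (if j < length bp then 1 else - 1)"
proof (cases "j < length bp")
  case True
  then show ?thesis using bp by (simp add: nth_append B.ordered_basis_iff[OF subspace_eigen] subset_iff)
next
  case False
  then have "bm ! (j - length bp) \<in> V (- 1)"
    using bm j by (simp add: B.ordered_basis_iff[OF subspace_eigen] subset_iff)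
  then show ?thesis using False by (simp add: nth_append)
qed

lemma ex_signed_basis:
  obtains b and s :: "nat \<Rightarrow> int" where "ordered_basis (scaleB M) UNIV b"
    "\<forall>j<length b. s j \<in> {1, - 1} \<and> b ! j \<in> V (s j)"
proof -
  obtain bp where bp: "ordered_basis (scaleB M) (V 1) bp" using B.ex_ordered_basis[OF subspace_eigen] .
  obtain bm where bm: "ordered_basis (scaleB M) (V (- 1)) bm" using B.ex_ordered_basis[OF subspace_eigen] .
  show thesis
    by (rule that[OF eigenbases_append[OF bp bm], of "\<lambda>j. if j < length bp then 1 else - 1"])
      (use eigenbases_append_mem[OF bp bm] in auto)
qed

lemma \<rho>_eigen_cx: "v \<in> V \<sigma> \<Longrightarrow> cmap (rho M) (v \<otimes>\<^sub>\<rat> 1) = \<sigma>B (of_int \<sigma>) (v \<otimes>\<^sub>\<rat> 1)"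
  by (simp add: betti_eigenspace_def cmap_tens[OF \<rho>_linear] of_int_tensor
      cext_tens[OF biadditive_scale[OF B.vector_space_axioms]])

text \<open>The left side is twice the projection of \<open>x\<close> to the complexified
  eigenspace. Conjugation is defined over the coefficient field, so the projection has coordinates
  in a rational basis of the eigenspace; keeping the factor 2 saves a division.\<close>

lemma eigenspace_cx:
  assumes bs: "ordered_basis (scaleB M) (V \<sigma>) bs" and \<sigma>: "\<sigma> \<in> {1, - 1}"
  shows "\<exists>c. x + \<sigma>B (of_int \<sigma>) (cmap (rho M) x) = (\<Sum>j<length bs. \<sigma>B (c j) ((bs ! j) \<otimes>\<^sub>\<rat> 1))"
proof (induction x)
  case zero
  show ?case by (rule exI[of _ "\<lambda>_. 0"]) simp
next
  case (add v z x)
  note b = biadditive_scale[OF B.vector_space_axioms]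
  have "v + scaleB M (of_int \<sigma>) (rho M v) \<in> V \<sigma>"
    using \<sigma> by (auto simp: betti_eigenspace_def \<rho>.add \<rho>.scale \<rho>.neg \<rho>\<rho> add.commute)
  then obtain c where c: "v + scaleB M (of_int \<sigma>) (rho M v) = (\<Sum>j<length bs. scaleB M (c j) (bs ! j))"
    using bs unfolding B.ordered_basis_iff[OF subspace_eigen] by blast
  obtain d where d: "x + \<sigma>B (of_int \<sigma>) (cmap (rho M) x) = (\<Sum>j<length bs. \<sigma>B (d j) ((bs ! j) \<otimes>\<^sub>\<rat> 1))"
    using add by blast
  have "v \<otimes>\<^sub>\<rat> z + \<sigma>B (of_int \<sigma>) (cmap (rho M) (v \<otimes>\<^sub>\<rat> z)) = (v + scaleB M (of_int \<sigma>) (rho M v)) \<otimes>\<^sub>\<rat> z"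
    by (simp add: of_int_tensor cmap_tens[OF \<rho>_linear] cext_tens[OF b] tens_add_left)
  also have "\<dots> = (\<Sum>j<length bs. \<sigma>B (c j \<otimes>\<^sub>\<rat> z) ((bs ! j) \<otimes>\<^sub>\<rat> 1))"
    by (simp add: c tens_sum_left cext_tens[OF b])
  finally have e: "v \<otimes>\<^sub>\<rat> z + \<sigma>B (of_int \<sigma>) (cmap (rho M) (v \<otimes>\<^sub>\<rat> z)) =
      (\<Sum>j<length bs. \<sigma>B (c j \<otimes>\<^sub>\<rat> z) ((bs ! j) \<otimes>\<^sub>\<rat> 1))" .
  have "v \<otimes>\<^sub>\<rat> z + x + \<sigma>B (of_int \<sigma>) (cmap (rho M) (v \<otimes>\<^sub>\<rat> z + x)) =
      (v \<otimes>\<^sub>\<rat> z + \<sigma>B (of_int \<sigma>) (cmap (rho M) (v \<otimes>\<^sub>\<rat> z))) + (x + \<sigma>B (of_int \<sigma>) (cmap (rho M) x))"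
    by (simp only: \<rho>C.add I.m1.scale_right_distrib add_ac)
  also have "\<dots> = (\<Sum>j<length bs. \<sigma>B (c j \<otimes>\<^sub>\<rat> z + d j) ((bs ! j) \<otimes>\<^sub>\<rat> 1))"
    by (simp only: e d I.m1.scale_left_distrib sum.distrib)
  finally have "v \<otimes>\<^sub>\<rat> z + x + \<sigma>B (of_int \<sigma>) (cmap (rho M) (v \<otimes>\<^sub>\<rat> z + x)) =
      (\<Sum>j<length bs. \<sigma>B (c j \<otimes>\<^sub>\<rat> z + d j) ((bs ! j) \<otimes>\<^sub>\<rat> 1))" .
  then show ?case by (rule exI[of _ "\<lambda>j. c j \<otimes>\<^sub>\<rat> z + d j"])
qed

end

text \<open>
  A basis \<open>f\<close> of the complexified Betti realization whose vectors have Hodge levels \<open>t\<close> and are permuted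
  up to scalars by complex conjugation. For a tensor product of motives it consists of the products of
  Hodge vectors, so that \<open>t\<close> need not be injective.
\<close>

locale framed_motive = pure M
  for M :: "('e::field_char_0, 'b::ab_group_add, 'd::ab_group_add) motive" +
  fixes d :: nat and f :: "nat \<Rightarrow> 'b cx" and t :: "nat \<Rightarrow> int" and bar :: "nat \<Rightarrow> nat"
    and lam :: "nat \<Rightarrow> 'e cx"
  assumes f_qb: "BC.qb d f"
    and filtration: "filtration_cx M p = I ` {\<Sum>i<d. \<sigma>B (c i) (f i) | c. \<forall>i<d. t i < p \<longrightarrow> c i = 0}"
    and bar: "i < d \<Longrightarrow> bar i < d" "i < d \<Longrightarrow> bar (bar i) = i" "i < d \<Longrightarrow> t (bar i) = weight M - t i"
    and \<rho>_f: "i < d \<Longrightarrow> cmap (rho M) (f i) = \<sigma>B (lam i) (f (bar i))"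
begin

text \<open>The frame indices that survive modulo the step \<open>p\<close>: the vectors of level at
  least \<open>p\<close> span the filtration step, so the others give a basis of the
  quotient.\<close>

definition below :: "int \<Rightarrow> nat set"
  where "below p = {i. i < d \<and> t i < p}"

lemma finite_below: "finite (below p)"
  by (simp add: below_def)

lemma f_expand: "x = (\<Sum>i<d. \<sigma>B (BC.qc d f x i) (f i))"
  using BC.qc_spec[OF f_qb, of x] by simp

lemma sum_frame_below:
  fixes g :: "nat \<Rightarrow> 'a::comm_monoid_add"
  assumes \<kappa>: "bij_betw \<kappa> {..<k} (below p)"
  shows "(\<Sum>l<k. g (\<kappa> l)) = (\<Sum>i<d. if t i < p then g i else 0)"
proof -
  have "(\<Sum>l<k. g (\<kappa> l)) = (\<Sum>i\<in>below p. g i)" by (rule sum.reindex_bij_betw[OF \<kappa>])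
  also have "\<dots> = (\<Sum>i<d. if t i < p then g i else 0)"
    unfolding below_def by (subst sum.inter_filter[symmetric]) (auto intro: sum.cong)
  finally show ?thesis .
qed

lemma frame_quotient_mem:
  assumes \<kappa>: "bij_betw \<kappa> {..<k} (below p)"
  shows "I x - (\<Sum>l<k. \<sigma>D (BC.qc d f x (\<kappa> l)) (I (f (\<kappa> l)))) \<in> filtration_cx M p"
proof -
  let ?c = "BC.qc d f x"
  have "(\<Sum>l<k. \<sigma>D (?c (\<kappa> l)) (I (f (\<kappa> l)))) = (\<Sum>i<d. if t i < p then \<sigma>D (?c i) (I (f i)) else 0)"
    by (rule sum_frame_below[OF \<kappa>])
  also have "\<dots> = I (\<Sum>i<d. if t i < p then \<sigma>B (?c i) (f i) else 0)"
    by (simp add: I.sum I.scale if_distrib[of I] cong: if_cong)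
  finally have "I x - (\<Sum>l<k. \<sigma>D (?c (\<kappa> l)) (I (f (\<kappa> l)))) =
      I (x - (\<Sum>i<d. if t i < p then \<sigma>B (?c i) (f i) else 0))"
    by (simp add: I.diff)
  also have "x - (\<Sum>i<d. if t i < p then \<sigma>B (?c i) (f i) else 0) =
      (\<Sum>i<d. \<sigma>B (?c i) (f i)) - (\<Sum>i<d. if t i < p then \<sigma>B (?c i) (f i) else 0)"
    using f_expand[of x] by simp
  also have "\<dots> = (\<Sum>i<d. \<sigma>B (if t i < p then 0 else ?c i) (f i))"
    unfolding sum_subtractf[symmetric] by (intro sum.cong) auto
  finally show ?thesis
    unfolding filtration by (auto intro!: imageI exI[of _ "\<lambda>i. if t i < p then 0 else ?c i"])
qed

lemma frame_quotient_qb: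
  assumes \<kappa>: "bij_betw \<kappa> {..<k} (below p)"
  shows "quotient_module.qb \<sigma>D (filtration_cx M p) k (\<lambda>l. I (f (\<kappa> l)))"
proof -
  interpret Q: quotient_module \<sigma>D "filtration_cx M p" by (rule quotient_filtration_cx)
  have "\<exists>c. y - (\<Sum>l<k. \<sigma>D (c l) (I (f (\<kappa> l)))) \<in> filtration_cx M p" for y
  proof -
    obtain x where "y = I x" using I_bij by (metis bij_pointE)
    then show ?thesis using frame_quotient_mem[OF \<kappa>, of x]
      by (intro exI[of _ "\<lambda>l. BC.qc d f x (\<kappa> l)"]) simp
  qed
  moreover have "\<forall>l<k. c l = 0" if c: "(\<Sum>l<k. \<sigma>D (c l) (I (f (\<kappa> l)))) \<in> filtration_cx M p" for c
  proof (intro allI impI)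
    fix l assume l: "l < k"
    define c' where "c' = (\<lambda>i. c (inv_into {..<k} \<kappa> i))"
    have c': "c' (\<kappa> l) = c l" if "l < k" for l
      unfolding c'_def using \<kappa> that by (simp add: bij_betw_def inv_into_f_f)
    have "(\<Sum>l<k. \<sigma>D (c l) (I (f (\<kappa> l)))) = I (\<Sum>l<k. \<sigma>B (c' (\<kappa> l)) (f (\<kappa> l)))"
      by (simp add: I.sum I.scale c')
    also have "(\<Sum>l<k. \<sigma>B (c' (\<kappa> l)) (f (\<kappa> l))) = (\<Sum>i<d. if t i < p then \<sigma>B (c' i) (f i) else 0)"
      by (rule sum_frame_below[OF \<kappa>])
    finally obtain e where e: "\<forall>i<d. t i < p \<longrightarrow> e i = 0"
      "(\<Sum>i<d. if t i < p then \<sigma>B (c' i) (f i) else 0) = (\<Sum>i<d. \<sigma>B (e i) (f i))"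
      using c unfolding filtration by (auto simp: I_eq)
    \<comment> \<open>The element of the filtration involves only levels at least \<open>p\<close>.
      Its coefficients and \<open>c'\<close> therefore have disjoint supports and merge into one
      relation of the whole frame.\<close>
    have "(\<Sum>i<d. \<sigma>B (if t i < p then c' i else - e i) (f i)) =
      (\<Sum>i<d. if t i < p then \<sigma>B (c' i) (f i) else 0) - (\<Sum>i<d. \<sigma>B (e i) (f i))"
      unfolding sum_subtractf[symmetric] using e(1) by (intro sum.cong) auto
    then have "(\<Sum>i<d. \<sigma>B (if t i < p then c' i else - e i) (f i)) \<in> {0}" using e(2) by simp
    moreover have \<kappa>l: "\<kappa> l < d" "t (\<kappa> l) < p" using \<kappa> l by (auto simp: bij_betw_def below_def)
    ultimately have "(if t (\<kappa> l) < p then c' (\<kappa> l) else - e (\<kappa> l)) = 0"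
      using BC.qb_indep[OF f_qb, of "\<lambda>i. if t i < p then c' i else - e i" "\<kappa> l"] by blast
    then show "c l = 0" using \<kappa>l c'[OF l] by simp
  qed
  ultimately show ?thesis by (simp add: Q.qb_def)
qed

text \<open>Modulo a filtration step the frame coordinates are just restricted to
  \<open>below p\<close>. In this basis a period matrix consists of rows of the matrix that
  expresses Betti vectors in the frame.\<close>

lemma frame_quotient_qc:
  assumes \<kappa>: "bij_betw \<kappa> {..<k} (below p)" and l: "l < k"
  shows "quotient_module.qc \<sigma>D (filtration_cx M p) k (\<lambda>l. I (f (\<kappa> l))) (I x) l = BC.qc d f x (\<kappa> l)"
proof -
  interpret Q: quotient_module \<sigma>D "filtration_cx M p" by (rule quotient_filtration_cx)
  show ?thesis
    by (rule Q.qc_eq[OF frame_quotient_qb[OF \<kappa>] frame_quotient_mem[OF \<kappa>] l])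
qed

lemma ex_enum_below: "\<exists>\<kappa>. bij_betw \<kappa> {..<card (below p)} (below p)"
  using ex_bij_betw_nat_finite[OF finite_below] by (simp add: atLeast0LessThan)

lemma codim_hodge_filtration: "codim (scaleD M) (hodge_filtration M p) = card (below p)"
proof -
  obtain \<kappa> where "bij_betw \<kappa> {..<card (below p)} (below p)" using ex_enum_below by blast
  then show ?thesis by (intro codim_eqI[OF frame_quotient_qb])
qed

lemma critical_step_iff: "critical_step M \<sigma> p \<longleftrightarrow> card (below p) = eigen_rank M \<sigma>"
  by (simp add: critical_step_def codim_hodge_filtration)

text \<open>The last equation computes the trace of conjugation twice: in a basis of eigenvectors,
  and in the frame, where only the indices fixed by \<open>bar\<close> have diagonal
  entries.\<close>

lemma eigen_ranks:
  "d = eigen_rank M 1 + eigen_rank M (- 1)" "d = motive_rank M"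
  "(\<Sum>i | i < d \<and> bar i = i. lam i) = of_int (int (eigen_rank M 1) - int (eigen_rank M (- 1)))"
proof -
  obtain bp where bp: "ordered_basis (scaleB M) (V 1) bp" using B.ex_ordered_basis[OF subspace_eigen] .
  obtain bm where bm: "ordered_basis (scaleB M) (V (- 1)) bm" using B.ex_ordered_basis[OF subspace_eigen] .
  define b where "b = bp @ bm"
  have b: "ordered_basis (scaleB M) UNIV b" unfolding b_def by (rule eigenbases_append[OF bp bm])
  then have bC: "BC.qb (length b) (\<lambda>j. (b ! j) \<otimes>\<^sub>\<rat> 1)"
    using qb_cext_zero[OF B.vector_space_axioms] by (simp add: B.ordered_basis_UNIV_qb)
  have d: "d = length b" by (rule BC.qb_card[OF f_qb bC])
  show "d = eigen_rank M 1 + eigen_rank M (- 1)"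
    using d length_eigenbasis[OF bp] length_eigenbasis[OF bm] by (simp add: b_def)
  show "d = motive_rank M"
    using d B.length_ordered_basis[OF b] by (simp add: motive_rank_def)
  define s where "s = (\<lambda>j. if j < length bp then 1 else - 1 :: int)"
  have s: "cmap (rho M) ((b ! j) \<otimes>\<^sub>\<rat> 1) = \<sigma>B (of_int (s j)) ((b ! j) \<otimes>\<^sub>\<rat> 1)" if "j < length b" for j
    using eigenbases_append_mem[OF bp bm] that unfolding b_def s_def by (intro \<rho>_eigen_cx)
  have "(\<Sum>i | i < d \<and> bar i = i. lam i) = (\<Sum>i<d. if bar i = i then lam i else 0)"
    by (subst sum.inter_filter[symmetric]) (auto intro: sum.cong)
  also have "\<dots> = (\<Sum>i<d. BC.qc d f (cmap (rho M) (f i)) i)"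
    by (intro sum.cong) (auto simp: \<rho>_f BC.qc_scale[OF f_qb] BC.qc_base[OF f_qb] bar)
  also have "\<dots> = (\<Sum>j<length b. BC.qc (length b) (\<lambda>j. (b ! j) \<otimes>\<^sub>\<rat> 1) (cmap (rho M) ((b ! j) \<otimes>\<^sub>\<rat> 1)) j)"
    by (rule BC.trace_invariant[OF HOL.refl \<rho>C.module_hom_axioms f_qb bC])
  also have "\<dots> = (\<Sum>j<length b. of_int (s j))"
    by (intro sum.cong) (auto simp: s BC.qc_scale[OF bC] BC.qc_base[OF bC])
  also have "\<dots> = of_int (int (length bp) - int (length bm))"
    by (simp add: b_def sum_lessThan_add s_def)
  finally show "(\<Sum>i | i < d \<and> bar i = i. lam i) = of_int (int (eigen_rank M 1) - int (eigen_rank M (- 1)))"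
    by (simp add: length_eigenbasis[OF bp] length_eigenbasis[OF bm])
qed

lemma card_bar_image: "A \<subseteq> {..<d} \<Longrightarrow> card (bar ` A) = card A"
  by (rule card_image, rule inj_on_inverseI[of _ bar]) (use bar(2) in auto)

text \<open>
  If a step cuts out half of the frame, then it is \<open>{i. 2 * t i < weight M}\<close> up to middle indices, and
  counting excludes the latter: this is how criticality of the tensor product is used.
\<close>

lemma bar_notin_below:
  assumes card: "2 * card (below p) = d" and i: "i \<in> below p"
  shows "bar i \<notin> below p"
proof (cases "2 * p \<le> weight M")
  case True
  then show ?thesis using i bar[of i] by (auto simp: below_def)
next
  case False
  have K: "below p \<subseteq> {..<d}" by (auto simp: below_def)
  have "i \<in> below p \<union> bar ` below p" if i: "i < d" for i
  proof (cases "t i < p")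
    case True
    then show ?thesis using i by (simp add: below_def)
  next
    case nlt: False
    then have "bar i \<in> below p" using False bar[OF i] by (auto simp: below_def)
    then show ?thesis using bar(2)[OF i] by (metis UnI2 imageI)
  qed
  \<comment> \<open>With \<open>2 * p\<close> above the weight, \<open>below p\<close> and its
    mirror image cover the frame. Each has half the size of the frame, so they cannot
    overlap.\<close>
  then have "card {..<d} \<le> card (below p \<union> bar ` below p)"
    by (intro card_mono) (auto simp: finite_below)
  then have "card (below p \<inter> bar ` below p) = 0"
    using card_Un_Int[OF finite_below finite_imageI[OF finite_below], of p bar p] card card_bar_image[OF K] by simp
  then have "below p \<inter> bar ` below p = {}" by (simp add: finite_below)
  moreover have "i = bar (bar i)" using i bar(2) by (simp add: below_def)
  ultimately show ?thesis using i by blast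
qed

text \<open>For \<open>i\<close> in \<open>below p\<close> the conjugate of \<open>f i\<close> lies
  in the filtration step, since \<open>bar i\<close> is not in \<open>below p\<close>. So
  \<open>f i\<close> has the same class as its sum with \<sigma> times its conjugate, which lies in
  the complexified eigenspace. Hence the images of the eigenbasis generate the quotient; there are
  as many of them as its rank, so they form a basis: the period map is an isomorphism.\<close>

lemma eigenbasis_quotient_qb:
  assumes card: "2 * card (below p) = d" and step: "critical_step M \<sigma> p" and \<sigma>: "\<sigma> \<in> {1, - 1}"
    and bs: "ordered_basis (scaleB M) (V \<sigma>) bs"
  shows "quotient_module.qb \<sigma>D (filtration_cx M p) (card (below p)) (\<lambda>j. I ((bs ! j) \<otimes>\<^sub>\<rat> 1))"
proof -
  interpret Q: quotient_module \<sigma>D "filtration_cx M p" by (rule quotient_filtration_cx)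
  obtain \<kappa> where \<kappa>: "bij_betw \<kappa> {..<card (below p)} (below p)" using ex_enum_below by blast
  have len: "length bs = card (below p)"
    using length_eigenbasis[OF bs] step by (simp add: critical_step_iff)
  have "\<exists>c. I (f (\<kappa> l)) - (\<Sum>j<card (below p). \<sigma>D (c j) (I ((bs ! j) \<otimes>\<^sub>\<rat> 1))) \<in> filtration_cx M p"
    if l: "l < card (below p)" for l
  proof -
    define i where "i = \<kappa> l"
    have i: "i \<in> below p" using \<kappa> l by (auto simp: i_def bij_betw_def)
    then have id: "i < d" by (simp add: below_def)
    obtain c where c: "f i + \<sigma>B (of_int \<sigma>) (cmap (rho M) (f i)) = (\<Sum>j<length bs. \<sigma>B (c j) ((bs ! j) \<otimes>\<^sub>\<rat> 1))"
      using eigenspace_cx[OF bs \<sigma>] by blast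
    have "I (f i) - (\<Sum>j<length bs. \<sigma>D (c j) (I ((bs ! j) \<otimes>\<^sub>\<rat> 1))) =
        I (f i - (f i + \<sigma>B (of_int \<sigma>) (cmap (rho M) (f i))))"
      unfolding c by (simp add: I.diff I.sum I.scale)
    also have "f i - (f i + \<sigma>B (of_int \<sigma>) (cmap (rho M) (f i))) = \<sigma>B (- of_int \<sigma> * lam i) (f (bar i))"
      by (simp add: \<rho>_f[OF id])
    also have "\<dots> = (\<Sum>j<d. \<sigma>B (of_bool (j = bar i) * (- of_int \<sigma> * lam i)) (f j))"
      by (rule BC.sum_delta_scale[OF bar(1)[OF id], symmetric])
    finally have "I (f i) - (\<Sum>j<length bs. \<sigma>D (c j) (I ((bs ! j) \<otimes>\<^sub>\<rat> 1))) =
        I (\<Sum>j<d. \<sigma>B (of_bool (j = bar i) * (- of_int \<sigma> * lam i)) (f j))" .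
    moreover have "(\<Sum>j<d. \<sigma>B (of_bool (j = bar i) * (- of_int \<sigma> * lam i)) (f j)) \<in>
        {\<Sum>i<d. \<sigma>B (c i) (f i) | c. \<forall>i<d. t i < p \<longrightarrow> c i = 0}"
    proof (intro CollectI exI conjI)
      show "\<forall>j<d. t j < p \<longrightarrow> of_bool (j = bar i) * (- of_int \<sigma> * lam i) = 0"
        using bar_notin_below[OF card i] by (auto simp: below_def)
    qed (rule HOL.refl)
    ultimately have "I (f i) - (\<Sum>j<length bs. \<sigma>D (c j) (I ((bs ! j) \<otimes>\<^sub>\<rat> 1))) \<in> filtration_cx M p"
      unfolding filtration by (simp only: imageI)
    then show ?thesis unfolding len i_def by (rule exI[of _ c])
  qed
  then show ?thesis by (rule Q.qb_spanI[OF frame_quotient_qb[OF \<kappa>]])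
qed

text \<open>The filtration is decreasing, so any two steps are comparable, and comparable steps of
  equal codimension coincide.\<close>

lemma hodge_filtration_step_unique:
  assumes "critical_step M \<sigma> p" "critical_step M \<sigma> p'"
  shows "hodge_filtration M p' = hodge_filtration M p"
proof -
  have mono: "antimono (hodge_filtration M)" using pure by (simp add: pure_motive_def)
  have "codim (scaleD M) (hodge_filtration M p) = codim (scaleD M) (hodge_filtration M p')"
    using assms by (simp add: critical_step_def)
  then show ?thesis
    using D.subspace_codim_eq[OF subspace_hodge_filtration subspace_hodge_filtration] antimonoD[OF mono]
    by (metis linorder_le_cases)
qed

text \<open>The factor \<open>C\<close> depends on the step of the filtration but not on the sign, so it cancels in \<open>c\<^sup>+ / c\<^sup>-\<close>.\<close>

lemma period_eq:
  assumes card: "2 * card (below p) = d" and \<kappa>: "bij_betw \<kappa> {..<card (below p)} (below p)"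
  shows "\<exists>C. C dvd 1 \<and> (\<forall>\<sigma> bs. \<sigma> \<in> {1, - 1} \<longrightarrow> critical_step M \<sigma> p \<longrightarrow> ordered_basis (scaleB M) (V \<sigma>) bs \<longrightarrow>
    (let A = mat (card (below p)) (card (below p)) (\<lambda>(l, j). BC.qc d f ((bs ! j) \<otimes>\<^sub>\<rat> 1) (\<kappa> l))
     in det A dvd 1 \<and> period M \<sigma> = {r * (C * det A) | r. r \<in> rational_units}))"
proof -
  interpret Q: quotient_module \<sigma>D "filtration_cx M p" by (rule quotient_filtration_cx)
  define k where "k = card (below p)"
  obtain vs where vs: "quotient_basis (scaleD M) (hodge_filtration M p) vs"
    "length vs = codim (scaleD M) (hodge_filtration M p)"
    using D.ex_quotient_basis[OF subspace_hodge_filtration] .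
  define v where "v = (\<lambda>i. (vs ! i) \<otimes>\<^sub>\<rat> (1::complex))"
  define F where "F = (\<lambda>l. I (f (\<kappa> l)))"
  have F: "Q.qb k F" unfolding F_def k_def by (rule frame_quotient_qb[OF \<kappa>])
  have lvs: "length vs = k" using vs(2) by (simp add: codim_hodge_filtration k_def)
  have v: "Q.qb k v" using quotient_basis_cx[OF vs(1)] by (simp add: v_def lvs)
  define C where "C = det (Q.tm k v F)"
  have C: "C dvd 1" unfolding C_def by (rule Q.tm_unit[OF v F])
  have main: "det A dvd 1 \<and> period M \<sigma> = {r * (C * det A) | r. r \<in> rational_units}"
    if \<sigma>: "\<sigma> \<in> {1, - 1}" and step: "critical_step M \<sigma> p" and bs: "ordered_basis (scaleB M) (V \<sigma>) bs"
      and A: "A = mat k k (\<lambda>(l, j). BC.qc d f ((bs ! j) \<otimes>\<^sub>\<rat> 1) (\<kappa> l))" for \<sigma> bs A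
  proof -
    define b where "b = (\<lambda>j. I ((bs ! j) \<otimes>\<^sub>\<rat> 1))"
    have b: "Q.qb k b" unfolding b_def k_def by (rule eigenbasis_quotient_qb[OF card step \<sigma> bs])
    have lbs: "length bs = k" using length_eigenbasis[OF bs] step by (simp add: critical_step_iff k_def)
    have A': "A = Q.tm k F b"
      unfolding A Q.tm_def F_def b_def k_def
      by (intro eq_matI) (auto simp: frame_quotient_qc[OF \<kappa>])
    \<comment> \<open>The factor \<open>C\<close> is the passage from the Hodge vectors to the
      rational quotient basis; it involves \<open>v\<close> and \<open>F\<close> only, not the
      eigenbasis.\<close>
    have CA: "C * det A = det (Q.tm k v b)"
      unfolding C_def A' by (rule Q.tm_det_trans[OF v F, symmetric])
    have "r * (C * det A) \<in> period M \<sigma>" if "r \<in> rational_units" for r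
    proof -
      have "is_period_matrix M \<sigma> (Q.tm k v b)"
        unfolding is_period_matrix_def
      proof (intro exI conjI)
        show "critical_step M \<sigma> p" "ordered_basis (scaleB M) (V \<sigma>) bs"
          "quotient_basis (scaleD M) (hodge_filtration M p) vs"
          "Q.tm k v b \<in> carrier_mat (length vs) (length bs)"
          using step bs vs(1) by (simp_all add: lvs lbs)
        show "\<forall>j<length bs. I ((bs ! j) \<otimes>\<^sub>\<rat> 1) - (\<Sum>i<length vs. \<sigma>D (Q.tm k v b $$ (i, j)) ((vs ! i) \<otimes>\<^sub>\<rat> 1)) \<in> filtration_cx M p"
          using Q.qc_spec[OF v, of "b j" for j] by (simp add: Q.tm_def lbs lvs v_def b_def)
      qed
      then show ?thesis unfolding period_def CA using that by blast
    qed
    moreover have "\<exists>r'\<in>rational_units. r * det A' = r' * (C * det A)"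
      if r: "r \<in> rational_units" and A': "is_period_matrix M \<sigma> A'" for r A'
    proof -
      obtain p' bs' vs' where p': "critical_step M \<sigma> p'" and bs': "ordered_basis (scaleB M) (V \<sigma>) bs'"
        and vs': "quotient_basis (scaleD M) (hodge_filtration M p') vs'"
        and A'c: "A' \<in> carrier_mat (length vs') (length bs')"
        and mem: "\<forall>j<length bs'. I ((bs' ! j) \<otimes>\<^sub>\<rat> 1) - (\<Sum>i<length vs'. \<sigma>D (A' $$ (i, j)) ((vs' ! i) \<otimes>\<^sub>\<rat> 1)) \<in> filtration_cx M p'"
        using A' unfolding is_period_matrix_def by blast
      note F' = hodge_filtration_step_unique[OF step p']
      then have FC': "filtration_cx M p' = filtration_cx M p" by (simp add: filtration_cx_def)
      have lvs': "length vs' = k"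
        using D.length_quotient_basis[OF subspace_hodge_filtration vs'] by (simp add: F' codim_hodge_filtration k_def)
      have lbs': "length bs' = k" using length_eigenbasis[OF bs'] step by (simp add: critical_step_iff k_def)
      define v' where "v' = (\<lambda>i. (vs' ! i) \<otimes>\<^sub>\<rat> (1::complex))"
      define b' where "b' = (\<lambda>j. I ((bs' ! j) \<otimes>\<^sub>\<rat> 1))"
      have v': "Q.qb k v'" using quotient_basis_cx[of p vs'] vs' by (simp add: v'_def lvs' F')
      have b': "Q.qb k b'" unfolding b'_def k_def by (rule eigenbasis_quotient_qb[OF card step \<sigma> bs'])
      have "A' = Q.tm k v' b'"
      proof (rule eq_matI)
        fix i j assume "i < dim_row (Q.tm k v' b')" "j < dim_col (Q.tm k v' b')"
        then have ij: "i < k" "j < k" by (auto simp: Q.tm_def)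
        then have "b' j - (\<Sum>i<k. \<sigma>D (A' $$ (i, j)) (v' i)) \<in> filtration_cx M p"
          using mem by (simp add: lbs' lvs' FC' b'_def v'_def)
        from Q.qc_eq[OF v' this ij(1)] show "A' $$ (i, j) = Q.tm k v' b' $$ (i, j)"
          using ij by (simp add: Q.tm_def)
      qed (use A'c lvs' lbs' in \<open>auto simp: Q.tm_def\<close>)
      \<comment> \<open>An arbitrary period matrix differs from the chosen one by two changes
        between rational bases, one in the de Rham quotient and one in the eigenspace. The outer
        factors are therefore the images \<open>e1\<close> and \<open>e2\<close> of elements of the
        field.\<close>
      then have detA': "det A' = det (Q.tm k v' v) * (det (Q.tm k v b) * det (Q.tm k b b'))"
        using Q.tm_det_trans[OF v' v, of b'] Q.tm_det_trans[OF v b, of b'] by simp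
      interpret E: quotient_module "scaleD M" "hodge_filtration M p" by (rule quotient_hodge_filtration)
      note sD = biadditive_scale[OF D.vector_space_axioms]
      have Ev': "E.qb k (\<lambda>i. vs' ! i)"
        using vs' by (simp add: F' quotient_basis_iff_qb[OF quotient_hodge_filtration] lvs')
      have "Q.tm k v' v = map_mat (\<lambda>e. e \<otimes>\<^sub>\<rat> 1) (E.tm k (\<lambda>i. vs' ! i) (\<lambda>i. vs ! i))"
      proof (rule eq_matI, goal_cases)
        case (1 i j)
        then have ij: "i < k" "j < k" by (auto simp: E.tm_def)
        let ?c = "E.qc k (\<lambda>i. vs' ! i) (vs ! j)"
        have "vs ! j - (\<Sum>i<k. scaleD M (?c i) (vs' ! i)) \<in> hodge_filtration M p"
          by (rule E.qc_spec[OF Ev'])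
        then have "(vs ! j - (\<Sum>i<k. scaleD M (?c i) (vs' ! i))) \<otimes>\<^sub>\<rat> 1 \<in> filtration_cx M p"
          unfolding filtration_cx_def by (intro I.m2.span_base imageI)
        also have "(vs ! j - (\<Sum>i<k. scaleD M (?c i) (vs' ! i))) \<otimes>\<^sub>\<rat> 1 =
            v j - (\<Sum>i<k. \<sigma>D (?c i \<otimes>\<^sub>\<rat> 1) (v' i))"
          by (simp add: tens_diff_left tens_sum_left v_def v'_def cext_tens[OF sD])
        finally have "Q.qc k v' (v j) i = ?c i \<otimes>\<^sub>\<rat> 1" by (intro Q.qc_eq[OF v' _ ij(1)])
        then show ?case using ij by (simp add: Q.tm_def E.tm_def)
      qed (auto simp: Q.tm_def E.tm_def)
      then obtain e1 where e1: "det (Q.tm k v' v) = e1 \<otimes>\<^sub>\<rat> 1" by (metis emb.hom_det)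
      have "\<exists>c. bs' ! j = (\<Sum>i<k. scaleB M (c i) (bs ! i))" if "j < k" for j
        using bs bs' that unfolding B.ordered_basis_iff[OF subspace_eigen] lbs lbs'
        by (metis nth_mem lbs' subsetD)
      then obtain c where c: "bs' ! j = (\<Sum>i<k. scaleB M (c j i) (bs ! i))" if "j < k" for j by metis
      have "Q.tm k b b' = map_mat (\<lambda>e. e \<otimes>\<^sub>\<rat> 1) (mat k k (\<lambda>(i, j). c j i))"
      proof (rule eq_matI, goal_cases)
        case (1 i j)
        then have ij: "i < k" "j < k" by auto
        have "(bs' ! j) \<otimes>\<^sub>\<rat> 1 = (\<Sum>i<k. \<sigma>B (c j i \<otimes>\<^sub>\<rat> 1) ((bs ! i) \<otimes>\<^sub>\<rat> 1))"
          by (simp add: c[OF ij(2)] tens_sum_left cext_tens[OF biadditive_scale[OF B.vector_space_axioms]])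
        then have "b' j - (\<Sum>i<k. \<sigma>D (c j i \<otimes>\<^sub>\<rat> 1) (b i)) = 0"
          by (simp add: b'_def b_def I.sum I.scale)
        then have "b' j - (\<Sum>i<k. \<sigma>D (c j i \<otimes>\<^sub>\<rat> 1) (b i)) \<in> filtration_cx M p"
          by (simp add: I.m2.subspace_0[OF Q.F])
        from Q.qc_eq[OF b this ij(1)] show ?case using ij by (simp add: Q.tm_def)
      qed (auto simp: Q.tm_def)
      then obtain e2 where e2: "det (Q.tm k b b') = e2 \<otimes>\<^sub>\<rat> 1" by (metis emb.hom_det)
      have "e1 \<noteq> 0" using Q.tm_unit[OF v' v] unfolding e1 by (rule tens_one_unit)
      moreover have "e2 \<noteq> 0" using Q.tm_unit[OF b b'] unfolding e2 by (rule tens_one_unit)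
      moreover obtain e where e: "r = e \<otimes>\<^sub>\<rat> 1" "e \<noteq> 0" using r by (auto simp: rational_units_def)
      ultimately have "(e * e1 * e2) \<otimes>\<^sub>\<rat> 1 \<in> (rational_units :: 'e cx set)" by (auto simp: rational_units_def)
      moreover have "r * det A' = ((e * e1 * e2) \<otimes>\<^sub>\<rat> 1) * (C * det A)"
        by (simp add: detA' CA e1 e2 e emb.hom_mult mult_ac)
      ultimately show ?thesis by blast
    qed
    ultimately have "period M \<sigma> = {r * (C * det A) | r. r \<in> rational_units}"
      unfolding period_def by blast
    moreover have "det A dvd 1" unfolding A' by (rule Q.tm_unit[OF F b])
    ultimately show ?thesis by blast
  qed
  show ?thesis
    unfolding Let_def k_def[symmetric]
    by (rule exI[of _ C], intro conjI C allI impI; drule (2) main[OF _ _ _ HOL.refl]) simp_all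
qed

end

section \<open>Frames from Hodge summands of rank one\<close>

context pure
begin

lemma span_frame:
  "I.m1.span (f ` {i. i < d \<and> p \<le> t i}) = {\<Sum>i<d. \<sigma>B (c i) (f i) | c. \<forall>i<d. t i < p \<longrightarrow> c i = 0}"
  for t :: "nat \<Rightarrow> int"
proof
  let ?R = "{\<Sum>i<d. \<sigma>B (c i) (f i) | c. \<forall>i<d. t i < p \<longrightarrow> c i = 0}"
  show "?R \<subseteq> I.m1.span (f ` {i. i < d \<and> p \<le> t i})"
  proof clarify
    fix c :: "nat \<Rightarrow> 'e cx" assume c: "\<forall>i<d. t i < p \<longrightarrow> c i = 0"
    show "(\<Sum>i<d. \<sigma>B (c i) (f i)) \<in> I.m1.span (f ` {i. i < d \<and> p \<le> t i})"
    proof (rule I.m1.span_sum)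
      fix i assume "i \<in> {..<d}"
      then show "\<sigma>B (c i) (f i) \<in> I.m1.span (f ` {i. i < d \<and> p \<le> t i})"
        using c by (cases "t i < p") (simp_all add: I.m1.span_zero I.m1.span_scale I.m1.span_base)
    qed
  qed
  have mem: "(\<Sum>i<d. \<sigma>B (c i) (f i)) \<in> ?R" if "\<forall>i<d. t i < p \<longrightarrow> c i = 0" for c
    using that by blast
  show "I.m1.span (f ` {i. i < d \<and> p \<le> t i}) \<subseteq> ?R"
  proof (rule I.m1.span_minimal)
    show "f ` {i. i < d \<and> p \<le> t i} \<subseteq> ?R"
    proof clarify
      fix i assume i: "i < d" "p \<le> t i"
      have "f i = (\<Sum>j<d. \<sigma>B (of_bool (j = i) * 1) (f j))"
        using BC.sum_delta_scale[OF i(1), where c = 1 and v = f] by simp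
      also have "\<dots> \<in> ?R" by (rule mem) (use i in auto)
      finally show "\<exists>c. f i = (\<Sum>i<d. \<sigma>B (c i) (f i)) \<and> (\<forall>i<d. t i < p \<longrightarrow> c i = 0)" by blast
    qed
    show "I.m1.subspace ?R"
    proof (rule I.m1.subspaceI)
      show "0 \<in> ?R" using mem[of "\<lambda>_. 0"] by simp
    next
      fix x y assume "x \<in> ?R" "y \<in> ?R"
      then obtain a b where ab: "x = (\<Sum>i<d. \<sigma>B (a i) (f i))" "y = (\<Sum>i<d. \<sigma>B (b i) (f i))"
        "\<forall>i<d. t i < p \<longrightarrow> a i = 0" "\<forall>i<d. t i < p \<longrightarrow> b i = 0" by blast
      then have "x + y = (\<Sum>i<d. \<sigma>B (a i + b i) (f i))"
        by (simp add: I.m1.scale_left_distrib sum.distrib)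
      also have "\<dots> \<in> ?R" by (rule mem) (use ab in simp)
      finally show "x + y \<in> ?R" .
    next
      fix r x assume "x \<in> ?R"
      then obtain a where a: "x = (\<Sum>i<d. \<sigma>B (a i) (f i))" "\<forall>i<d. t i < p \<longrightarrow> a i = 0" by blast
      then have "\<sigma>B r x = (\<Sum>i<d. \<sigma>B (r * a i) (f i))"
        by (simp add: I.m1.scale_sum_right)
      also have "\<dots> \<in> ?R" by (rule mem) (use a in simp)
      finally show "\<sigma>B r x \<in> ?R" .
    qed
  qed
qed

lemma ex_betti_basis:
  obtains bs where "ordered_basis (scaleB M) UNIV bs" "BC.qb (length bs) (\<lambda>j. (bs ! j) \<otimes>\<^sub>\<rat> 1)"
proof -
  obtain bs where "ordered_basis (scaleB M) UNIV bs" using B.ex_ordered_basis[OF B.subspace_UNIV] .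
  then show thesis
    using that qb_cext_zero[OF B.vector_space_axioms] by (simp add: B.ordered_basis_UNIV_qb)
qed

abbreviation H :: "int \<Rightarrow> 'b cx set"
  where "H p \<equiv> hodge M p (weight M - p)"

lemma hodge_decomposition: "\<exists>!g. (\<forall>p. g p \<in> H p) \<and> finite {p. g p \<noteq> 0} \<and> x = (\<Sum>p | g p \<noteq> 0. g p)"
  using pure by (auto simp: pure_motive_def is_direct_sum_def)

lemma subspace_H: "I.m1.subspace (H p)"
proof -
  have "free_of_rank \<sigma>B (H p) (hodge_number M p (weight M - p))" using pure by (auto simp: pure_motive_def)
  then show ?thesis unfolding free_of_rank_def by (metis I.m1.subspace_span)
qed

text \<open>The uniqueness in \<open>is_direct_sum\<close> concerns finitely supported families over
  all integers; families on the finite set \<open>T\<close> are extended by 0 to fall under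
  it.\<close>

lemma H_unique:
  assumes "finite T" "\<And>p. p \<in> T \<Longrightarrow> g p \<in> H p" "\<And>p. p \<in> T \<Longrightarrow> g' p \<in> H p"
    "(\<Sum>p\<in>T. g p) = (\<Sum>p\<in>T. g' p)" "p \<in> T"
  shows "g p = g' p"
proof -
  have *: "(\<forall>p. (if p \<in> T then h p else 0) \<in> H p) \<and> finite {p. (if p \<in> T then h p else 0) \<noteq> 0} \<and>
      (\<Sum>p\<in>T. h p) = (\<Sum>p | (if p \<in> T then h p else 0) \<noteq> 0. (if p \<in> T then h p else 0))"
    if "\<And>p. p \<in> T \<Longrightarrow> h p \<in> H p" for h
  proof -
    have "{p. (if p \<in> T then h p else 0) \<noteq> 0} \<subseteq> T" by auto
    moreover from this have "finite {p. (if p \<in> T then h p else 0) \<noteq> 0}" using assms(1) finite_subset by blast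
    moreover have "(\<Sum>p\<in>T. h p) = (\<Sum>p | (if p \<in> T then h p else 0) \<noteq> 0. (if p \<in> T then h p else 0))"
      by (rule sum.mono_neutral_cong_right[OF assms(1)]) auto
    ultimately show ?thesis using that by (auto simp: I.m1.subspace_0[OF subspace_H])
  qed
  define Q where "Q = (\<lambda>g. (\<forall>p. g p \<in> H p) \<and> finite {p. g p \<noteq> 0} \<and> (\<Sum>p\<in>T. g' p) = (\<Sum>p | g p \<noteq> 0. g p))"
  have "\<exists>!g. Q g" unfolding Q_def by (rule hodge_decomposition)
  moreover have "Q (\<lambda>p. if p \<in> T then g p else 0)"
    using *[of g, OF assms(2)] unfolding Q_def assms(4) .
  moreover have "Q (\<lambda>p. if p \<in> T then g' p else 0)"
    using *[of g', OF assms(3)] unfolding Q_def .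
  ultimately have "(\<lambda>p. if p \<in> T then g p else 0) = (\<lambda>p. if p \<in> T then g' p else 0)"
    by blast
  then show ?thesis using assms(5) by metis
qed

text \<open>The components of the members of a finite basis involve finitely many types. A nonzero
  vector of any other type would have two decompositions: itself, and the one obtained by expanding
  it in the basis.\<close>

lemma finite_hodge_types: "finite {p. H p \<noteq> {0}}"
proof -
  obtain bs where bs: "BC.qb (length bs) (\<lambda>j. (bs ! j) \<otimes>\<^sub>\<rat> 1)" using ex_betti_basis .
  define b where "b = (\<lambda>j. (bs ! j) \<otimes>\<^sub>\<rat> (1::complex))"
  have "\<exists>g. (\<forall>p. g p \<in> H p) \<and> finite {p. g p \<noteq> 0} \<and> x = (\<Sum>p | g p \<noteq> 0. g p)" for x
    using hodge_decomposition[of x] by blast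
  then obtain g where g: "\<And>x p. g x p \<in> H p" "\<And>x. finite {p. g x p \<noteq> 0}"
    "\<And>x. x = (\<Sum>p | g x p \<noteq> 0. g x p)" by metis
  define S where "S = (\<Union>j<length bs. {p. g (b j) p \<noteq> 0})"
  have S: "finite S" unfolding S_def using g(2) by auto
  have "p \<in> S" if p: "H p \<noteq> {0}" for p
  proof (rule ccontr)
    assume pS: "p \<notin> S"
    obtain x where x: "x \<in> H p" "x \<noteq> 0" using p I.m1.subspace_0[OF subspace_H] by blast
    define c where "c = BC.qc (length bs) b x"
    have "x = (\<Sum>j<length bs. \<sigma>B (c j) (b j))"
      using BC.qc_spec[OF bs, of x] by (simp add: c_def b_def)
    also have "\<dots> = (\<Sum>j<length bs. \<sigma>B (c j) (\<Sum>q\<in>S. g (b j) q))"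
    proof (intro sum.cong)
      fix j assume j: "j \<in> {..<length bs}"
      have "b j = (\<Sum>q\<in>S. g (b j) q)"
        by (subst g(3), rule sum.mono_neutral_left[OF S]) (use j in \<open>auto simp: S_def\<close>)
      then show "\<sigma>B (c j) (b j) = \<sigma>B (c j) (\<Sum>q\<in>S. g (b j) q)" by (rule arg_cong)
    qed simp
    also have "\<dots> = (\<Sum>q\<in>S. \<Sum>j<length bs. \<sigma>B (c j) (g (b j) q))"
      by (simp add: I.m1.scale_sum_right) (rule sum.swap)
    finally have e: "x = (\<Sum>q\<in>S. \<Sum>j<length bs. \<sigma>B (c j) (g (b j) q))" .
    have "(\<Sum>q\<in>insert p S. if q = p then x else 0) = x"
      using S by simp
    also have "x = (\<Sum>q\<in>insert p S. if q = p then 0 else \<Sum>j<length bs. \<sigma>B (c j) (g (b j) q))"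
      unfolding sum.insert[OF S pS] using pS
      by (subst e) (simp, rule sum.cong, auto)
    finally have "(if p = p then x else 0) = (if p = p then 0 else \<Sum>j<length bs. \<sigma>B (c j) (g (b j) p))"
      by (intro H_unique[of "insert p S" "\<lambda>q. if q = p then x else 0"
            "\<lambda>q. if q = p then 0 else \<Sum>j<length bs. \<sigma>B (c j) (g (b j) q)"])
        (use S x g(1) in \<open>auto intro!: I.m1.subspace_0[OF subspace_H] I.m1.subspace_sum[OF subspace_H] I.m1.subspace_scale[OF subspace_H]\<close>)
    then show False using x by simp
  qed
  then have "{p. H p \<noteq> {0}} \<subseteq> S" by blast
  then show ?thesis using S by (rule finite_subset)
qed

lemma \<rho>_H: "cmap (rho M) ` H p = H (weight M - p)"
  using pure by (auto simp: pure_motive_def)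

lemma H_reflect: "H (weight M - p) \<noteq> {0} \<longleftrightarrow> H p \<noteq> {0}"
proof -
  have "H (weight M - p) = {0}" if "H p = {0}" for p
    using \<rho>_H[of p] that by simp
  from this[of p] this[of "weight M - p"] show ?thesis by auto
qed

text \<open>Every enumeration \<open>h\<close> of the nonzero types yields a frame. The choice of
  \<open>h\<close> is left open because the second motive needs an enumeration in which the middle
  type comes last.\<close>

lemma ex_hodge_generators:
  assumes h1: "\<And>p q. hodge_number M p q \<noteq> 0 \<Longrightarrow> hodge_number M p q = 1"
  obtains T e where "finite T" "\<And>p. p \<in> T \<longleftrightarrow> H p \<noteq> {0}"
    "\<And>p. p \<in> T \<Longrightarrow> H p = range (\<lambda>r. \<sigma>B r (e p))"
    "\<And>d h. bij_betw h {..<d} T \<Longrightarrow> \<exists>bar lam. framed_motive M d (\<lambda>i. e (h i)) h bar lam"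
proof -
  define T where "T = {p. H p \<noteq> {0}}"
  have T: "finite T" unfolding T_def by (rule finite_hodge_types)
  have "\<exists>e. H p = range (\<lambda>r. \<sigma>B r e) \<and> (\<forall>r. \<sigma>B r e = 0 \<longrightarrow> r = 0)" if p: "p \<in> T" for p
  proof -
    have "free_of_rank \<sigma>B (H p) (hodge_number M p (weight M - p))" using pure by (auto simp: pure_motive_def)
    then obtain B where B: "finite B" "card B = hodge_number M p (weight M - p)"
      "I.m1.independent B" "I.m1.span B = H p" unfolding free_of_rank_def by blast
    have "B \<noteq> {}"
    proof
      assume "B = {}"
      then have "H p = {0}" using B(4) by (simp only: I.m1.span_empty)
      then show False using p by (simp add: T_def)
    qed
    then have "card B \<noteq> 0" using B(1) by simp
    then have "card B = 1" using B h1 by simp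
    then obtain e where e: "B = {e}" by (auto simp: card_1_singleton_iff)
    have "\<forall>r. \<sigma>B r e = 0 \<longrightarrow> r = 0"
      using I.m1.independentD[OF B(3), of "{e}" "\<lambda>_. r" e for r] e by simp
    moreover have "H p = range (\<lambda>r. \<sigma>B r e)"
      using B(4) unfolding e I.m1.span_singleton by (rule HOL.sym)
    ultimately show ?thesis by (intro exI[of _ e] conjI)
  qed
  then obtain e where e: "\<And>p. p \<in> T \<Longrightarrow> H p = range (\<lambda>r. \<sigma>B r (e p))"
    "\<And>p r. p \<in> T \<Longrightarrow> \<sigma>B r (e p) = 0 \<Longrightarrow> r = 0" by metis
  have eH: "\<sigma>B r (e p) \<in> H p" if "p \<in> T" for r p using e(1)[OF that] by blast
  have refl: "weight M - p \<in> T" if "p \<in> T" for p using that H_reflect unfolding T_def by blast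
  have frame: "\<exists>bar lam. framed_motive M d (\<lambda>i. e (h i)) h bar lam" if h: "bij_betw h {..<d} T" for d h
  proof -
    \<comment> \<open>The position of the type conjugate to the one at position \<open>i\<close>; it
      exists because the set of nonzero types is symmetric.\<close>
    define bar where "bar = (\<lambda>i. inv_into {..<d} h (weight M - h i))"
    have hT: "h i \<in> T" if "i < d" for i using h that by (auto simp: bij_betw_def)
    have bar: "bar i < d" "h (bar i) = weight M - h i" if "i < d" for i
    proof -
      have *: "weight M - h i \<in> h ` {..<d}" using refl[OF hT[OF that]] h by (simp add: bij_betw_def)
      show "bar i < d" unfolding bar_def using inv_into_into[OF *] by simp
      show "h (bar i) = weight M - h i" unfolding bar_def using f_inv_into_f[OF *] .
    qed
    have barbar: "bar (bar i) = i" if "i < d" for i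
      using h bar[OF that] bar[of "bar i"] that by (auto simp: bij_betw_def inj_on_def)
    have "\<exists>r. cmap (rho M) (e (h i)) = \<sigma>B r (e (h (bar i)))" if i: "i < d" for i
    proof -
      have "e (h i) \<in> H (h i)" using eH[OF hT[OF i], of 1] by simp
      then have "cmap (rho M) (e (h i)) \<in> H (weight M - h i)" using \<rho>_H by blast
      then show ?thesis using e(1)[OF refl[OF hT[OF i]]] bar(2)[OF i] by auto
    qed
    then obtain lam where lam: "\<And>i. i < d \<Longrightarrow> cmap (rho M) (e (h i)) = \<sigma>B (lam i) (e (h (bar i)))" by metis
    have qb: "BC.qb d (\<lambda>i. e (h i))"
      unfolding BC.qb_def
    proof (intro conjI allI impI)
      fix x
      obtain g where g: "\<And>p. g p \<in> H p" "finite {p. g p \<noteq> 0}" "x = (\<Sum>p | g p \<noteq> 0. g p)"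
        using hodge_decomposition[of x] by blast
      have "\<exists>c. g (h i) = \<sigma>B c (e (h i))" if "i < d" for i
        using g(1)[of "h i"] e(1)[OF hT[OF that]] by auto
      then obtain c where c: "\<And>i. i < d \<Longrightarrow> g (h i) = \<sigma>B (c i) (e (h i))" by metis
      have "x = (\<Sum>p\<in>T. g p)"
        unfolding g(3) by (rule sum.mono_neutral_left[OF T]) (use g(1) in \<open>auto simp: T_def\<close>)
      also have "\<dots> = (\<Sum>i<d. g (h i))" by (rule sum.reindex_bij_betw[OF h, symmetric])
      also have "\<dots> = (\<Sum>i<d. \<sigma>B (c i) (e (h i)))" using c by simp
      finally show "\<exists>c. x - (\<Sum>i<d. \<sigma>B (c i) (e (h i))) \<in> {0}" by (intro exI[of _ c]) simp
    next
      fix c i assume c: "(\<Sum>i<d. \<sigma>B (c i) (e (h i))) \<in> {0}" and i: "i < d"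
      define c' where "c' = (\<lambda>p. c (inv_into {..<d} h p))"
      have c': "c' (h i) = c i" if "i < d" for i
        unfolding c'_def using h that by (simp add: bij_betw_def inv_into_f_f)
      have "(\<Sum>p\<in>T. \<sigma>B (c' p) (e p)) = (\<Sum>i<d. \<sigma>B (c' (h i)) (e (h i)))"
        by (rule sum.reindex_bij_betw[OF h, symmetric])
      also have "\<dots> = (\<Sum>p\<in>T. 0)" using c by (simp add: c')
      finally have "\<sigma>B (c' (h i)) (e (h i)) = 0"
        using H_unique[OF T, of "\<lambda>p. \<sigma>B (c' p) (e p)" "\<lambda>_. 0" "h i"] eH hT[OF i]
        by (simp add: I.m1.subspace_0[OF subspace_H])
      then show "c i = 0" using e(2)[OF hT[OF i]] c'[OF i] by simp
    qed
    have fil: "filtration_cx M p = I ` {\<Sum>i<d. \<sigma>B (c i) (e (h i)) | c. \<forall>i<d. h i < p \<longrightarrow> c i = 0}" for p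
    proof -
      have "filtration_cx M p = I ` I.m1.span (\<Union>p'\<in>{p..}. \<Union>q. hodge M p' q)"
        using pure by (simp add: pure_motive_def)
      also have "I.m1.span (\<Union>p'\<in>{p..}. \<Union>q. hodge M p' q) = I.m1.span ((\<lambda>i. e (h i)) ` {i. i < d \<and> p \<le> h i})"
        (is "_ = I.m1.span ?E")
      proof (rule antisym)
        have "hodge M p' q \<subseteq> I.m1.span ?E" if p': "p \<le> p'" for p' q
        proof (cases "p' + q = weight M \<and> p' \<in> T")
          case True
          then have q: "q = weight M - p'" by simp
          have H: "hodge M p' q = range (\<lambda>r. \<sigma>B r (e p'))"
            unfolding q by (rule e(1)) (use True in simp)
          obtain i where "i < d" "h i = p'" using h True by (auto simp: bij_betw_def)
          then have "e p' \<in> ?E" using p' by auto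
          then show ?thesis unfolding H by (auto intro: I.m1.span_scale I.m1.span_base)
        next
          case False
          have "hodge M p' q = {0}"
          proof (cases "p' + q = weight M")
            case True
            then have q: "q = weight M - p'" by simp
            have "p' \<notin> T" using False True by simp
            then show ?thesis unfolding q by (simp add: T_def)
          qed (use pure in \<open>simp add: pure_motive_def\<close>)
          then show ?thesis using I.m1.span_zero by simp
        qed
        then show "I.m1.span (\<Union>p'\<in>{p..}. \<Union>q. hodge M p' q) \<subseteq> I.m1.span ?E"
          by (intro I.m1.span_minimal) auto
        have "?E \<subseteq> (\<Union>p'\<in>{p..}. \<Union>q. hodge M p' q)"
        proof clarify
          fix i assume i: "i < d" "p \<le> h i"
          have "e (h i) \<in> H (h i)" using eH[OF hT[OF i(1)], of 1] by simp
          then show "e (h i) \<in> (\<Union>p'\<in>{p..}. \<Union>q. hodge M p' q)" using i(2) by blast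
        qed
        then show "I.m1.span ?E \<subseteq> I.m1.span (\<Union>p'\<in>{p..}. \<Union>q. hodge M p' q)" by (rule I.m1.span_mono)
      qed
      also have "I.m1.span ?E = {\<Sum>i<d. \<sigma>B (c i) (e (h i)) | c. \<forall>i<d. h i < p \<longrightarrow> c i = 0}"
        by (rule span_frame)
      finally show ?thesis .
    qed
    have "framed_motive M d (\<lambda>i. e (h i)) h bar lam"
      by unfold_locales (use qb fil bar barbar lam in auto)
    then show ?thesis by blast
  qed
  show thesis by (rule that[OF T _ e(1) frame]) (auto simp: T_def)
qed

end

section \<open>Middle type and criticality of a motive with distinct Hodge levels\<close>

context framed_motive
begin

text \<open>\<open>p\<close> is half the weight rounded up, so \<open>t i < p\<close> means
  \<open>2 * t i < weight M\<close>. The frame splits into \<open>below p\<close>, its mirror image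
  and the indices fixed by \<open>bar\<close>. Since the levels are distinct at most one index is
  fixed, and the parity of \<open>d\<close> decides whether there is one. In the odd case the steps
  \<open>t m\<close> and \<open>t m + 1\<close> differ by the middle index alone.\<close>

lemma middle:
  assumes inj: "inj_on t {..<d}"
  defines "p \<equiv> (weight M + 1) div 2"
  shows "even d \<Longrightarrow> 2 * card (below p) = d"
    and "even d \<Longrightarrow> {i. i < d \<and> bar i = i} = {}"
    and "odd d \<Longrightarrow> \<exists>m<d. {i. i < d \<and> bar i = i} = {m} \<and> 2 * t m = weight M \<and> 2 * card (below p) + 1 = d \<and>
      card (below (t m)) = card (below p) \<and> card (below (t m + 1)) = Suc (card (below p))"
proof -
  define E where "E = {i. i < d \<and> bar i = i}"
  have E: "i \<in> E \<longleftrightarrow> i < d \<and> 2 * t i = weight M" for i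
  proof
    assume "i \<in> E" then show "i < d \<and> 2 * t i = weight M" using bar(3)[of i] by (auto simp: E_def)
  next
    assume i: "i < d \<and> 2 * t i = weight M"
    then have "t (bar i) = t i" using bar(3)[of i] by simp
    then have "bar i = i" using inj i bar(1)[of i] by (auto simp: inj_on_def)
    then show "i \<in> E" using i by (simp add: E_def)
  qed
  have K: "below p = {i. i < d \<and> 2 * t i < weight M}" by (auto simp: below_def p_def)
  have b: "bar ` below p = {i. i < d \<and> weight M < 2 * t i}"
  proof (intro Set.set_eqI iffI)
    fix i assume "i \<in> bar ` below p"
    then show "i \<in> {i. i < d \<and> weight M < 2 * t i}" using bar by (auto simp: K)
  next
    fix i assume i: "i \<in> {i. i < d \<and> weight M < 2 * t i}"
    then have "bar i \<in> below p" using bar[of i] by (auto simp: K)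
    then show "i \<in> bar ` below p" using i bar(2)[of i] by (metis imageI mem_Collect_eq)
  qed
  have cb: "card (bar ` below p) = card (below p)"
    by (rule card_bar_image) (auto simp: below_def)
  have fE: "finite E" by (simp add: E_def)
  have "i < d \<longleftrightarrow> i \<in> below p \<union> bar ` below p \<union> E" for i
    unfolding b unfolding K E Un_iff mem_Collect_eq
    using linorder_less_linear[of "2 * t i" "weight M"] by blast
  then have "{..<d} = below p \<union> bar ` below p \<union> E" by blast
  then have "d = card (below p \<union> bar ` below p \<union> E)" by (metis card_lessThan)
  also have "\<dots> = card (below p \<union> bar ` below p) + card E"
    by (rule card_Un_disjoint) (use fE E finite_below in \<open>auto simp: b\<close>, auto simp: K)
  also have "card (below p \<union> bar ` below p) = 2 * card (below p)"
    by (subst card_Un_disjoint) (use finite_below cb in \<open>auto simp: b\<close>, auto simp: K)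
  finally have d: "d = 2 * card (below p) + card E" .
  have E1: "i = j" if "i \<in> E" "j \<in> E" for i j
    using that inj by (auto simp: E inj_on_def)
  then have cE: "card E \<le> 1" using fE by (simp add: card_le_Suc0_iff_eq)
  show "2 * card (below p) = d" if "even d"
    using d cE that by presburger
  show "{i. i < d \<and> bar i = i} = {}" if "even d"
  proof -
    have "card E = 0" using d cE that by presburger
    then show ?thesis using fE by (simp add: E_def)
  qed
  show "\<exists>m<d. {i. i < d \<and> bar i = i} = {m} \<and> 2 * t m = weight M \<and> 2 * card (below p) + 1 = d \<and>
      card (below (t m)) = card (below p) \<and> card (below (t m + 1)) = Suc (card (below p))" if "odd d"
  proof -
    have c1: "card E = 1" using d cE that by presburger
    then obtain m where m: "E = {m}" by (auto simp: card_1_singleton_iff)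
    then have m2: "m < d" "2 * t m = weight M" using E[of m] by auto
    have t1: "below (t m) = below p" unfolding below_def p_def using m2 by auto
    have t2: "below (t m + 1) = insert m (below p)"
    proof (intro Set.set_eqI iffI)
      fix i assume i: "i \<in> below (t m + 1)"
      show "i \<in> insert m (below p)"
      proof (cases "t i = t m")
        case True
        then show ?thesis using inj i m2 by (auto simp: below_def inj_on_def)
      qed (use i m2 in \<open>auto simp: below_def p_def\<close>)
    qed (use m2 in \<open>auto simp: below_def p_def\<close>)
    have "m \<notin> below p" using m2 by (simp add: K)
    then show ?thesis using t1 t2 d c1 m m2 finite_below[of p] by (intro exI[of _ m]) (auto simp: E_def)
  qed
qed

text \<open>No index is fixed by \<open>bar\<close>, so conjugation has trace 0 and its eigenspaces
  have equal rank. One and the same step is then critical for both signs.\<close>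

lemma critical_even:
  assumes "inj_on t {..<d}" "even d"
  defines "p \<equiv> (weight M + 1) div 2"
  shows "2 * card (below p) = d" "critical_step M 1 p" "critical_step M (- 1) p"
proof -
  note m = middle(1,2)[OF assms(1,2), folded p_def]
  show "2 * card (below p) = d" by (rule m(1))
  have "of_int (int (eigen_rank M 1) - int (eigen_rank M (- 1))) = (of_int 0 :: 'e cx)"
    using eigen_ranks(3) by (simp add: m(2))
  then have "eigen_rank M 1 = eigen_rank M (- 1)" by (simp only: of_int_eq_iff)
  then show "critical_step M 1 p" "critical_step M (- 1) p"
    using m(1) eigen_ranks(1) by (simp_all add: critical_step_iff)
qed

text \<open>Only the middle vector contributes to the trace, so its eigenvalue is an integer, and
  its square is 1 because conjugation is an involution. The eigenspaces have ranks \<open>k\<close>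
  and \<open>k + 1\<close> with \<open>k = card (below p)\<close>, in an order that depends on the
  sign; the two steps next to the middle level realize both numbers.\<close>

lemma critical_odd:
  assumes "inj_on t {..<d}" "odd d"
  shows "critical M" and "\<exists>m<d. \<exists>\<epsilon>\<in>{1, - 1}. {i. i < d \<and> bar i = i} = {m} \<and> 2 * t m = weight M \<and> lam m = of_int \<epsilon>"
proof -
  define p where "p = (weight M + 1) div 2"
  obtain m where m: "m < d" "{i. i < d \<and> bar i = i} = {m}" "2 * t m = weight M" "2 * card (below p) + 1 = d"
      "card (below (t m)) = card (below p)" "card (below (t m + 1)) = Suc (card (below p))"
    using middle(3)[OF assms, folded p_def] by blast
  define \<epsilon> where "\<epsilon> = int (eigen_rank M 1) - int (eigen_rank M (- 1))"
  have lam: "lam m = of_int \<epsilon>" using eigen_ranks(3) by (simp add: m(2) \<epsilon>_def)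
  have bm: "bar m = m" using m(2) by blast
  have "f m = cmap (rho M) (cmap (rho M) (f m))" by (simp add: \<rho>\<rho>C)
  also have "\<dots> = \<sigma>B (lam m * lam m) (f m)" using m(1) by (simp add: \<rho>_f bm \<rho>C.scale)
  finally have "BC.qc d f (f m) m = lam m * lam m * BC.qc d f (f m) m"
    by (metis BC.qc_scale[OF f_qb m(1)])
  then have "(of_int (\<epsilon> * \<epsilon>) :: 'e cx) = of_int 1"
    using lam by (simp add: BC.qc_base[OF f_qb m(1) m(1)])
  then have "\<epsilon> * \<epsilon> = 1" by (simp only: of_int_eq_iff)
  then have \<epsilon>: "\<epsilon> = 1 \<or> \<epsilon> = - 1" using zmult_eq_1_iff by blast
  then show "\<exists>m<d. \<exists>\<epsilon>\<in>{1, - 1}. {i. i < d \<and> bar i = i} = {m} \<and> 2 * t m = weight M \<and> lam m = of_int \<epsilon>"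
    using m lam by (intro exI[of _ m]) auto
  have "(eigen_rank M 1 = card (below p) \<or> eigen_rank M 1 = Suc (card (below p))) \<and>
    (eigen_rank M (- 1) = card (below p) \<or> eigen_rank M (- 1) = Suc (card (below p)))"
    using \<epsilon>
  proof
    assume "\<epsilon> = 1"
    then have "eigen_rank M 1 = Suc (card (below p))" "eigen_rank M (- 1) = card (below p)"
      using m(4) eigen_ranks(1) by (simp_all add: \<epsilon>_def)
    then show ?thesis by simp
  next
    assume "\<epsilon> = - 1"
    then have "eigen_rank M 1 = card (below p)" "eigen_rank M (- 1) = Suc (card (below p))"
      using m(4) eigen_ranks(1) by (simp_all add: \<epsilon>_def)
    then show ?thesis by simp
  qed
  then show "critical M" unfolding critical_def critical_step_iff using m(5,6) by (metis insertE empty_iff)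
qed

lemma middle_sign_eq:
  assumes "m < d" "bar m = m" "2 * t m = weight M" "lam m = of_int \<epsilon>" "\<epsilon> \<in> {1, - 1}"
    and gen: "hodge M (t m) (t m) = range (\<lambda>r. \<sigma>B r (f m))" and ne: "hodge M (t m) (t m) \<noteq> {0}"
  shows "\<exists>!\<epsilon>. is_middle_sign M \<epsilon>" "middle_sign M = \<epsilon>"
proof -
  have ex: "is_middle_sign M \<epsilon>"
    unfolding is_middle_sign_def gen[symmetric]
  proof (intro conjI exI[of _ "t m"] ballI)
    fix x assume "x \<in> hodge M (t m) (t m)"
    then obtain r where "x = \<sigma>B r (f m)" using gen by auto
    then show "cmap (rho M) x = \<sigma>B (of_int \<epsilon>) x"
      using assms by (simp add: \<rho>C.scale \<rho>_f mult.commute)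
  qed (use assms in auto)
  have un: "\<epsilon>' = \<epsilon>" if \<epsilon>': "is_middle_sign M \<epsilon>'" for \<epsilon>'
  proof -
    obtain p where p: "2 * p = weight M" "\<forall>x\<in>hodge M p p. cmap (rho M) x = \<sigma>B (of_int \<epsilon>') x"
      using \<epsilon>' by (auto simp: is_middle_sign_def)
    have "p = t m" using p(1) assms(3) by simp
    moreover have "f m \<in> hodge M (t m) (t m)" using gen rangeI[of "\<lambda>r. \<sigma>B r (f m)" 1] by simp
    ultimately have "\<sigma>B (of_int \<epsilon>') (f m) = \<sigma>B (of_int \<epsilon>) (f m)"
      using bspec[OF p(2), of "f m"] assms(1,2,4) by (simp add: \<rho>_f)
    then have "of_int \<epsilon>' * BC.qc d f (f m) m = of_int \<epsilon> * BC.qc d f (f m) m"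
      by (metis BC.qc_scale[OF f_qb assms(1)])
    then show ?thesis by (simp add: BC.qc_base[OF f_qb assms(1) assms(1)])
  qed
  show "\<exists>!\<epsilon>. is_middle_sign M \<epsilon>" using ex un by blast
  show "middle_sign M = \<epsilon>" unfolding middle_sign_def using ex un by (rule the_equality)
qed

end

section \<open>Tensor products\<close>

text \<open>Pairs \<open>(i, j)\<close> with \<open>i < m\<close> and \<open>j < n\<close> are encoded as \<open>j * m + i < n * m\<close>.\<close>

lemma sum_pairs: "(\<Sum>r<n * m. g (r mod m) (r div m)) = (\<Sum>j<n. \<Sum>i<m. g i j)"
  for m n :: nat and g :: "nat \<Rightarrow> nat \<Rightarrow> 'a::comm_monoid_add"
proof (induction n)
  case (Suc n)
  have "(\<Sum>r<Suc n * m. g (r mod m) (r div m)) = (\<Sum>r<n * m + m. g (r mod m) (r div m))"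
    by (simp add: add.commute)
  also have "\<dots> = (\<Sum>r<n * m. g (r mod m) (r div m)) + (\<Sum>i<m. g ((n * m + i) mod m) ((n * m + i) div m))"
    by (rule sum_lessThan_add)
  also have "(\<Sum>i<m. g ((n * m + i) mod m) ((n * m + i) div m)) = (\<Sum>i<m. g i n)"
    by (intro sum.cong) auto
  finally show ?case by (simp add: Suc)
qed simp

lemma pair_code: "i < m \<Longrightarrow> j < n \<Longrightarrow> j * m + i < n * m"
  "i < m \<Longrightarrow> (j * m + i) mod m = i" "i < m \<Longrightarrow> (j * m + i) div m = j" for i j m n :: nat
proof -
  assume "i < m" "j < n"
  then have "j * m + i < Suc j * m" by simp
  also have "\<dots> \<le> n * m" using \<open>j < n\<close> by (intro mult_right_mono) auto
  finally show "j * m + i < n * m" .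
qed auto

lemma pair_bounds: "r < n * m \<Longrightarrow> r mod m < m" "r < n * m \<Longrightarrow> r div m < n" for r m n :: nat
  by (metis mod_less_divisor mult_0_right not_gr_zero not_less_zero) (simp add: less_mult_imp_div_less)

lemma tlift_diff: "biadditive g \<Longrightarrow> tlift g (x - y) = tlift g x - tlift g y"
  by (metis add_diff_cancel diff_add_cancel tlift_add)

text \<open>For independence, the product \<open>\<beta>\<close> of two coordinate forms is
  balanced, so its extension vanishes on \<open>balanced_rel s t\<close>, which is the kernel of
  \<open>tlift \<tau>\<close>. Evaluated on a formal preimage of the relation, it isolates a single
  coefficient.\<close>

lemma tensor_product_qb:
  assumes s: "vector_space s" and t: "vector_space t" and u: "vector_space u"
    and tp: "is_tensor_product s t u \<tau>"
    and b: "quotient_module.qb s {0} m b" and b': "quotient_module.qb t {0} n b'"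
  shows "quotient_module.qb u {0} (n * m) (\<lambda>r. \<tau> (b (r mod m)) (b' (r div m)))"
proof -
  interpret S: vector_space s by fact
  interpret T: vector_space t by fact
  interpret U: vector_space u by fact
  interpret S: quotient_module s "{0}" by unfold_locales simp
  interpret T: quotient_module t "{0}" by unfold_locales simp
  interpret U: quotient_module u "{0}" by unfold_locales simp
  have \<tau>: "biadditive \<tau>" and hom: "\<tau> (s e v) w = u e (\<tau> v w)" "\<tau> v (t e w) = u e (\<tau> v w)"
    and surj: "surj (tlift \<tau>)" and ker: "{x. tlift \<tau> x = 0} = balanced_rel s t" for e v w
    using tp by (auto simp: is_tensor_product_def)
  have \<tau>sum: "\<tau> (sum g A) y = (\<Sum>a\<in>A. \<tau> (g a) y)" "\<tau> x (sum h A) = (\<Sum>a\<in>A. \<tau> x (h a))"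
    for g h x y and A :: "nat set"
    using \<tau> by (induction A rule: infinite_finite_induct) (simp_all add: biadditive_zero biadditive_def)
  have "\<exists>c. x - (\<Sum>r<n * m. u (c r) (\<tau> (b (r mod m)) (b' (r div m)))) \<in> {0}" for x
  proof -
    obtain y where "x = tlift \<tau> y" using surj by (metis surjD)
    moreover have "\<exists>c. tlift \<tau> y = (\<Sum>r<n * m. u (c r) (\<tau> (b (r mod m)) (b' (r div m))))"
    proof (induction y)
      case zero
      show ?case by (rule exI[of _ "\<lambda>_. 0"]) (simp add: tlift_zero[OF \<tau>])
    next
      case (add v w y)
      then obtain c where c: "tlift \<tau> y = (\<Sum>r<n * m. u (c r) (\<tau> (b (r mod m)) (b' (r div m))))" by blast
      define p q where "p = S.qc m b v" and "q = T.qc n b' w"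
      have v: "v = (\<Sum>i<m. s (p i) (b i))" using S.qc_spec[OF b, of v] by (simp add: p_def)
      have w: "w = (\<Sum>j<n. t (q j) (b' j))" using T.qc_spec[OF b', of w] by (simp add: q_def)
      have "\<tau> v w = (\<Sum>j<n. \<Sum>i<m. u (q j * p i) (\<tau> (b i) (b' j)))"
        unfolding v w by (simp add: \<tau>sum hom U.scale_sum_right)
      also have "\<dots> = (\<Sum>r<n * m. u (q (r div m) * p (r mod m)) (\<tau> (b (r mod m)) (b' (r div m))))"
        by (rule sum_pairs[symmetric])
      finally have "tlift \<tau> (v \<otimes>\<^sub>\<rat> w + y) =
          (\<Sum>r<n * m. u (q (r div m) * p (r mod m) + c r) (\<tau> (b (r mod m)) (b' (r div m))))"
        by (simp add: tlift_add[OF \<tau>] tlift_tens[OF \<tau>] c U.scale_left_distrib sum.distrib)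
      then show ?case by (rule exI[of _ "\<lambda>r. q (r div m) * p (r mod m) + c r"])
    qed
    ultimately show ?thesis by auto
  qed
  moreover have "\<forall>r<n * m. c r = 0" if c: "(\<Sum>r<n * m. u (c r) (\<tau> (b (r mod m)) (b' (r div m)))) \<in> {0}" for c
  proof (intro allI impI)
    fix r assume r: "r < n * m"
    define i j where "i = r mod m" and "j = r div m"
    have i: "i < m" and j: "j < n" using pair_bounds[OF r] by (auto simp: i_def j_def)
    define \<beta> where "\<beta> = (\<lambda>v w. S.qc m b v i * T.qc n b' w j)"
    have \<beta>: "biadditive \<beta>"
      by (simp add: biadditive_def \<beta>_def S.qc_add[OF b i] T.qc_add[OF b' j] algebra_simps)
    have bal: "\<beta> (s e v) w = \<beta> v (t e w)" for e v w
      by (simp add: \<beta>_def S.qc_scale[OF b i] T.qc_scale[OF b' j])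
    have val: "\<beta> (s e (b i')) (b' j') = e * (of_bool (i = i') * of_bool (j = j'))" if "i' < m" "j' < n" for e i' j'
      using that by (simp add: \<beta>_def S.qc_scale[OF b i] S.qc_base[OF b i] T.qc_base[OF b' j])
    have van: "tlift \<beta> x = 0" if "x \<in> balanced_rel s t" for x
      using that
      by (induction rule: balanced_rel.induct)
        (simp_all add: tlift_zero[OF \<beta>] tlift_diff[OF \<beta>] tlift_tens[OF \<beta>] bal)
    have tsum: "tlift g (sum h A) = (\<Sum>a\<in>A. tlift g (h a))" if g: "biadditive g"
      for g :: "'b \<Rightarrow> 'c \<Rightarrow> 'x::ab_group_add" and h :: "nat \<Rightarrow> _" and A
      by (induction A rule: infinite_finite_induct) (simp_all add: tlift_zero[OF g] tlift_add[OF g])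
    define x where "x = (\<Sum>r<n * m. s (c r) (b (r mod m)) \<otimes>\<^sub>\<rat> b' (r div m))"
    have "tlift \<tau> x = 0" unfolding x_def using c by (simp add: tsum[OF \<tau>] tlift_tens[OF \<tau>] hom)
    then have "tlift \<beta> x = 0" using van ker by blast
    also have "tlift \<beta> x = (\<Sum>r'<n * m. c r' * (of_bool (i = r' mod m) * of_bool (j = r' div m)))"
      unfolding x_def tsum[OF \<beta>] tlift_tens[OF \<beta>]
      by (intro sum.cong HOL.refl val) (simp_all add: pair_bounds)
    also have "\<dots> = (\<Sum>r'<n * m. if r' = r then c r' else 0)"
    proof (intro sum.cong)
      fix r'
      have "i = r' mod m \<and> j = r' div m \<longleftrightarrow> r' = r"
        unfolding i_def j_def by (metis div_mult_mod_eq)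
      then show "c r' * (of_bool (i = r' mod m) * of_bool (j = r' div m)) = (if r' = r then c r' else 0)"
        by auto
    qed simp
    also have "\<dots> = c r" using r by simp
    finally show "c r = 0" by simp
  qed
  ultimately show ?thesis by (simp add: U.qb_def)
qed

text \<open>Asked of the two factors only: a product frame violates the second clause as soon as two
  of its vectors have the same Hodge type.\<close>

definition hodge_generated ::
  "('e::field_char_0, 'b::ab_group_add, 'd::ab_group_add) motive \<Rightarrow> nat \<Rightarrow> (nat \<Rightarrow> 'b cx) \<Rightarrow> (nat \<Rightarrow> int) \<Rightarrow> bool"
  where "hodge_generated M d f t \<longleftrightarrow>
    (\<forall>i<d. f i \<in> hodge M (t i) (weight M - t i)) \<and>
    (\<forall>a b. \<forall>x\<in>hodge M a b. x \<noteq> 0 \<longrightarrow> (\<exists>i<d. \<exists>r. t i = a \<and> x = cext (scaleB M) r (f i)))"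

locale tensor_frame =
  M: framed_motive M d f t bar lam + M': framed_motive M' d' f' t' bar' lam' + N: pure N
  for M :: "('e::field_char_0, 'b::ab_group_add, 'd::ab_group_add) motive" and d f t bar lam
    and M' :: "('e, 'b'::ab_group_add, 'd'::ab_group_add) motive" and d' f' t' bar' lam'
    and N :: "('e, 'b''::ab_group_add, 'd''::ab_group_add) motive" +
  fixes \<tau>\<^sub>B :: "'b \<Rightarrow> 'b' \<Rightarrow> 'b''"
  assumes weight_N: "weight N = weight M + weight M'"
    and tensor_B: "is_tensor_product (scaleB M) (scaleB M') (scaleB N) \<tau>\<^sub>B"
    and rho_N: "rho N (\<tau>\<^sub>B v w) = \<tau>\<^sub>B (rho M v) (rho M' w)"
    and hodge_N: "hodge N p q = Modules.module.span (cext (scaleB N))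
        {cext \<tau>\<^sub>B x y | x y a b. x \<in> hodge M a b \<and> y \<in> hodge M' (p - a) (q - b)}"
    and gen: "hodge_generated M d f t" and gen': "hodge_generated M' d' f' t'"
begin

lemma \<tau>: "biadditive \<tau>\<^sub>B"
  "\<tau>\<^sub>B (scaleB M e v) w = scaleB N e (\<tau>\<^sub>B v w)" "\<tau>\<^sub>B v (scaleB M' e w) = scaleB N e (\<tau>\<^sub>B v w)"
  using tensor_B by (auto simp: is_tensor_product_def)

lemma \<tau>C:
  "cext \<tau>\<^sub>B (M.\<sigma>B r x) y = N.\<sigma>B r (cext \<tau>\<^sub>B x y)"
  "cext \<tau>\<^sub>B x (M'.\<sigma>B r y) = N.\<sigma>B r (cext \<tau>\<^sub>B x y)"
  by (rule cext_bilinear(1)[where s = "scaleB M" and t = "scaleB M'" and u = "scaleB N" and \<tau> = \<tau>\<^sub>B]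
      cext_bilinear(2)[where s = "scaleB M" and t = "scaleB M'" and u = "scaleB N" and \<tau> = \<tau>\<^sub>B],
      (fact M.B.vector_space_axioms M'.B.vector_space_axioms N.B.vector_space_axioms \<tau>)+)+

definition F :: "nat \<Rightarrow> 'b'' cx"
  where "F r = cext \<tau>\<^sub>B (f (r mod d)) (f' (r div d))"

text \<open>The coordinates of a product are products of coordinates; this gives the period matrices
  of the tensor product their Kronecker-like form.\<close>

lemma \<tau>C_expand:
  "cext \<tau>\<^sub>B x y = (\<Sum>r<d' * d. N.\<sigma>B (M.BC.qc d f x (r mod d) * M'.BC.qc d' f' y (r div d)) (F r))"
proof -
  have "cext \<tau>\<^sub>B x y = cext \<tau>\<^sub>B (\<Sum>i<d. M.\<sigma>B (M.BC.qc d f x i) (f i)) (\<Sum>j<d'. M'.\<sigma>B (M'.BC.qc d' f' y j) (f' j))"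
    using M.f_expand[of x] M'.f_expand[of y] by simp
  also have "\<dots> = (\<Sum>j<d'. \<Sum>i<d. N.\<sigma>B (M.BC.qc d f x i * M'.BC.qc d' f' y j) (cext \<tau>\<^sub>B (f i) (f' j)))"
    by (simp add: cext_sum[OF \<tau>(1)] \<tau>C N.I.m1.scale_sum_right mult.commute)
  also have "\<dots> = (\<Sum>r<d' * d. N.\<sigma>B (M.BC.qc d f x (r mod d) * M'.BC.qc d' f' y (r div d)) (F r))"
    unfolding F_def by (rule sum_pairs[symmetric])
  finally show ?thesis .
qed

text \<open>\<open>tensor_product_qb\<close> works over the coefficient field, but Hodge vectors are
  not rational. So the products of two rational bases supply one basis after extension of scalars,
  and the products of Hodge vectors, which generate it and have the same number, form a basis by
  \<open>qb_spanI\<close>.\<close>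

lemma F_qb: "N.BC.qb (d' * d) F"
proof -
  obtain bs where bs: "ordered_basis (scaleB M) UNIV bs" "M.BC.qb (length bs) (\<lambda>j. (bs ! j) \<otimes>\<^sub>\<rat> 1)"
    using M.ex_betti_basis .
  obtain bs' where bs': "ordered_basis (scaleB M') UNIV bs'" "M'.BC.qb (length bs') (\<lambda>j. (bs' ! j) \<otimes>\<^sub>\<rat> 1)"
    using M'.ex_betti_basis .
  have l: "length bs = d" by (rule M.BC.qb_card[OF bs(2) M.f_qb])
  have l': "length bs' = d'" by (rule M'.BC.qb_card[OF bs'(2) M'.f_qb])
  have "quotient_module.qb (scaleB N) {0} (d' * d) (\<lambda>r. \<tau>\<^sub>B (bs ! (r mod d)) (bs' ! (r div d)))"
    using tensor_product_qb[OF M.B.vector_space_axioms M'.B.vector_space_axioms N.B.vector_space_axioms tensor_B]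
      bs(1) bs'(1) unfolding M.B.ordered_basis_UNIV_qb M'.B.ordered_basis_UNIV_qb l l' by blast
  from qb_cext_zero[OF N.B.vector_space_axioms this]
  have "N.BC.qb (d' * d) (\<lambda>r. cext \<tau>\<^sub>B ((bs ! (r mod d)) \<otimes>\<^sub>\<rat> 1) ((bs' ! (r div d)) \<otimes>\<^sub>\<rat> 1))"
    by (simp add: cext_tens[OF \<tau>(1)])
  then show ?thesis
  proof (rule N.BC.qb_spanI)
    fix r
    show "\<exists>c. cext \<tau>\<^sub>B ((bs ! (r mod d)) \<otimes>\<^sub>\<rat> 1) ((bs' ! (r div d)) \<otimes>\<^sub>\<rat> 1) - (\<Sum>r<d' * d. N.\<sigma>B (c r) (F r)) \<in> {0}"
      using \<tau>C_expand[of "(bs ! (r mod d)) \<otimes>\<^sub>\<rat> 1" "(bs' ! (r div d)) \<otimes>\<^sub>\<rat> 1"]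
      by (intro exI[of _ "\<lambda>q. M.BC.qc d f ((bs ! (r mod d)) \<otimes>\<^sub>\<rat> 1) (q mod d) * M'.BC.qc d' f' ((bs' ! (r div d)) \<otimes>\<^sub>\<rat> 1) (q div d)"]) simp
  qed
qed

lemma F_qc:
  assumes "r < d' * d"
  shows "N.BC.qc (d' * d) F (cext \<tau>\<^sub>B x y) r = M.BC.qc d f x (r mod d) * M'.BC.qc d' f' y (r div d)"
  by (rule N.BC.qc_eq[OF F_qb _ assms]) (simp add: \<tau>C_expand[of x y])

lemma \<rho>_\<tau>: "cmap (rho N) (cext \<tau>\<^sub>B x y) = cext \<tau>\<^sub>B (cmap (rho M) x) (cmap (rho M') y)"
proof -
  note simps = cext_zero[OF \<tau>(1)] cext_add[OF \<tau>(1)] M.\<rho>C.zero M.\<rho>C.add M'.\<rho>C.zero M'.\<rho>C.add N.\<rho>C.zero N.\<rho>C.add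
  have *: "cmap (rho N) (cext \<tau>\<^sub>B (v \<otimes>\<^sub>\<rat> z) y) = cext \<tau>\<^sub>B (cmap (rho M) (v \<otimes>\<^sub>\<rat> z)) (cmap (rho M') y)" for v z
    by (induction y) (simp_all add: simps cext_tens[OF \<tau>(1)] cmap_tens[OF M.\<rho>_linear]
        cmap_tens[OF M'.\<rho>_linear] cmap_tens[OF N.\<rho>_linear] rho_N)
  show ?thesis by (induction x) (simp_all add: simps *)
qed

definition T :: "nat \<Rightarrow> int"
  where "T r = t (r mod d) + t' (r div d)"

text \<open>Through the comparison isomorphism of \<open>N\<close> this describes its filtration in
  the product frame, as a framed motive requires. Both inclusions are checked on generators, which
  are products of Hodge vectors.\<close>

lemma span_hodge_N:
  "N.I.m1.span (\<Union>p'\<in>{p..}. \<Union>q. hodge N p' q) = N.I.m1.span (F ` {r. r < d' * d \<and> p \<le> T r})"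
  (is "_ = N.I.m1.span ?E")
proof (rule antisym)
  have "hodge N p' q \<subseteq> N.I.m1.span ?E" if p': "p \<le> p'" for p' q
    unfolding hodge_N
  proof (rule N.I.m1.span_minimal[OF _ N.I.m1.subspace_span], clarify)
    fix x y a b assume x: "x \<in> hodge M a b" and y: "y \<in> hodge M' (p' - a) (q - b)"
    show "cext \<tau>\<^sub>B x y \<in> N.I.m1.span ?E"
    proof (cases "x = 0 \<or> y = 0")
      case True
      then show ?thesis by (auto simp: cext_zero[OF \<tau>(1)] N.I.m1.span_zero)
    next
      case False
      then obtain i c j c' where i: "i < d" "t i = a" "x = M.\<sigma>B c (f i)"
        and j: "j < d'" "t' j = p' - a" "y = M'.\<sigma>B c' (f' j)"
        using gen gen' x y unfolding hodge_generated_def by blast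
      have "cext \<tau>\<^sub>B x y = N.\<sigma>B (c * c') (F (j * d + i))"
        using i(1) by (simp add: i(3) j(3) \<tau>C F_def pair_code mult.commute)
      moreover have "F (j * d + i) \<in> ?E"
        by (rule imageI) (use i j p' in \<open>simp add: T_def pair_code\<close>)
      ultimately show ?thesis by (simp add: N.I.m1.span_scale N.I.m1.span_base)
    qed
  qed
  then show "N.I.m1.span (\<Union>p'\<in>{p..}. \<Union>q. hodge N p' q) \<subseteq> N.I.m1.span ?E"
    by (intro N.I.m1.span_minimal) auto
  have "?E \<subseteq> (\<Union>p'\<in>{p..}. \<Union>q. hodge N p' q)"
  proof clarify
    fix r assume r: "r < d' * d" "p \<le> T r"
    define i j where "i = r mod d" and "j = r div d"
    have i: "i < d" and j: "j < d'" using pair_bounds[OF r(1)] by (auto simp: i_def j_def)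
    have "f i \<in> hodge M (t i) (weight M - t i)" using gen i by (simp add: hodge_generated_def)
    moreover have "f' j \<in> hodge M' (t' j) (weight M' - t' j)" using gen' j by (simp add: hodge_generated_def)
    then have "f' j \<in> hodge M' (T r - t i) ((weight N - T r) - (weight M - t i))"
      by (simp add: T_def weight_N i_def[symmetric] j_def[symmetric])
    ultimately have "F r \<in> hodge N (T r) (weight N - T r)"
      unfolding hodge_N F_def i_def[symmetric] j_def[symmetric] by (intro N.I.m1.span_base) blast
    then show "F r \<in> (\<Union>p'\<in>{p..}. \<Union>q. hodge N p' q)" using r(2) by blast
  qed
  then show "N.I.m1.span ?E \<subseteq> N.I.m1.span (\<Union>p'\<in>{p..}. \<Union>q. hodge N p' q)" by (rule N.I.m1.span_mono)
qed

sublocale N: framed_motive N "d' * d" F T "\<lambda>r. bar' (r div d) * d + bar (r mod d)"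
  "\<lambda>r. lam (r mod d) * lam' (r div d)"
proof unfold_locales
  show "N.BC.qb (d' * d) F" by (rule F_qb)
  have "filtration_cx N p = N.I ` N.I.m1.span (\<Union>p'\<in>{p..}. \<Union>q. hodge N p' q)" for p
    using N.pure by (simp add: pure_motive_def)
  then show "filtration_cx N p = N.I ` {\<Sum>i<d' * d. N.\<sigma>B (c i) (F i) | c. \<forall>i<d' * d. T i < p \<longrightarrow> c i = 0}" for p
    unfolding span_hodge_N N.span_frame .
  fix r assume r: "r < d' * d"
  have i: "r mod d < d" and j: "r div d < d'" using pair_bounds[OF r] by auto
  note b = M.bar[OF i] and b' = M'.bar[OF j]
  show "bar' (r div d) * d + bar (r mod d) < d' * d" using b b' by (simp add: pair_code)
  show "bar' ((bar' (r div d) * d + bar (r mod d)) div d) * d + bar ((bar' (r div d) * d + bar (r mod d)) mod d) = r"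
    using b b' by (simp add: pair_code)
  show "T (bar' (r div d) * d + bar (r mod d)) = weight N - T r"
    using b b' by (simp add: pair_code T_def weight_N)
  show "cmap (rho N) (F r) = N.\<sigma>B (lam (r mod d) * lam' (r div d)) (F (bar' (r div d) * d + bar (r mod d)))"
    using b b' by (simp add: F_def \<rho>_\<tau> M.\<rho>_f[OF i] M'.\<rho>_f[OF j] \<tau>C pair_code mult.commute)
qed

end

section \<open>The determinant relation\<close>

lemma det_diag: "det (mat k k (\<lambda>(i, j). if i = j then x i else 0)) = (\<Prod>i<k. x i)"
  for x :: "nat \<Rightarrow> 'r::comm_ring_1"
  by (subst det_upper_triangular[of _ k])
    (auto simp: prod_list_diag_prod atLeast0LessThan)

lemma det_one_block:
  fixes \<Psi> :: "'r::comm_ring_1 mat"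
  assumes \<Psi>: "\<Psi> \<in> carrier_mat n n"
  shows "det (mat (q + n) (q + n) (\<lambda>(i, j). if q \<le> i \<and> q \<le> j then \<Psi> $$ (i - q, j - q) else of_bool (i = j))) = det \<Psi>"
proof (induction q)
  case 0
  have "mat (0 + n) (0 + n) (\<lambda>(i, j). if 0 \<le> i \<and> 0 \<le> j then \<Psi> $$ (i - 0, j - 0) else of_bool (i = j)) = \<Psi>"
    by (rule eq_matI) (use \<Psi> in auto)
  then show ?case by simp
next
  case (Suc q)
  let ?E = "\<lambda>q. mat (q + n) (q + n) (\<lambda>(i, j). if q \<le> i \<and> q \<le> j then \<Psi> $$ (i - q, j - q) else of_bool (i = j))"
  have "?E (Suc q) = four_block_mat (1\<^sub>m 1) (0\<^sub>m 1 (q + n)) (0\<^sub>m (q + n) 1) (?E q)"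
    by (rule eq_matI) auto
  then have "det (?E (Suc q)) = det (1\<^sub>m 1 :: 'r mat) * det (?E q)"
    by (simp only: det_four_block_mat_lower_left_zero_col[OF one_carrier_mat zero_carrier_mat HOL.refl mat_carrier])
  then show ?case using Suc by simp
qed

lemma prod_signs: "(\<And>i. i < k \<Longrightarrow> x i \<in> {1, - 1}) \<Longrightarrow> (\<Prod>i<k. x i) \<in> {1, - 1}"
  for x :: "nat \<Rightarrow> 'r::comm_ring_1" and k :: nat
proof (induction k)
  case (Suc k)
  have "(\<Prod>i<k. x i) \<in> {1, - 1}" "x k \<in> {1, - 1}" using Suc by auto
  then show ?case by auto
qed simp

lemma double_eq_zero:
  fixes x :: "'r::comm_ring_1"
  assumes "(2::'r) dvd 1" "x + x = 0"
  shows "x = 0"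
proof -
  obtain c :: 'r where c: "1 = 2 * c" using assms(1) by (elim dvdE)
  have "x = 1 * x" by simp
  also have "\<dots> = c * (x + x)" unfolding c by (simp add: algebra_simps)
  finally show ?thesis using assms(2) by simp
qed

text \<open>
  \<open>a \<sigma> p i\<close> is the coordinate \<open>p\<close> of the \<open>i\<close>-th basis vector of the eigenspace of sign \<open>\<sigma>\<close> of the
  first factor; \<open>G\<close> is the transition matrix from a basis of eigenvectors (of signs \<open>s\<close>) of the
  second factor to the Hodge basis, whose last vector is the middle one. After the change of basis
  by \<open>Gi\<close>, which is the same for both signs, the two period matrices differ by the signs \<open>J\<close> and
  by the block \<open>\<Psi>\<close>.
\<close>

lemma det_period_relation:
  fixes a :: "int \<Rightarrow> nat \<Rightarrow> nat \<Rightarrow> 'r::comm_ring_1" and G Gi :: "nat \<Rightarrow> nat \<Rightarrow> 'r"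
    and s :: "nat \<Rightarrow> int" and J :: "nat \<Rightarrow> 'r" and row\<^sub>1 row\<^sub>2 :: "nat \<Rightarrow> nat" and m n :: nat
  defines "P \<equiv> \<lambda>\<sigma>. mat (Suc m * n) (Suc m * n)
      (\<lambda>(l, r). a (\<sigma> * s (r div n)) (row\<^sub>1 l) (r mod n) * G (row\<^sub>2 l) (r div n))"
  assumes two: "(2::'r) dvd 1"
    and GGi: "\<And>h g. h \<le> m \<Longrightarrow> g \<le> m \<Longrightarrow> (\<Sum>k\<le>m. G h k * Gi k g) = of_bool (h = g)"
    and GiG: "\<And>k j. k \<le> m \<Longrightarrow> j \<le> m \<Longrightarrow> (\<Sum>h\<le>m. Gi k h * G h j) = of_bool (k = j)"
    and s: "\<And>k. k \<le> m \<Longrightarrow> s k \<in> {1, - 1}"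
    and J: "\<And>g. g \<le> m \<Longrightarrow> J g \<in> {1, - 1}" "J m = 1"
    and \<epsilon>: "\<epsilon> \<in> {1, - 1}"
    and mid: "\<And>h. h \<le> m \<Longrightarrow> (\<Sum>k\<le>m. of_int (s k) * (G h k * Gi k m)) = (if h = m then of_int \<epsilon> else 0)"
    and off: "\<And>h g. h \<le> m \<Longrightarrow> g < m \<Longrightarrow> (\<Sum>k\<le>m. of_int (s k) * (G h k * Gi k g)) \<noteq> 0 \<Longrightarrow> h \<noteq> g \<and> J h = - J g"
    and row\<^sub>2: "\<And>l. l < Suc m * n \<Longrightarrow> row\<^sub>2 l \<le> m"
    and \<Psi>: "\<Psi> \<in> carrier_mat n n"
      "\<And>l i. l < Suc m * n \<Longrightarrow> row\<^sub>2 l = m \<Longrightarrow> i < n \<Longrightarrow>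
        (\<Sum>l'<n. a (- \<epsilon>) (row\<^sub>1 l) l' * \<Psi> $$ (l', i)) = a \<epsilon> (row\<^sub>1 l) i"
  shows "\<exists>\<delta>\<in>{1, - 1}. det (P 1) = \<delta> * (det (P (- 1)) * det \<Psi>)"
proof -
  define K where "K = Suc m * n"
  \<comment> \<open>In the application these are the coefficients, in the Hodge basis, of the
    projection of the second factor to its eigenspace of sign \<sigma>.\<close>
  define e where "e = (\<lambda>(\<sigma>::int) h g. \<Sum>k | k \<le> m \<and> s k = \<sigma>. G h k * Gi k g)"
  have split: "(\<Sum>k\<le>m. w (s k) * (G h k * Gi k g)) = w 1 * e 1 h g + w (- 1) * e (- 1) h g"
    for w :: "int \<Rightarrow> 'r" and h g
  proof -
    have "(\<Sum>k\<le>m. w (s k) * (G h k * Gi k g)) =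
      (\<Sum>k\<in>{k. k \<le> m \<and> s k = 1} \<union> {k. k \<le> m \<and> s k = - 1}. w (s k) * (G h k * Gi k g))"
      by (intro sum.cong) (use s in auto)
    also have "\<dots> = (\<Sum>k | k \<le> m \<and> s k = 1. w (s k) * (G h k * Gi k g)) +
        (\<Sum>k | k \<le> m \<and> s k = - 1. w (s k) * (G h k * Gi k g))"
      by (rule sum.union_disjoint) auto
    also have "\<dots> = w 1 * e 1 h g + w (- 1) * e (- 1) h g"
      by (simp add: e_def sum_distrib_left)
    finally show ?thesis .
  qed
  have plus: "e 1 h g + e (- 1) h g = of_bool (h = g)" if "h \<le> m" "g \<le> m" for h g
    using split[of "\<lambda>_. 1" h g] GGi[OF that] by simp
  have minus: "e 1 h g - e (- 1) h g = (\<Sum>k\<le>m. of_int (s k) * (G h k * Gi k g))" for h g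
    using split[of of_int h g] by simp
  \<comment> \<open>The entries of the period matrix of sign \<sigma> once the second factor has
    been moved to the Hodge basis, see \<open>PL\<close>.\<close>
  define Y where "Y = (\<lambda>\<sigma> h g p i. a \<sigma> p i * e 1 h g + a (- \<sigma>) p i * e (- 1) h g)"
  have Ymid: "Y 1 h m p i = (if h = m then a \<epsilon> p i else 0)" "Y (- 1) h m p i = (if h = m then a (- \<epsilon>) p i else 0)"
    if h: "h \<le> m" for h p i
  proof -
    \<comment> \<open>The middle vector has sign \<epsilon>: one of the two projections fixes it and
      the other kills it.\<close>
    have 1: "e 1 h m + e (- 1) h m = of_bool (h = m)" "e 1 h m - e (- 1) h m = (if h = m then of_int \<epsilon> else 0)"
      using plus[OF h order.refl] minus[of h m] mid[OF h] by auto
    have "e (- 1) h m + e (- 1) h m = (e 1 h m + e (- 1) h m) - (e 1 h m - e (- 1) h m)"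
      "e 1 h m + e 1 h m = (e 1 h m + e (- 1) h m) + (e 1 h m - e (- 1) h m)"
      by simp_all
    then have "e (- \<epsilon>) h m + e (- \<epsilon>) h m = 0"
      unfolding 1 using \<epsilon> by auto
    then have 2: "e (- \<epsilon>) h m = 0" by (rule double_eq_zero[OF two])
    then have 3: "e \<epsilon> h m = of_bool (h = m)" using \<epsilon> 1(1) by auto
    show "Y 1 h m p i = (if h = m then a \<epsilon> p i else 0)" "Y (- 1) h m p i = (if h = m then a (- \<epsilon>) p i else 0)"
      using \<epsilon> 2 3 by (auto simp: Y_def)
  qed
  \<comment> \<open>Outside the middle, the two projections of a Hodge vector have equal diagonal
    entries, and opposite entries at the conjugate vector. There \<open>J\<close> changes sign as
    well, so that it absorbs the difference.\<close>
  have Yoff: "J h * Y 1 h g p i = Y (- 1) h g p i * J g" if h: "h \<le> m" and g: "g < m" for h g p i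
  proof (cases "(\<Sum>k\<le>m. of_int (s k) * (G h k * Gi k g)) = 0")
    case True
    then have 1: "e 1 h g = e (- 1) h g" using minus[of h g] by simp
    show ?thesis
    proof (cases "h = g")
      case True
      then show ?thesis by (simp add: Y_def 1[unfolded True] algebra_simps)
    next
      case False
      then have "e 1 h g + e 1 h g = 0" using plus[OF h, of g] g 1 by simp
      then have "e 1 h g = 0" by (rule double_eq_zero[OF two])
      then show ?thesis using 1 by (simp add: Y_def)
    qed
  next
    case False
    then have "h \<noteq> g" "J h = - J g" using off[OF h g] by auto
    moreover from this have "e 1 h g = - e (- 1) h g" using plus[OF h, of g] g by (simp add: add_eq_0_iff2)
    ultimately show ?thesis by (simp add: Y_def algebra_simps)
  qed
  \<comment> \<open>\<open>L\<close> and \<open>U\<close> are the base changes \<open>Gi\<close> and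
    \<open>G\<close> of the second factor, trivial on the index of the first. \<open>E\<close>
    applies \<open>\<Psi>\<close> to the last block of columns, that of the middle vector;
    \<open>D1\<close> and \<open>D2\<close> carry the signs \<open>J\<close> of the rows and of the
    columns.\<close>
  define L where "L = mat K K (\<lambda>(r, c). if r mod n = c mod n then Gi (r div n) (c div n) else 0)"
  define U where "U = mat K K (\<lambda>(r, c). if r mod n = c mod n then G (r div n) (c div n) else 0)"
  define E where "E = mat K K (\<lambda>(r, c). if m * n \<le> r \<and> m * n \<le> c then \<Psi> $$ (r - m * n, c - m * n) else of_bool (r = c))"
  define D1 where "D1 = mat K K (\<lambda>(i, j). if i = j then J (row\<^sub>2 i) else 0)"
  define D2 where "D2 = mat K K (\<lambda>(i, j). if i = j then J (i div n) else 0)"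
  note sp = sum_pairs[where n = "Suc m" and m = n, folded K_def]
  have car: "P \<sigma> \<in> carrier_mat K K" "L \<in> carrier_mat K K" "U \<in> carrier_mat K K" "E \<in> carrier_mat K K"
    "D1 \<in> carrier_mat K K" "D2 \<in> carrier_mat K K" for \<sigma>
    by (simp_all add: P_def L_def U_def E_def D1_def D2_def K_def)
  note [simp] = car[THEN carrier_matD(1)] car[THEN carrier_matD(2)]
  have bounds: "r mod n < n" "r div n \<le> m" if "r < K" for r
    using pair_bounds[of r "Suc m" n] that by (auto simp: K_def)
  have PL: "(P \<sigma> * L) $$ (l, c) = Y \<sigma> (row\<^sub>2 l) (c div n) (row\<^sub>1 l) (c mod n)"
    if l: "l < K" and c: "c < K" for \<sigma> l c
  proof -
    have "(P \<sigma> * L) $$ (l, c) = (\<Sum>r<K. (a (\<sigma> * s (r div n)) (row\<^sub>1 l) (r mod n) * G (row\<^sub>2 l) (r div n)) *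
        (if r mod n = c mod n then Gi (r div n) (c div n) else 0))"
      using l c car by (simp add: P_def L_def scalar_prod_def atLeast0LessThan K_def)
    also have "\<dots> = (\<Sum>k<Suc m. \<Sum>i<n. (a (\<sigma> * s k) (row\<^sub>1 l) i * G (row\<^sub>2 l) k) *
        (if i = c mod n then Gi k (c div n) else 0))"
      by (rule sp)
    also have "\<dots> = (\<Sum>k<Suc m. \<Sum>i<n. if i = c mod n then a (\<sigma> * s k) (row\<^sub>1 l) i * (G (row\<^sub>2 l) k * Gi k (c div n)) else 0)"
      by (intro sum.cong) (auto simp: mult.assoc)
    also have "\<dots> = (\<Sum>k\<le>m. a (\<sigma> * s k) (row\<^sub>1 l) (c mod n) * (G (row\<^sub>2 l) k * Gi k (c div n)))"
      using bounds[OF c] by (simp add: lessThan_Suc_atMost)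
    also have "\<dots> = Y \<sigma> (row\<^sub>2 l) (c div n) (row\<^sub>1 l) (c mod n)"
      using split[of "\<lambda>\<tau>. a (\<sigma> * \<tau>) (row\<^sub>1 l) (c mod n)"] by (simp add: Y_def)
    finally show ?thesis .
  qed
  have LU: "L * U = 1\<^sub>m K"
  proof (rule eq_matI)
    fix r c assume "r < dim_row (1\<^sub>m K :: 'r mat)" "c < dim_col (1\<^sub>m K :: 'r mat)"
    then have r: "r < K" and c: "c < K" by auto
    have "(L * U) $$ (r, c) = (\<Sum>q<K. (if r mod n = q mod n then Gi (r div n) (q div n) else 0) *
        (if q mod n = c mod n then G (q div n) (c div n) else 0))"
      using r c by (simp add: L_def U_def scalar_prod_def atLeast0LessThan)
    also have "\<dots> = (\<Sum>k<Suc m. \<Sum>i<n. (if r mod n = i then Gi (r div n) k else 0) * (if i = c mod n then G k (c div n) else 0))"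
      by (rule sp)
    also have "\<dots> = (\<Sum>k<Suc m. \<Sum>i<n. if i = r mod n then (if r mod n = c mod n then Gi (r div n) k * G k (c div n) else 0) else 0)"
      by (intro sum.cong) auto
    also have "\<dots> = (\<Sum>k\<le>m. if r mod n = c mod n then Gi (r div n) k * G k (c div n) else 0)"
      using bounds[OF r] by (simp add: lessThan_Suc_atMost)
    also have "\<dots> = of_bool (r mod n = c mod n \<and> r div n = c div n)"
      using GiG[OF bounds(2)[OF r] bounds(2)[OF c]] by (cases "r mod n = c mod n") simp_all
    also have "r mod n = c mod n \<and> r div n = c div n \<longleftrightarrow> r = c" by (metis div_mult_mod_eq)
    finally show "(L * U) $$ (r, c) = 1\<^sub>m K $$ (r, c)" using r c by simp
  qed (use car in auto)
  \<comment> \<open>The two signs are compared column by column. Before the middle block this is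
    \<open>Yoff\<close>. In the middle block the rows with second index \<open>m\<close> are related
    by \<open>\<Psi>\<close>, and all other rows vanish.\<close>
  have eq: "D1 * (P 1 * L) = (P (- 1) * L) * (E * D2)"
  proof (rule eq_matI)
    fix l c assume "l < dim_row ((P (- 1) * L) * (E * D2))" "c < dim_col ((P (- 1) * L) * (E * D2))"
    then have l: "l < K" and c: "c < K" using car by auto
    have "(D1 * (P 1 * L)) $$ (l, c) = (\<Sum>q<K. (if l = q then J (row\<^sub>2 l) else 0) * (P 1 * L) $$ (q, c))"
      using l c car by (simp add: D1_def scalar_prod_def atLeast0LessThan)
    also have "\<dots> = (\<Sum>q<K. if q = l then J (row\<^sub>2 l) * (P 1 * L) $$ (l, c) else 0)"
      by (intro sum.cong) auto
    also have "\<dots> = J (row\<^sub>2 l) * (P 1 * L) $$ (l, c)" using l by simp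
    also have "\<dots> = J (row\<^sub>2 l) * Y 1 (row\<^sub>2 l) (c div n) (row\<^sub>1 l) (c mod n)" by (simp only: PL[OF l c])
    finally have lhs: "(D1 * (P 1 * L)) $$ (l, c) = J (row\<^sub>2 l) * Y 1 (row\<^sub>2 l) (c div n) (row\<^sub>1 l) (c mod n)" .
    have ED: "(E * D2) $$ (r, c) = E $$ (r, c) * J (c div n)" if r: "r < K" for r
    proof -
      have "(E * D2) $$ (r, c) = (\<Sum>q<K. E $$ (r, q) * (if q = c then J (q div n) else 0))"
        using r c car by (simp add: D2_def scalar_prod_def atLeast0LessThan)
      also have "\<dots> = (\<Sum>q<K. if q = c then E $$ (r, c) * J (c div n) else 0)"
        by (intro sum.cong) auto
      finally show ?thesis using c by simp
    qed
    have "((P (- 1) * L) * (E * D2)) $$ (l, c) = (\<Sum>r<K. (P (- 1) * L) $$ (l, r) * (E * D2) $$ (r, c))"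
      using l c car by (simp add: scalar_prod_def atLeast0LessThan)
    also have "\<dots> = (\<Sum>r<K. Y (- 1) (row\<^sub>2 l) (r div n) (row\<^sub>1 l) (r mod n) * (E $$ (r, c) * J (c div n)))"
      by (intro sum.cong) (auto simp only: lessThan_iff PL[OF l] ED)
    finally have rhs: "((P (- 1) * L) * (E * D2)) $$ (l, c) =
        (\<Sum>r<K. Y (- 1) (row\<^sub>2 l) (r div n) (row\<^sub>1 l) (r mod n) * (E $$ (r, c) * J (c div n)))" .
    have h: "row\<^sub>2 l \<le> m" using row\<^sub>2 l by (simp add: K_def)
    show "(D1 * (P 1 * L)) $$ (l, c) = ((P (- 1) * L) * (E * D2)) $$ (l, c)"
    proof (cases "c div n = m")
      case False
      then have g: "c div n < m" using bounds[OF c] by simp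
      have "c < m * n" using g by (metis div_less_iff_less_mult bounds(1)[OF c] gr_implies_not0 neq0_conv)
      then have "(\<Sum>r<K. Y (- 1) (row\<^sub>2 l) (r div n) (row\<^sub>1 l) (r mod n) * (E $$ (r, c) * J (c div n))) =
        (\<Sum>r<K. if r = c then Y (- 1) (row\<^sub>2 l) (c div n) (row\<^sub>1 l) (c mod n) * J (c div n) else 0)"
        by (intro sum.cong) (auto simp: E_def c)
      then show ?thesis unfolding lhs rhs using Yoff[OF h g] c by simp
    next
      case True
      have cm: "c = m * n + c mod n" using True by (metis div_mult_mod_eq)
      have "(\<Sum>r<K. Y (- 1) (row\<^sub>2 l) (r div n) (row\<^sub>1 l) (r mod n) * (E $$ (r, c) * J (c div n))) =
        (\<Sum>r<m * n + n. Y (- 1) (row\<^sub>2 l) (r div n) (row\<^sub>1 l) (r mod n) * E $$ (r, c))"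
        by (simp add: True J K_def add.commute)
      also have "\<dots> = (\<Sum>r<m * n. Y (- 1) (row\<^sub>2 l) (r div n) (row\<^sub>1 l) (r mod n) * E $$ (r, c)) +
        (\<Sum>i<n. Y (- 1) (row\<^sub>2 l) ((m * n + i) div n) (row\<^sub>1 l) ((m * n + i) mod n) * E $$ (m * n + i, c))"
        by (rule sum_lessThan_add)
      also have "(\<Sum>r<m * n. Y (- 1) (row\<^sub>2 l) (r div n) (row\<^sub>1 l) (r mod n) * E $$ (r, c)) = 0"
      proof (intro sum.neutral ballI)
        fix r assume "r \<in> {..<m * n}"
        then have "r < K" "\<not> m * n \<le> r" "r \<noteq> c" using cm by (auto simp: K_def)
        then have "E $$ (r, c) = 0" using c by (simp add: E_def)
        then show "Y (- 1) (row\<^sub>2 l) (r div n) (row\<^sub>1 l) (r mod n) * E $$ (r, c) = 0" by simp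
      qed
      also have "(\<Sum>i<n. Y (- 1) (row\<^sub>2 l) ((m * n + i) div n) (row\<^sub>1 l) ((m * n + i) mod n) * E $$ (m * n + i, c)) =
        (\<Sum>i<n. Y (- 1) (row\<^sub>2 l) m (row\<^sub>1 l) i * \<Psi> $$ (i, c mod n))"
      proof (intro sum.cong)
        fix i assume i: "i \<in> {..<n}"
        have "m * n + i < K" using i by (simp add: K_def)
        then have "E $$ (m * n + i, c) = \<Psi> $$ (i, c mod n)"
          using c cm unfolding E_def by (simp, metis add_diff_cancel_left' le_add1)
        then show "Y (- 1) (row\<^sub>2 l) ((m * n + i) div n) (row\<^sub>1 l) ((m * n + i) mod n) * E $$ (m * n + i, c) =
          Y (- 1) (row\<^sub>2 l) m (row\<^sub>1 l) i * \<Psi> $$ (i, c mod n)"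
          using i by (simp add: pair_code)
      qed simp
      finally have rhs': "((P (- 1) * L) * (E * D2)) $$ (l, c) =
          (\<Sum>i<n. Y (- 1) (row\<^sub>2 l) m (row\<^sub>1 l) i * \<Psi> $$ (i, c mod n))" unfolding rhs by simp
      show ?thesis
      proof (cases "row\<^sub>2 l = m")
        case rm: True
        have "l < Suc m * n" using l by (simp add: K_def)
        from \<Psi>(2)[OF this rm bounds(1)[OF c]] show ?thesis
          unfolding lhs rhs' True Ymid[OF h] by (simp add: rm J)
      next
        case False
        then show ?thesis unfolding lhs rhs' True Ymid[OF h] by simp
      qed
    qed
  qed (use car in auto)
  \<comment> \<open>The base change is the same for both signs and its determinant is a unit, so it
    cancels.\<close>
  have detLU: "det L * det U = 1" using arg_cong[OF LU, of det] by (simp add: det_mult[OF car(2,3)])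
  have "det D1 * det (P 1) = (det D1 * (det (P 1) * det L)) * det U"
    by (simp add: mult.assoc detLU)
  also have "det D1 * (det (P 1) * det L) = (det (P (- 1)) * det L) * (det E * det D2)"
    using arg_cong[OF eq, of det]
    by (simp only: det_mult[OF car(5) mult_carrier_mat[OF car(1,2)]] det_mult[OF car(1,2)]
        det_mult[OF mult_carrier_mat[OF car(1,2)] mult_carrier_mat[OF car(4,6)]] det_mult[OF car(4,6)])
  also have "\<dots> * det U = det (P (- 1)) * (det E * det D2) * (det L * det U)" by (simp only: mult_ac)
  finally have *: "det D1 * det (P 1) = det (P (- 1)) * (det E * det D2)" by (simp add: detLU)
  have E: "det E = det \<Psi>"
    unfolding E_def K_def using det_one_block[OF \<Psi>(1), of "m * n"] by (simp add: add.commute)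
  have D1: "det D1 \<in> {1, - 1}"
    unfolding D1_def det_diag by (rule prod_signs) (use J row\<^sub>2 in \<open>auto simp: K_def\<close>)
  have D2: "det D2 \<in> {1, - 1}"
    unfolding D2_def det_diag by (rule prod_signs) (use J bounds in auto)
  have "det D1 * det D1 = 1" using D1 by auto
  then have "det (P 1) = det D1 * (det D1 * det (P 1))" by (simp add: mult.assoc[symmetric])
  also have "\<dots> = (det D1 * det D2) * (det (P (- 1)) * det \<Psi>)" by (simp add: * E mult_ac)
  finally show ?thesis using D1 D2 by (intro bexI[of _ "det D1 * det D2"]) auto
qed

section \<open>Eigenbases and period matrices of the tensor product\<close>

context tensor_frame
begin

text \<open>Signs multiply, so an eigenvector of sign \<open>s j\<close> in the second factor has to
  be paired with eigenvectors of sign \<open>\<sigma> * s j\<close> in the first. All products of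
  the eigenvectors form a basis of the tensor product, and those outside the list have sign
  \<open>- \<sigma>\<close>; hence the list spans the eigenspace.\<close>

lemma tensor_eigenbasis:
  fixes v :: "int \<Rightarrow> 'b list" and b' :: "'b' list" and s :: "nat \<Rightarrow> int"
  assumes v: "\<And>\<sigma>. \<sigma> \<in> {1, - 1} \<Longrightarrow> ordered_basis (scaleB M) (M.V \<sigma>) (v \<sigma>)"
    and len: "\<And>\<sigma>. \<sigma> \<in> {1, - 1} \<Longrightarrow> length (v \<sigma>) = n"
    and b': "ordered_basis (scaleB M') UNIV b'" and len': "length b' = d'"
    and s: "\<And>j. j < d' \<Longrightarrow> s j \<in> {1, - 1}" "\<And>j. j < d' \<Longrightarrow> b' ! j \<in> M'.V (s j)"
    and \<sigma>: "\<sigma> \<in> {1, - 1}"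
  shows "ordered_basis (scaleB N) (N.V \<sigma>)
    (map (\<lambda>r. \<tau>\<^sub>B (v (\<sigma> * s (r div n)) ! (r mod n)) (b' ! (r div n))) [0..<d' * n])"
proof -
  define w where "w = v 1 @ v (- 1)"
  have lw: "length w = n + n" by (simp add: w_def len)
  define W where "W = (\<lambda>r. \<tau>\<^sub>B (w ! (r mod (n + n))) (b' ! (r div (n + n))))"
  have "quotient_module.qb (scaleB M) {0} (n + n) (\<lambda>i. w ! i)"
    using M.eigenbases_append[OF v v] lw unfolding w_def M.B.ordered_basis_UNIV_qb by simp
  moreover have "quotient_module.qb (scaleB M') {0} d' (\<lambda>j. b' ! j)"
    using b' unfolding M'.B.ordered_basis_UNIV_qb len' .
  ultimately have W: "quotient_module.qb (scaleB N) {0} (d' * (n + n)) W"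
    unfolding W_def
    by (rule tensor_product_qb[OF M.B.vector_space_axioms M'.B.vector_space_axioms N.B.vector_space_axioms tensor_B])
  interpret Q: quotient_module "scaleB N" "{0}" by unfold_locales simp
  \<comment> \<open>The term of a full expansion that belongs to the \<open>i\<close>-th vector of
    sign \<eta>. In \<open>w\<close> the vectors of sign -1 follow the \<open>n\<close> vectors of
    sign 1, hence the shift by \<open>n\<close>.\<close>
  define u where "u = (\<lambda>C \<eta> j i. scaleB N (C (j * (n + n) + (if \<eta> = 1 then i else n + i))) (\<tau>\<^sub>B (v \<eta> ! i) (b' ! j)))"
  have expand: "(\<Sum>r<d' * (n + n). scaleB N (C r) (W r)) =
      (\<Sum>j<d'. \<Sum>i<n. u C (\<sigma> * s j) j i) + (\<Sum>j<d'. \<Sum>i<n. u C (- (\<sigma> * s j)) j i)" for C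
  proof -
    have "(\<Sum>r<d' * (n + n). scaleB N (C r) (W r)) =
      (\<Sum>r<d' * (n + n). scaleB N (C (r div (n + n) * (n + n) + r mod (n + n))) (\<tau>\<^sub>B (w ! (r mod (n + n))) (b' ! (r div (n + n)))))"
      by (simp only: W_def div_mult_mod_eq)
    also have "\<dots> = (\<Sum>j<d'. \<Sum>i<n + n. scaleB N (C (j * (n + n) + i)) (\<tau>\<^sub>B (w ! i) (b' ! j)))"
      by (rule sum_pairs)
    also have "\<dots> = (\<Sum>j<d'. \<Sum>i<n. u C 1 j i + u C (- 1) j i)"
      by (simp add: sum_lessThan_add sum.distrib u_def w_def nth_append len)
    also have "\<dots> = (\<Sum>j<d'. \<Sum>i<n. u C (\<sigma> * s j) j i + u C (- (\<sigma> * s j)) j i)"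
    proof (intro sum.cong HOL.refl)
      fix j i assume "j \<in> {..<d'}"
      then have "\<sigma> * s j = 1 \<or> \<sigma> * s j = - 1" using \<sigma> s(1)[of j] by auto
      then show "u C 1 j i + u C (- 1) j i = u C (\<sigma> * s j) j i + u C (- (\<sigma> * s j)) j i"
        by (auto simp: add.commute)
    qed
    finally show ?thesis by (simp add: sum.distrib)
  qed
  have eigen: "\<tau>\<^sub>B (v \<eta> ! i) (b' ! j) \<in> N.V (\<eta> * s j)" if "\<eta> \<in> {1, - 1}" "i < n" "j < d'" for \<eta> i j
  proof -
    have "v \<eta> ! i \<in> M.V \<eta>"
      using v[OF that(1)] that(2) len[OF that(1)] unfolding M.B.ordered_basis_iff[OF M.subspace_eigen]
      by (metis nth_mem subsetD)
    then show ?thesis using s(2)[OF that(3)]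
      by (simp add: betti_eigenspace_def rho_N \<tau> mult.commute)
  qed
  have sum_eigen: "(\<Sum>j<d'. \<Sum>i<n. u C (\<eta> * s j) j i) \<in> N.V \<eta>" if "\<eta> \<in> {1, - 1}" for \<eta> C
  proof (intro N.B.subspace_sum[OF N.subspace_eigen])
    fix j i assume ij: "j \<in> {..<d'}" "i \<in> {..<n}"
    have sj: "\<eta> * s j \<in> {1, - 1}" "\<eta> * s j * s j = \<eta>" using that s(1)[of j] ij by auto
    have "\<tau>\<^sub>B (v (\<eta> * s j) ! i) (b' ! j) \<in> N.V (\<eta> * s j * s j)"
      by (rule eigen[OF sj(1)]) (use ij in auto)
    then show "u C (\<eta> * s j) j i \<in> N.V \<eta>"
      unfolding u_def sj(2) by (rule N.B.subspace_scale[OF N.subspace_eigen])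
  qed
  define E where "E = map (\<lambda>r. \<tau>\<^sub>B (v (\<sigma> * s (r div n)) ! (r mod n)) (b' ! (r div n))) [0..<d' * n]"
  have lE: "length E = d' * n" by (simp add: E_def)
  have E_sum: "(\<Sum>r<d' * n. scaleB N (c r) (E ! r)) =
      (\<Sum>j<d'. \<Sum>i<n. scaleB N (c (j * n + i)) (\<tau>\<^sub>B (v (\<sigma> * s j) ! i) (b' ! j)))" for c
  proof -
    have "(\<Sum>r<d' * n. scaleB N (c r) (E ! r)) =
      (\<Sum>r<d' * n. scaleB N (c (r div n * n + r mod n)) (\<tau>\<^sub>B (v (\<sigma> * s (r div n)) ! (r mod n)) (b' ! (r div n))))"
      by (intro sum.cong) (auto simp: E_def)
    also have "\<dots> = (\<Sum>j<d'. \<Sum>i<n. scaleB N (c (j * n + i)) (\<tau>\<^sub>B (v (\<sigma> * s j) ! i) (b' ! j)))"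
      by (rule sum_pairs)
    finally show ?thesis .
  qed
  have "set E \<subseteq> N.V \<sigma>"
  proof
    fix x assume "x \<in> set E"
    then obtain r where r: "r < d' * n" "x = \<tau>\<^sub>B (v (\<sigma> * s (r div n)) ! (r mod n)) (b' ! (r div n))"
      by (auto simp: E_def)
    note rb = pair_bounds[OF r(1)]
    have sj: "\<sigma> * s (r div n) \<in> {1, - 1}" "\<sigma> * s (r div n) * s (r div n) = \<sigma>" using \<sigma> s(1)[OF rb(2)] by auto
    show "x \<in> N.V \<sigma>" using eigen[OF sj(1) rb] unfolding sj(2) r(2) .
  qed
  moreover have "\<exists>c. x = (\<Sum>r<length E. scaleB N (c r) (E ! r))" if x: "x \<in> N.V \<sigma>" for x
  proof -
    define C where "C = Q.qc (d' * (n + n)) W x"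
    define y z where "y = (\<Sum>j<d'. \<Sum>i<n. u C (\<sigma> * s j) j i)" and "z = (\<Sum>j<d'. \<Sum>i<n. u C (- (\<sigma> * s j)) j i)"
    have "x = (\<Sum>r<d' * (n + n). scaleB N (C r) (W r))" using Q.qc_spec[OF W, of x] by (simp add: C_def)
    then have xyz: "x = y + z" unfolding expand y_def z_def .
    have "y \<in> N.V \<sigma>" unfolding y_def by (rule sum_eigen[OF \<sigma>])
    \<comment> \<open>The remaining part \<open>z\<close> lies in both eigenspaces, hence is
      0.\<close>
    then have "x - y \<in> N.V \<sigma>" by (rule N.B.subspace_diff[OF N.subspace_eigen x])
    then have "rho N z = scaleB N (of_int \<sigma>) z" by (simp add: xyz betti_eigenspace_def)
    moreover have "z \<in> N.V (- \<sigma>)" using sum_eigen[of "- \<sigma>" C] \<sigma> by (auto simp: z_def)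
    then have "rho N z = - scaleB N (of_int \<sigma>) z" by (simp add: betti_eigenspace_def)
    ultimately have "scaleB N (of_int \<sigma>) z = - scaleB N (of_int \<sigma>) z" by simp
    then have "scaleB N (2 * of_int \<sigma>) z = 0"
      by (metis N.B.scale_left_distrib add.right_inverse mult_2)
    then have "z = 0" using \<sigma> by auto
    then have "x = (\<Sum>r<d' * n. scaleB N (C ((r div n) * (n + n) + (if \<sigma> * s (r div n) = 1 then r mod n else n + r mod n))) (E ! r))"
      unfolding E_sum xyz by (auto simp: y_def u_def pair_code intro!: sum.cong)
    then show ?thesis
      unfolding lE by (rule exI[of _ "\<lambda>r. C ((r div n) * (n + n) + (if \<sigma> * s (r div n) = 1 then r mod n else n + r mod n))"])
  qed
  moreover have "\<forall>r<length E. c r = 0" if c: "(\<Sum>r<length E. scaleB N (c r) (E ! r)) = 0" for c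
  proof (intro allI impI)
    fix r assume r: "r < length E"
    then have r: "r < d' * n" by (simp add: lE)
    \<comment> \<open>The extension of \<open>c\<close> by 0 to the products of sign
      \<open>- \<sigma>\<close>, to which the independence of the full product basis
      applies.\<close>
    define C where "C = (\<lambda>q. let j = q div (n + n); i = q mod (n + n) in
      if i < n then (if \<sigma> * s j = 1 then c (j * n + i) else 0)
      else (if \<sigma> * s j = 1 then 0 else c (j * n + (i - n))))"
    have C1: "C (j * (n + n) + i) = (if \<sigma> * s j = 1 then c (j * n + i) else 0)" if "i < n" for i j
      using that by (simp add: C_def pair_code)
    have C2: "C (j * (n + n) + (n + i)) = (if \<sigma> * s j = 1 then 0 else c (j * n + i))" if "i < n" for i j
      using that pair_code(2,3)[of "n + i" "n + n" j] by (simp add: C_def)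
    have "(\<Sum>r<d' * (n + n). scaleB N (C r) (W r)) =
      (\<Sum>j<d'. \<Sum>i<n. scaleB N (c (j * n + i)) (\<tau>\<^sub>B (v (\<sigma> * s j) ! i) (b' ! j))) + (\<Sum>j<d'. \<Sum>i<n. 0)"
      unfolding expand
    proof (intro arg_cong2[where f = "(+)"] sum.cong HOL.refl)
      fix j i assume "j \<in> {..<d'}" and "i \<in> {..<n}"
      then have "\<sigma> * s j = 1 \<or> \<sigma> * s j = - 1" and i: "i < n" using \<sigma> s(1)[of j] by auto
      then show "u C (\<sigma> * s j) j i = scaleB N (c (j * n + i)) (\<tau>\<^sub>B (v (\<sigma> * s j) ! i) (b' ! j))"
        "u C (- (\<sigma> * s j)) j i = 0"
        by (auto simp: u_def C1[OF i] C2[OF i])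
    qed
    then have "(\<Sum>r<d' * (n + n). scaleB N (C r) (W r)) \<in> {0}"
      using c unfolding lE E_sum by simp
    then have C0: "C q = 0" if "q < d' * (n + n)" for q using Q.qb_indep[OF W _ that] by blast
    note rb = pair_bounds[OF r]
    have "C (r div n * (n + n) + r mod n) = 0" "C (r div n * (n + n) + (n + r mod n)) = 0"
      using rb by (intro C0 pair_code(1); simp)+
    then show "c r = 0" unfolding C1[OF rb(1)] C2[OF rb(1)] by (auto split: if_splits)
  qed
  ultimately show ?thesis
    unfolding E_def[symmetric] N.B.ordered_basis_iff[OF N.subspace_eigen] by blast
qed

end

text \<open>Both eigenspaces of \<open>M\<close> have rank \<open>n\<close>, so those of
  \<open>N\<close> have rank \<open>d' * n\<close>. One step \<open>P\<close> is thus critical for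
  both signs, and the factors \<open>CM\<close> and \<open>CN\<close> of \<open>period_eq\<close>
  are common to them, which reduces the claim to \<open>det_period_relation\<close>. Products of
  representatives avoid inverses until the period group is available.\<close>

lemma (in tensor_frame) period_ratio:
  assumes inj: "inj_on t {..<d}" and inj': "inj_on t' {..<d'}" and d: "even d" and d': "d' = Suc m"
    and mid: "{i. i < d' \<and> bar' i = i} = {m}" "2 * t' m = weight M'" "lam' m = of_int \<epsilon>" "\<epsilon> \<in> {1, - 1}"
    and crit: "critical N"
  obtains X x :: "int \<Rightarrow> 'e cx" and \<delta> where
    "\<forall>\<sigma>\<in>{1, - 1}. X \<sigma> dvd 1 \<and> x \<sigma> dvd 1 \<and>
      period N \<sigma> = {r * X \<sigma> | r. r \<in> rational_units} \<and> period M \<sigma> = {r * x \<sigma> | r. r \<in> rational_units}"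
    "\<delta> \<in> {1, - 1}" "X 1 * x (- \<epsilon>) = \<delta> * (X (- 1) * x \<epsilon>)"
proof -
  define n where "n = d div 2"
  have dn: "d = 2 * n" using d by (simp add: n_def)
  define p where "p = (weight M + 1) div 2"
  note stepM = M.critical_even[OF inj d, folded p_def]
  have cM: "card (M.below p) = n" using stepM(1) dn by simp
  have stepM': "critical_step M \<sigma> p" if "\<sigma> \<in> {1, - 1}" for \<sigma> using that stepM by auto
  have "\<exists>bs. ordered_basis (scaleB M) (M.V \<sigma>) bs" for \<sigma>
    using M.B.ex_ordered_basis[OF M.subspace_eigen] by blast
  then obtain v where v: "\<And>\<sigma>. ordered_basis (scaleB M) (M.V \<sigma>) (v \<sigma>)" by metis
  have len: "length (v \<sigma>) = n" if "\<sigma> \<in> {1, - 1}" for \<sigma>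
    using M.length_eigenbasis[OF v] stepM'[OF that] cM by (simp add: M.critical_step_iff)
  obtain b' and s :: "nat \<Rightarrow> int" where b': "ordered_basis (scaleB M') UNIV b'"
    and s: "\<forall>j<length b'. s j \<in> {1, - 1} \<and> b' ! j \<in> M'.V (s j)"
    using M'.ex_signed_basis .
  have bC: "M'.BC.qb (length b') (\<lambda>j. (b' ! j) \<otimes>\<^sub>\<rat> 1)"
    using b' qb_cext_zero[OF M'.B.vector_space_axioms] by (simp add: M'.B.ordered_basis_UNIV_qb)
  have lb': "length b' = d'" by (rule M'.BC.qb_card[OF bC M'.f_qb])
  note bC = bC[unfolded lb']
  have s: "s j \<in> {1, - 1}" "b' ! j \<in> M'.V (s j)" if "j < d'" for j
    using s that unfolding lb' by blast+
  define E where "E = (\<lambda>\<sigma>. map (\<lambda>r. \<tau>\<^sub>B (v (\<sigma> * s (r div n)) ! (r mod n)) (b' ! (r div n))) [0..<d' * n])"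
  have E: "ordered_basis (scaleB N) (N.V \<sigma>) (E \<sigma>)" if "\<sigma> \<in> {1, - 1}" for \<sigma>
    unfolding E_def by (rule tensor_eigenbasis[OF v len b' lb' s that])
  have rank: "eigen_rank N \<sigma> = d' * n" if "\<sigma> \<in> {1, - 1}" for \<sigma>
    using N.length_eigenbasis[OF E[OF that]] by (simp add: E_def)
  obtain P where P: "critical_step N 1 P" using crit by (auto simp: critical_def)
  have cN: "card (N.below P) = d' * n" using P rank[of 1] by (simp add: N.critical_step_iff)
  have stepN: "critical_step N \<sigma> P" if "\<sigma> \<in> {1, - 1}" for \<sigma>
    using cN rank[OF that] by (simp add: N.critical_step_iff)
  have cN2: "2 * card (N.below P) = d' * d" unfolding cN using dn by simp
  obtain \<kappa> where \<kappa>: "bij_betw \<kappa> {..<d' * n} (N.below P)" using N.ex_enum_below[of P] unfolding cN by blast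
  obtain \<mu> where \<mu>: "bij_betw \<mu> {..<n} (M.below p)" using M.ex_enum_below[of p] unfolding cM by blast
  define a where "a = (\<lambda>\<sigma> i j. M.BC.qc d f ((v \<sigma> ! j) \<otimes>\<^sub>\<rat> 1) i)"
  define G where "G = (\<lambda>h j. M'.BC.qc d' f' ((b' ! j) \<otimes>\<^sub>\<rat> 1) h)"
  define Gi where "Gi = (\<lambda>k g. M'.BC.qc d' (\<lambda>j. (b' ! j) \<otimes>\<^sub>\<rat> 1) (f' g) k)"
  define A where "A = (\<lambda>\<sigma>. mat n n (\<lambda>(l, j). a \<sigma> (\<mu> l) j))"
  define B where "B = (\<lambda>\<sigma>. mat (Suc m * n) (Suc m * n)
      (\<lambda>(l, r). a (\<sigma> * s (r div n)) (\<kappa> l mod d) (r mod n) * G (\<kappa> l div d) (r div n)))"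
  have Acar: "A \<sigma> \<in> carrier_mat n n" for \<sigma> by (simp add: A_def)
  obtain CM where CM: "CM dvd 1 \<and> (\<forall>\<sigma> bs. \<sigma> \<in> {1, - 1} \<longrightarrow> critical_step M \<sigma> p \<longrightarrow> ordered_basis (scaleB M) (M.V \<sigma>) bs \<longrightarrow>
    (let A = mat n n (\<lambda>(l, j). M.BC.qc d f ((bs ! j) \<otimes>\<^sub>\<rat> 1) (\<mu> l))
     in det A dvd 1 \<and> period M \<sigma> = {r * (CM * det A) | r. r \<in> rational_units}))"
    using M.period_eq[OF stepM(1), of \<mu>, unfolded cM, OF \<mu>] by (rule exE)
  have CM: "CM dvd 1" "\<And>\<sigma>. \<sigma> \<in> {1, - 1} \<Longrightarrow> det (A \<sigma>) dvd 1 \<and>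
      period M \<sigma> = {r * (CM * det (A \<sigma>)) | r. r \<in> rational_units}"
    using conjunct1[OF CM] conjunct2[OF CM, rule_format, OF _ stepM' v] unfolding Let_def A_def a_def by simp_all
  have \<kappa>b: "\<kappa> l mod d < d" "\<kappa> l div d < d'" "\<kappa> l < d' * d" "T (\<kappa> l) < P" if "l < d' * n" for l
  proof -
    have "\<kappa> l \<in> N.below P" using \<kappa> that by (auto simp: bij_betw_def)
    then show "\<kappa> l < d' * d" "T (\<kappa> l) < P" by (auto simp: N.below_def)
    then show "\<kappa> l mod d < d" "\<kappa> l div d < d'" using pair_bounds by auto
  qed
  have B: "mat (d' * n) (d' * n) (\<lambda>(l, r). N.BC.qc (d' * d) F ((E \<sigma> ! r) \<otimes>\<^sub>\<rat> 1) (\<kappa> l)) = B \<sigma>" for \<sigma>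
  proof (rule eq_matI)
    fix l r assume "l < dim_row (B \<sigma>)" "r < dim_col (B \<sigma>)"
    then have l: "l < d' * n" and r: "r < d' * n" by (auto simp: B_def d')
    have "(E \<sigma> ! r) \<otimes>\<^sub>\<rat> 1 = cext \<tau>\<^sub>B ((v (\<sigma> * s (r div n)) ! (r mod n)) \<otimes>\<^sub>\<rat> 1) ((b' ! (r div n)) \<otimes>\<^sub>\<rat> 1)"
      using r by (simp add: E_def cext_tens[OF \<tau>(1)])
    then have "N.BC.qc (d' * d) F ((E \<sigma> ! r) \<otimes>\<^sub>\<rat> 1) (\<kappa> l) =
        a (\<sigma> * s (r div n)) (\<kappa> l mod d) (r mod n) * G (\<kappa> l div d) (r div n)"
      by (simp only: F_qc[OF \<kappa>b(3)[OF l]] a_def G_def)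
    then show "mat (d' * n) (d' * n) (\<lambda>(l, r). N.BC.qc (d' * d) F ((E \<sigma> ! r) \<otimes>\<^sub>\<rat> 1) (\<kappa> l)) $$ (l, r) = B \<sigma> $$ (l, r)"
      using l r by (simp add: B_def d')
  qed (auto simp: B_def d')
  obtain CN where CN: "CN dvd 1 \<and> (\<forall>\<sigma> bs. \<sigma> \<in> {1, - 1} \<longrightarrow> critical_step N \<sigma> P \<longrightarrow> ordered_basis (scaleB N) (N.V \<sigma>) bs \<longrightarrow>
    (let A = mat (d' * n) (d' * n) (\<lambda>(l, j). N.BC.qc (d' * d) F ((bs ! j) \<otimes>\<^sub>\<rat> 1) (\<kappa> l))
     in det A dvd 1 \<and> period N \<sigma> = {r * (CN * det A) | r. r \<in> rational_units}))"
    using N.period_eq[OF cN2, of \<kappa>, unfolded cN, OF \<kappa>] by (rule exE)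
  have CN: "CN dvd 1" "\<And>\<sigma>. \<sigma> \<in> {1, - 1} \<Longrightarrow> det (B \<sigma>) dvd 1 \<and>
      period N \<sigma> = {r * (CN * det (B \<sigma>)) | r. r \<in> rational_units}"
    using conjunct1[OF CN] conjunct2[OF CN, rule_format, OF _ stepN E] unfolding Let_def B by simp_all
  have m\<epsilon>: "- \<epsilon> \<in> {1, - 1}" using mid(4) by auto
  obtain c where c: "det (A (- \<epsilon>)) * c = 1" using CM(2)[OF m\<epsilon>] by (metis dvdE)
  \<comment> \<open>The inverse of \<open>A (- \<epsilon>)\<close>, written with the adjugate, times
    \<open>A \<epsilon>\<close>. Its determinant is the ratio of the period determinants of
    \<open>M\<close>, from which the exponent \<epsilon> arises.\<close>
  define \<Psi> where "\<Psi> = c \<cdot>\<^sub>m (adj_mat (A (- \<epsilon>)) * A \<epsilon>)"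
  note adj = adj_mat[OF Acar[of "- \<epsilon>"]]
  have \<Psi>car: "\<Psi> \<in> carrier_mat n n" unfolding \<Psi>_def using adj(1) Acar by auto
  have "A (- \<epsilon>) * \<Psi> = c \<cdot>\<^sub>m (A (- \<epsilon>) * (adj_mat (A (- \<epsilon>)) * A \<epsilon>))"
    unfolding \<Psi>_def by (rule mult_smult_distrib[OF Acar mult_carrier_mat[OF adj(1) Acar]])
  also have "A (- \<epsilon>) * (adj_mat (A (- \<epsilon>)) * A \<epsilon>) = (det (A (- \<epsilon>)) \<cdot>\<^sub>m 1\<^sub>m n) * A \<epsilon>"
    unfolding assoc_mult_mat[OF Acar adj(1) Acar, symmetric] adj(2) ..
  also have "\<dots> = det (A (- \<epsilon>)) \<cdot>\<^sub>m A \<epsilon>"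
    by (simp add: mult_smult_assoc_mat[OF one_carrier_mat Acar] left_mult_one_mat[OF Acar])
  also have "c \<cdot>\<^sub>m (det (A (- \<epsilon>)) \<cdot>\<^sub>m A \<epsilon>) = A \<epsilon>"
    using c Acar[of \<epsilon>] by (intro eq_matI) (auto simp: mult.assoc[symmetric] mult.commute[of c])
  finally have A\<Psi>: "A (- \<epsilon>) * \<Psi> = A \<epsilon>" .
  \<comment> \<open>Conjugation exchanges the types below and above the middle one, so
    \<open>J\<close> changes sign between conjugate types; the middle type itself gets 1.\<close>
  define J where "J = (\<lambda>g. if t' g < t' m then - 1 else 1 :: 'e cx)"
  have two: "(2 :: 'e cx) dvd 1"
  proof -
    have e: "(2 :: 'e cx) = 2 \<otimes>\<^sub>\<rat> 1"
      using of_nat_tensor[of 2, where 'a = 'e and 'b = complex] by (simp only: of_nat_numeral)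
    have "(2 :: 'e cx) * ((1 / 2) \<otimes>\<^sub>\<rat> 1) = 1"
      unfolding e times_tens by (simp flip: one_tensor_def)
    then show ?thesis by (metis dvdI)
  qed
  \<comment> \<open>The sum is an entry of the matrix of conjugation on \<open>M'\<close>: diagonal
    with entries \<open>s\<close> in the eigenbasis, it is transported here to the Hodge
    basis.\<close>
  have signs: "(\<Sum>k\<le>m. of_int (s k) * (G h k * Gi k g)) = lam' g * of_bool (h = bar' g)"
    if h: "h \<le> m" and g: "g \<le> m" for h g
  proof -
    have hd: "h < d'" and gd: "g < d'" using h g by (auto simp: d')
    have "f' g = (\<Sum>k<d'. M'.\<sigma>B (Gi k g) ((b' ! k) \<otimes>\<^sub>\<rat> 1))"
      using M'.BC.qc_spec[OF bC, of "f' g"] by (simp add: Gi_def)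
    then have "cmap (rho M') (f' g) = (\<Sum>k<d'. cmap (rho M') (M'.\<sigma>B (Gi k g) ((b' ! k) \<otimes>\<^sub>\<rat> 1)))"
      by (simp only: M'.\<rho>C.sum)
    also have "\<dots> = (\<Sum>k<d'. M'.\<sigma>B (Gi k g * of_int (s k)) ((b' ! k) \<otimes>\<^sub>\<rat> 1))"
      by (intro sum.cong) (auto simp: M'.\<rho>C.scale M'.\<rho>_eigen_cx[OF s(2)])
    finally have "M'.BC.qc d' f' (cmap (rho M') (f' g)) h = (\<Sum>k<d'. (Gi k g * of_int (s k)) * G h k)"
      by (simp add: M'.BC.qc_sum[OF M'.f_qb _ hd] G_def)
    moreover have "M'.BC.qc d' f' (cmap (rho M') (f' g)) h = lam' g * of_bool (h = bar' g)"
      by (simp add: M'.\<rho>_f[OF gd] M'.BC.qc_scale[OF M'.f_qb hd] M'.BC.qc_base[OF M'.f_qb hd M'.bar(1)[OF gd]])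
    ultimately show ?thesis by (simp add: d' lessThan_Suc_atMost mult_ac)
  qed
  have bm: "bar' m = m" using mid(1) by blast
  have "\<exists>\<delta>\<in>{1, - 1}. det (B 1) = \<delta> * (det (B (- 1)) * det \<Psi>)"
    unfolding B_def
  proof (rule det_period_relation[where G = G and Gi = Gi and s = s and J = J and \<epsilon> = \<epsilon>, OF two])
    fix h g assume h: "h \<le> m" and g: "g \<le> m"
    then have "h < d'" "g < d'" by (auto simp: d')
    then show "(\<Sum>k\<le>m. G h k * Gi k g) = of_bool (h = g)"
      using M'.BC.qc_trans[OF M'.f_qb bC, of h "f' g"] M'.BC.qc_base[OF M'.f_qb, of h g]
      by (simp add: G_def Gi_def d' lessThan_Suc_atMost mult.commute)
  next
    fix k j assume "k \<le> m" "j \<le> m"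
    then have "k < d'" "j < d'" by (auto simp: d')
    then show "(\<Sum>h\<le>m. Gi k h * G h j) = of_bool (k = j)"
      using M'.BC.qc_trans[OF bC M'.f_qb, of k "(b' ! j) \<otimes>\<^sub>\<rat> 1"] M'.BC.qc_base[OF bC, of k j]
      by (simp add: G_def Gi_def d' lessThan_Suc_atMost mult.commute)
  next
    show "s k \<in> {1, - 1}" if "k \<le> m" for k using s(1)[of k] that by (simp add: d')
    show "J g \<in> {1, - 1}" for g by (simp add: J_def)
    show "J m = 1" by (simp add: J_def)
    show "\<epsilon> \<in> {1, - 1}" by (rule mid(4))
    show "(\<Sum>k\<le>m. of_int (s k) * (G h k * Gi k m)) = (if h = m then of_int \<epsilon> else 0)" if "h \<le> m" for h
      using signs[OF that order.refl] by (simp add: bm mid(3))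
  next
    fix h g assume h: "h \<le> m" and g: "g < m" and "(\<Sum>k\<le>m. of_int (s k) * (G h k * Gi k g)) \<noteq> 0"
    then have hb: "h = bar' g" using signs[OF h, of g] by (cases "h = bar' g") auto
    have gd: "g < d'" "m < d'" using g by (auto simp: d')
    have "bar' g \<noteq> g"
    proof
      assume "bar' g = g"
      then have "g \<in> {i. i < d' \<and> bar' i = i}" using gd by simp
      then show False using mid(1) g by simp
    qed
    moreover have "t' g \<noteq> t' m" using inj_onD[OF inj', of g m] gd g by auto
    moreover have "t' (bar' g) = 2 * t' m - t' g" using M'.bar(3)[OF gd(1)] mid(2) by simp
    ultimately show "h \<noteq> g \<and> J h = - J g" by (auto simp: hb J_def)
  next
    show "\<kappa> l div d \<le> m" if "l < Suc m * n" for l using \<kappa>b(2)[of l] that by (simp add: d')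
    show "\<Psi> \<in> carrier_mat n n" by (rule \<Psi>car)
  next
    \<comment> \<open>Criticality of \<open>N\<close> enters here. A row over the middle vector and
      its conjugate lie on different sides of the step \<open>P\<close>, so the level of
      \<open>q\<close> is below half the weight of \<open>M\<close>; hence the row is one of the
      rows of \<open>A\<close>.\<close>
    fix l i assume l: "l < Suc m * n" and row: "\<kappa> l div d = m" and i: "i < n"
    have l': "l < d' * n" using l by (simp add: d')
    define q where "q = \<kappa> l mod d"
    have qd: "q < d" using \<kappa>b(1)[OF l'] by (simp add: q_def)
    have "\<kappa> l \<in> N.below P" using \<kappa>b[OF l'] by (simp add: N.below_def)
    from N.bar_notin_below[OF cN2 this] have "m * d + bar q \<notin> N.below P"
      unfolding row bm q_def .
    moreover have "m * d + bar q < d' * d" by (rule pair_code(1)[OF M.bar(1)[OF qd]]) (simp add: d')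
    ultimately have "\<not> T (m * d + bar q) < P" unfolding N.below_def by blast
    then have "\<not> t (bar q) + t' m < P"
      using M.bar(1)[OF qd] by (simp add: T_def pair_code)
    moreover have "t q + t' m < P" using \<kappa>b(4)[OF l'] by (simp add: T_def row q_def)
    ultimately have "2 * t q < weight M" using M.bar(3)[OF qd] by simp
    then have "q \<in> M.below p" using qd by (auto simp: M.below_def p_def)
    then obtain q' where q': "q' < n" "q = \<mu> q'" using \<mu> by (auto simp: bij_betw_def)
    have "(\<Sum>l'<n. a (- \<epsilon>) (\<kappa> l mod d) l' * \<Psi> $$ (l', i)) = (A (- \<epsilon>) * \<Psi>) $$ (q', i)"
      using q' i \<Psi>car by (simp add: A_def scalar_prod_def atLeast0LessThan flip: q_def)
    also have "\<dots> = a \<epsilon> (\<kappa> l mod d) i"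
      unfolding A\<Psi> using q' i by (simp add: A_def flip: q_def)
    finally show "(\<Sum>l'<n. a (- \<epsilon>) (\<kappa> l mod d) l' * \<Psi> $$ (l', i)) = a \<epsilon> (\<kappa> l mod d) i" .
  qed
  then obtain \<delta> where \<delta>: "\<delta> \<in> {1, - 1}" "det (B 1) = \<delta> * (det (B (- 1)) * det \<Psi>)" by blast
  have det\<Psi>: "det (A (- \<epsilon>)) * det \<Psi> = det (A \<epsilon>)"
    using arg_cong[OF A\<Psi>, of det] by (simp add: det_mult[OF Acar \<Psi>car])
  show thesis
  proof (rule that[of "\<lambda>\<sigma>. CN * det (B \<sigma>)" "\<lambda>\<sigma>. CM * det (A \<sigma>)" \<delta>], rule ballI)
    fix \<sigma> :: int assume \<sigma>: "\<sigma> \<in> {1, - 1}"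
    have "CN * det (B \<sigma>) dvd 1" "CM * det (A \<sigma>) dvd 1"
      using CN(1) CN(2)[OF \<sigma>] CM(1) CM(2)[OF \<sigma>] by (auto simp: is_unit_mult_iff)
    then show "CN * det (B \<sigma>) dvd 1 \<and> CM * det (A \<sigma>) dvd 1 \<and>
        period N \<sigma> = {r * (CN * det (B \<sigma>)) | r. r \<in> rational_units} \<and>
        period M \<sigma> = {r * (CM * det (A \<sigma>)) | r. r \<in> rational_units}"
      using conjunct2[OF CN(2)[OF \<sigma>]] conjunct2[OF CM(2)[OF \<sigma>]] by (intro conjI)
  next
    show "\<delta> \<in> {1, - 1}" by (rule \<delta>(1))
    show "CN * det (B 1) * (CM * det (A (- \<epsilon>))) = \<delta> * (CN * det (B (- 1)) * (CM * det (A \<epsilon>)))"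
      unfolding \<delta>(2) det\<Psi>[symmetric] by (simp only: mult_ac)
  qed
qed

section \<open>The group of periods\<close>

lemma comm_group_cx_units: "comm_group (cx_units :: 'e::field_char_0 cx monoid)"
proof (rule comm_groupI)
  fix x :: "'e cx" assume "x \<in> carrier cx_units"
  then have "x dvd 1" by (simp add: cx_units_def)
  then obtain y where y: "1 = x * y" by (elim dvdE)
  then have "y * x = 1" by (simp add: mult.commute)
  moreover from this have "y dvd 1" by (metis dvdI)
  ultimately show "\<exists>y\<in>carrier cx_units. y \<otimes>\<^bsub>cx_units\<^esub> x = \<one>\<^bsub>cx_units\<^esub>"
    by (auto simp: cx_units_def)
qed (auto simp: cx_units_def mult_ac is_unit_mult_iff)

lemma rational_unitsI: "e \<noteq> 0 \<Longrightarrow> e \<otimes>\<^sub>\<rat> 1 \<in> rational_units"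
  by (auto simp: rational_units_def)

lemma subgroup_rational_units: "subgroup rational_units (cx_units :: 'e::field_char_0 cx monoid)"
proof -
  have inv: "(e \<otimes>\<^sub>\<rat> 1) * ((1 / e) \<otimes>\<^sub>\<rat> 1) = (1 :: 'e cx)" if "e \<noteq> 0" for e :: 'e
    using that by (simp add: times_tens flip: one_tensor_def)
  interpret comm_group "cx_units :: 'e cx monoid" by (rule comm_group_cx_units)
  have unit: "r dvd 1" if r: "r \<in> rational_units" for r :: "'e cx"
  proof -
    obtain e where "r = e \<otimes>\<^sub>\<rat> 1" "e \<noteq> 0" using r by (auto simp: rational_units_def)
    then show ?thesis using inv[of e] by (intro dvdI[of _ _ "(1 / e) \<otimes>\<^sub>\<rat> 1"]) simp
  qed
  show ?thesis
  proof (rule subgroupI)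
    show "rational_units \<subseteq> carrier (cx_units :: 'e cx monoid)"
      using unit by (auto simp: cx_units_def)
    have "1 \<otimes>\<^sub>\<rat> 1 \<in> (rational_units :: 'e cx set)" by (rule rational_unitsI) simp
    then show "rational_units \<noteq> ({} :: 'e cx set)" by blast
  next
    fix r :: "'e cx" assume r: "r \<in> rational_units"
    then obtain e where e: "r = e \<otimes>\<^sub>\<rat> 1" "e \<noteq> 0" by (auto simp: rational_units_def)
    have mem: "(1 / e) \<otimes>\<^sub>\<rat> 1 \<in> (rational_units :: 'e cx set)" by (rule rational_unitsI) (use e in simp)
    have "inv\<^bsub>cx_units\<^esub> r = (1 / e) \<otimes>\<^sub>\<rat> 1"
    proof (rule inv_equality)
      show "((1 / e) \<otimes>\<^sub>\<rat> 1) \<otimes>\<^bsub>cx_units\<^esub> r = \<one>\<^bsub>cx_units\<^esub>"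
        using inv[OF e(2)] by (simp add: cx_units_def e mult.commute)
    qed (use unit[OF r] unit[OF mem] in \<open>auto simp: cx_units_def\<close>)
    then show "inv\<^bsub>cx_units\<^esub> r \<in> rational_units" using mem by simp
  next
    fix r r' :: "'e cx" assume "r \<in> rational_units" "r' \<in> rational_units"
    then obtain e e' where "r = e \<otimes>\<^sub>\<rat> 1" "e \<noteq> 0" "r' = e' \<otimes>\<^sub>\<rat> 1" "e' \<noteq> 0" by (auto simp: rational_units_def)
    then show "r \<otimes>\<^bsub>cx_units\<^esub> r' \<in> rational_units"
      by (auto simp: cx_units_def times_tens intro!: rational_unitsI)
  qed
qed

lemma comm_group_period_group: "comm_group (period_group :: 'e::field_char_0 cx set monoid)"
  unfolding period_group_def by (rule comm_group.abelian_FactGroup[OF comm_group_cx_units subgroup_rational_units])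

lemma (in comm_group) ratio_eqI:
  assumes "a \<in> carrier G" "b \<in> carrier G" "c \<in> carrier G" "d \<in> carrier G" "a \<otimes> d = b \<otimes> c"
  shows "a \<otimes> inv b = c \<otimes> inv d"
proof -
  have "a = b \<otimes> c \<otimes> inv d" using assms by (simp add: inv_solve_right)
  then have "a \<otimes> inv b = b \<otimes> c \<otimes> inv d \<otimes> inv b" by simp
  also have "\<dots> = c \<otimes> inv d \<otimes> (b \<otimes> inv b)" using assms by (simp only: m_ac m_closed inv_closed)
  finally show ?thesis using assms by simp
qed

definition period_class :: "'e::field_char_0 cx \<Rightarrow> 'e cx set"
  where "period_class x = {r * x | r. r \<in> rational_units}"

lemma period_class_hom: "(period_class :: 'e::field_char_0 cx \<Rightarrow> _) \<in> hom cx_units period_group"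
proof -
  interpret normal rational_units "cx_units :: 'e cx monoid"
    by (rule comm_group.subgroup_imp_normal[OF comm_group_cx_units subgroup_rational_units])
  have "period_class = (\<lambda>x :: 'e cx. rational_units #>\<^bsub>cx_units\<^esub> x)"
    by (auto simp: fun_eq_iff period_class_def r_coset_def cx_units_def)
  then show ?thesis using r_coset_hom_Mod by (simp add: period_group_def)
qed

lemma period_class_closed: "x dvd 1 \<Longrightarrow> period_class x \<in> carrier period_group"
  using hom_in_carrier[OF period_class_hom, of x] by (simp add: cx_units_def)

lemma period_class_mult:
  "x dvd 1 \<Longrightarrow> y dvd 1 \<Longrightarrow> period_class (x * y) = period_class x \<otimes>\<^bsub>period_group\<^esub> period_class y"
  using hom_mult[OF period_class_hom, of x y] by (simp add: cx_units_def)

text \<open>A sign is a unit of the coefficient field, so it is invisible in the period group. This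
  is why \<open>det_period_relation\<close> may leave its sign undetermined.\<close>

lemma period_class_sign:
  fixes x :: "'e::field_char_0 cx"
  assumes "\<delta> \<in> {1, - 1}"
  shows "period_class (\<delta> * x) = period_class x"
proof -
  have "r * (- x) \<in> period_class x" if r: "r \<in> rational_units" for r x :: "'e cx"
  proof -
    obtain e where e: "r = e \<otimes>\<^sub>\<rat> 1" "e \<noteq> 0" using r by (auto simp: rational_units_def)
    have "r * (- x) = ((- e) \<otimes>\<^sub>\<rat> 1) * x" by (simp add: e emb.hom_uminus)
    then show ?thesis using rational_unitsI[of "- e"] e(2) by (auto simp: period_class_def)
  qed
  then have sub: "period_class (- x) \<subseteq> period_class x" for x :: "'e cx"
    unfolding period_class_def[of "- x"] by clarify
  have "period_class (- x) = period_class x"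
    using sub[of x] sub[of "- x"] unfolding minus_minus by (rule equalityI)
  then show ?thesis using assms by (elim insertE) simp_all
qed

lemma (in pure) hodge_generatedI:
  assumes T: "\<And>p. p \<in> T \<longleftrightarrow> H p \<noteq> {0}" and e: "\<And>p. p \<in> T \<Longrightarrow> H p = range (\<lambda>r. \<sigma>B r (e p))"
    and h: "bij_betw h {..<d} T"
  shows "hodge_generated M d (\<lambda>i. e (h i)) h"
  unfolding hodge_generated_def
proof (intro conjI allI impI ballI)
  fix i assume "i < d"
  then have "h i \<in> T" using h by (auto simp: bij_betw_def)
  then have "\<sigma>B 1 (e (h i)) \<in> H (h i)" using e by blast
  then show "e (h i) \<in> H (h i)" by simp
next
  fix a b x assume x: "x \<in> hodge M a b" "x \<noteq> 0"
  have "a + b = weight M"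
  proof (rule ccontr)
    assume "a + b \<noteq> weight M"
    then have "hodge M a b = {0}" using pure by (simp add: pure_motive_def)
    then show False using x by simp
  qed
  then have b: "b = weight M - a" by simp
  then have "a \<in> T" using x T by auto
  then have "x \<in> range (\<lambda>r. \<sigma>B r (e a))" using x(1) e unfolding b by blast
  moreover obtain i where "i < d" "h i = a" using h \<open>a \<in> T\<close> by (auto simp: bij_betw_def)
  ultimately show "\<exists>i<d. \<exists>r. h i = a \<and> x = \<sigma>B r (e (h i))" by blast
qed

theorem theorem3p1:
  fixes M :: "('e::field_char_0, 'b::ab_group_add, 'd::ab_group_add) motive"
    and M' :: "('e, 'b'::ab_group_add, 'd'::ab_group_add) motive"
    and MM' :: "('e, 'b''::ab_group_add, 'd''::ab_group_add) motive"
  assumes "number_field TYPE('e)"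
    and "pure_motive M" and "pure_motive M'"
    and "is_tensor_motive M M' MM'"
    and "even (motive_rank M)" and "odd (motive_rank M')"
    and "\<And>p q. hodge_number M p q \<noteq> 0 \<Longrightarrow> hodge_number M p q = 1"
    and "\<And>p q. hodge_number M' p q \<noteq> 0 \<Longrightarrow> hodge_number M' p q = 1"
    and "critical MM'"
  shows "critical M \<and> critical M' \<and> (\<exists>!\<epsilon>. is_middle_sign M' \<epsilon>) \<and>
    {period M 1, period M (- 1), period MM' 1, period MM' (- 1)} \<subseteq> carrier period_group \<and>
    period MM' 1 \<otimes>\<^bsub>period_group\<^esub> inv\<^bsub>period_group\<^esub> period MM' (- 1) =
      (period M 1 \<otimes>\<^bsub>period_group\<^esub> inv\<^bsub>period_group\<^esub> period M (- 1))
        [^]\<^bsub>period_group\<^esub> middle_sign M'"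
proof -
  interpret M: pure M by (rule pure.intro[OF assms(2)])
  interpret M': pure M' by (rule pure.intro[OF assms(3)])
  obtain \<tau>\<^sub>B where \<tau>: "is_tensor_product (scaleB M) (scaleB M') (scaleB MM') \<tau>\<^sub>B"
    "\<And>v w. rho MM' (\<tau>\<^sub>B v w) = \<tau>\<^sub>B (rho M v) (rho M' w)"
    "\<And>p q. hodge MM' p q = Modules.module.span (cext (scaleB MM'))
        {cext \<tau>\<^sub>B x y | x y a b. x \<in> hodge M a b \<and> y \<in> hodge M' (p - a) (q - b)}"
    and N: "pure_motive MM'" "weight MM' = weight M + weight M'"
    using assms(4) unfolding is_tensor_motive_def by blast
  interpret N: pure MM' by (rule pure.intro[OF N(1)])

  obtain T e where T: "finite T" "\<And>p. p \<in> T \<longleftrightarrow> M.H p \<noteq> {0}"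
    and e: "\<And>p. p \<in> T \<Longrightarrow> M.H p = range (\<lambda>r. M.\<sigma>B r (e p))"
    and fr: "\<And>d h. bij_betw h {..<d} T \<Longrightarrow> \<exists>bar lam. framed_motive M d (\<lambda>i. e (h i)) h bar lam"
    using M.ex_hodge_generators[OF assms(7)] by metis
  obtain d h where h: "bij_betw h {..<d::nat} T"
    using ex_bij_betw_nat_finite[OF T(1)] by (auto simp: atLeast0LessThan)
  obtain bar lam where "framed_motive M d (\<lambda>i. e (h i)) h bar lam" using fr[OF h] by blast
  then interpret M: framed_motive M d "\<lambda>i. e (h i)" h bar lam .
  have inj: "inj_on h {..<d}" using h by (simp add: bij_betw_def)
  have d: "even d" using M.eigen_ranks(2) assms(5) by simp

  obtain T' e' where T': "finite T'" "\<And>p. p \<in> T' \<longleftrightarrow> M'.H p \<noteq> {0}"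
    and e': "\<And>p. p \<in> T' \<Longrightarrow> M'.H p = range (\<lambda>r. M'.\<sigma>B r (e' p))"
    and fr': "\<And>d h. bij_betw h {..<d} T' \<Longrightarrow> \<exists>bar lam. framed_motive M' d (\<lambda>i. e' (h i)) h bar lam"
    using M'.ex_hodge_generators[OF assms(8)] by metis
  obtain d' h\<^sub>0 where h\<^sub>0: "bij_betw h\<^sub>0 {..<d'::nat} T'"
    using ex_bij_betw_nat_finite[OF T'(1)] by (auto simp: atLeast0LessThan)
  have inj\<^sub>0: "inj_on h\<^sub>0 {..<d'}" using h\<^sub>0 by (simp add: bij_betw_def)
  obtain bar\<^sub>0 lam\<^sub>0 where "framed_motive M' d' (\<lambda>i. e' (h\<^sub>0 i)) h\<^sub>0 bar\<^sub>0 lam\<^sub>0" using fr'[OF h\<^sub>0] by blast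
  then interpret M0: framed_motive M' d' "\<lambda>i. e' (h\<^sub>0 i)" h\<^sub>0 bar\<^sub>0 lam\<^sub>0 .
  have odd: "odd d'" using M0.eigen_ranks(2) assms(6) by simp
  then obtain m where d': "d' = Suc m" by (cases d') auto
  obtain m\<^sub>0 where m\<^sub>0: "m\<^sub>0 < d'" "2 * h\<^sub>0 m\<^sub>0 = weight M'" using M0.critical_odd(2)[OF inj\<^sub>0 odd] by blast
  \<comment> \<open>The transposition moves the middle type to the last position \<open>m\<close>,
    where \<open>det_period_relation\<close> expects it; the frame for \<open>h\<^sub>0\<close>
    served to locate it.\<close>
  define h' where "h' = h\<^sub>0 \<circ> Transposition.transpose m\<^sub>0 m"
  have h': "bij_betw h' {..<d'} T'"
    unfolding h'_def
    by (rule bij_betw_trans[OF permutes_imp_bij[OF permutes_swap_id] h\<^sub>0]) (use m\<^sub>0 d' in auto)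
  have inj': "inj_on h' {..<d'}" using h' by (simp add: bij_betw_def)
  have hm: "2 * h' m = weight M'" using m\<^sub>0 by (simp add: h'_def)
  obtain bar' lam' where "framed_motive M' d' (\<lambda>i. e' (h' i)) h' bar' lam'" using fr'[OF h'] by blast
  then interpret M': framed_motive M' d' "\<lambda>i. e' (h' i)" h' bar' lam' .
  obtain m\<^sub>1 \<epsilon> where m\<^sub>1: "m\<^sub>1 < d'" "2 * h' m\<^sub>1 = weight M'" "{i. i < d' \<and> bar' i = i} = {m\<^sub>1}" "lam' m\<^sub>1 = of_int \<epsilon>"
    and \<epsilon>: "\<epsilon> \<in> {1, - 1}" using M'.critical_odd(2)[OF inj' odd] by blast
  \<comment> \<open>The frame for \<open>h'\<close> comes with its own \<open>bar'\<close> and its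
    own middle index; that index has the middle level, so by injectivity it is
    \<open>m\<close>.\<close>
  have "h' m\<^sub>1 = h' m" using hm m\<^sub>1(2) by simp
  then have "m\<^sub>1 = m" using inj' m\<^sub>1(1) d' by (auto simp: inj_on_def)
  note m = m\<^sub>1[unfolded this]
  have H': "hodge M' (h' m) (h' m) = M'.H (h' m)" using m(2) by (simp flip: m(2))
  have "h' m \<in> T'" using h' m(1) by (auto simp: bij_betw_def)
  then have gen: "hodge M' (h' m) (h' m) = range (\<lambda>r. M'.\<sigma>B r (e' (h' m)))" "hodge M' (h' m) (h' m) \<noteq> {0}"
    unfolding H' using e' T'(2) by auto
  have bm: "bar' m = m" using m(3) by blast
  note sign = M'.middle_sign_eq[OF m(1) bm m(2,4) \<epsilon> gen]

  interpret X: tensor_frame M d "\<lambda>i. e (h i)" h bar lam M' d' "\<lambda>i. e' (h' i)" h' bar' lam' MM' \<tau>\<^sub>B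
    by unfold_locales (use N(2) \<tau> M.hodge_generatedI[OF T(2) e h] M'.hodge_generatedI[OF T'(2) e' h'] in auto)
  obtain X x :: "int \<Rightarrow> 'e cx" and \<delta> where
    X: "\<forall>\<sigma>\<in>{1, - 1}. X \<sigma> dvd 1 \<and> x \<sigma> dvd 1 \<and>
      period MM' \<sigma> = {r * X \<sigma> | r. r \<in> rational_units} \<and> period M \<sigma> = {r * x \<sigma> | r. r \<in> rational_units}"
    and \<delta>: "\<delta> \<in> {1, - 1}" and rel: "X 1 * x (- \<epsilon>) = \<delta> * (X (- 1) * x \<epsilon>)"
    by (rule X.period_ratio[OF inj inj' d d' m(3,2,4) \<epsilon> assms(9)])

  have unit: "X \<sigma> dvd 1" "x \<sigma> dvd 1" and per: "period MM' \<sigma> = period_class (X \<sigma>)" "period M \<sigma> = period_class (x \<sigma>)"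
    if "\<sigma> \<in> {1, - 1}" for \<sigma>
    using bspec[OF X that] by (simp_all add: period_class_def)
  have closed: "period MM' \<sigma> \<in> carrier period_group" "period M \<sigma> \<in> carrier period_group" if "\<sigma> \<in> {1, - 1}" for \<sigma>
    unfolding per[OF that] by (rule period_class_closed[OF unit(1)[OF that]] period_class_closed[OF unit(2)[OF that]])+
  have m\<epsilon>: "- \<epsilon> \<in> {1, - 1}" using \<epsilon> by auto
  have one: "1 \<in> {1, - 1 :: int}" "- 1 \<in> {1, - 1 :: int}" by auto
  interpret G: comm_group "period_group :: 'e cx set monoid" by (rule comm_group_period_group)
  have "period_class (X 1 * x (- \<epsilon>)) = period_class (X (- 1) * x \<epsilon>)"
    unfolding rel by (rule period_class_sign[OF \<delta>])
  then have "period MM' 1 \<otimes>\<^bsub>period_group\<^esub> period M (- \<epsilon>) = period MM' (- 1) \<otimes>\<^bsub>period_group\<^esub> period M \<epsilon>"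
    unfolding per[OF one(1)] per[OF one(2)] per[OF \<epsilon>] per[OF m\<epsilon>]
      period_class_mult[OF unit(1)[OF one(1)] unit(2)[OF m\<epsilon>]] period_class_mult[OF unit(1)[OF one(2)] unit(2)[OF \<epsilon>]] .
  then have "period MM' 1 \<otimes>\<^bsub>period_group\<^esub> inv\<^bsub>period_group\<^esub> period MM' (- 1) =
      period M \<epsilon> \<otimes>\<^bsub>period_group\<^esub> inv\<^bsub>period_group\<^esub> period M (- \<epsilon>)"
    by (rule G.ratio_eqI[OF closed(1)[OF one(1)] closed(1)[OF one(2)] closed(2)[OF \<epsilon>] closed(2)[OF m\<epsilon>]])
  \<comment> \<open>For \<epsilon> equal to -1 the two periods of \<open>M\<close> are exchanged,
    which inverts their quotient.\<close>
  also have "\<dots> = (period M 1 \<otimes>\<^bsub>period_group\<^esub> inv\<^bsub>period_group\<^esub> period M (- 1)) [^]\<^bsub>period_group\<^esub> \<epsilon>"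
  proof (cases "\<epsilon> = 1")
    case True
    then show ?thesis using closed(2)[OF one(1)] closed(2)[OF one(2)] by simp
  next
    case False
    then have "\<epsilon> = - 1" using \<epsilon> by simp
    then show ?thesis using closed(2)[OF one(1)] closed(2)[OF one(2)]
      by (simp add: G.int_pow_neg G.inv_mult G.m_comm)
  qed
  finally have ratio: "period MM' 1 \<otimes>\<^bsub>period_group\<^esub> inv\<^bsub>period_group\<^esub> period MM' (- 1) =
      (period M 1 \<otimes>\<^bsub>period_group\<^esub> inv\<^bsub>period_group\<^esub> period M (- 1)) [^]\<^bsub>period_group\<^esub> \<epsilon>" .
  have "critical M" using M.critical_even[OF inj d] by (auto simp: critical_def)
  moreover have "critical M'" by (rule M'.critical_odd(1)[OF inj' odd])
  ultimately show ?thesis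
    using sign ratio closed[OF one(1)] closed[OF one(2)] by simp
qed

end
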